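(* Let $(A,\Delta,\epsilon,\Phi,\mathcal R)$ be a quasi-triangular quasi-Hopf superalgebra over a field $K$ (with antipode $S$ and canonical elements $\alpha,\beta$), and let $F\in A\otimes A$ be an invertible homogeneous element with $(\epsilon\otimes1)F=1=(1\otimes\epsilon)F$. Put $$\Delta_F(a)=F\Delta(a)F^{-1}\ (a\in A),\qquad \Phi_F=(F\otimes1)\cdot(\Delta\otimes1)F\cdot\Phi\cdot(1\otimes\Delta)F^{-1}\cdot(1\otimes F^{-1}),\qquad \mathcal R_F=F^T\,\mathcal R\,F^{-1},$$ where $F^T=T(F)$ with $T$ the graded twist map. Then $(A,\Delta_F,\epsilon,\Phi_F,\mathcal R_F)$, with antipode $S$ and canonical elements $\alpha_F=m\cdot(1\otimes\alpha)(S\otimes1)F^{-1}$, $\beta_F=m\cdot(1\otimes\beta)(1\otimes S)F$, is also a quasi-triangular quasi-Hopf superalgebra.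
   Context: All algebras are unital, associative and $\mathbf{Z}_2$-graded; $[a]\in\mathbf{Z}_2$ denotes the degree of a homogeneous element $a$. Tensor products carry the graded multiplication $(a\otimes b)(a'\otimes b')=(-1)^{[b][a']}aa'\otimes bb'$ for homogeneous elements (similarly for more factors). Homomorphisms and anti-homomorphisms of graded algebras preserve degree, the field $K$ being in degree $0$ (so $\epsilon$ vanishes on odd elements). In formulas such as $(\Delta\otimes 1)$, "$1$" denotes the identity map when it acts as a map, and the unit of $A$ when it is an element; $A\otimes K$ and $K\otimes A$ are identified with $A$. A $\mathbf{Z}_2$-graded quasi-bialgebra $(A,\Delta,\epsilon,\Phi)$ is a $\mathbf{Z}_2$-graded unital associative algebra $A$ over $K$ with algebra homomorphisms $\epsilon:A\to K$ and $\Delta:A\to A\otimes A$ and an invertible homogeneous element $\Phi\in A\otimes A\otimes A$ such that - $(1\otimes\Delta)\Delta(a)=\Phi^{-1}\,(\Delta\otimes 1)\Delta(a)\,\Phi$ for all $a\in A$; - $(\Delta\otimes 1\otimes 1)\Phi\cdot(1\otimes 1\otimes\Delta)\Phi=(\Phi\otimes 1)\cdot(1\otimes\Delta\otimes 1)\Phi\cdot(1\otimes\Phi)$; - $(\epsilon\otimes 1)\Delta=1=(1\otimes\epsilon)\Delta$ (identity map of $A$); - $(1\otimes\epsilon\otimes 1)\Phi=1$. A quasi-Hopf superalgebra is a $\mathbf{Z}_2$-graded quasi-bialgebra equipped with a graded algebra anti-homomorphism $S:A\to A$ (antipode), i.e. $S(ab)=(-1)^{[a][b]}S(b)S(a)$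 for homogeneous $a,b$, and even canonical elements $\alpha,\beta\in A$ such that, with $m:A\otimes A\to A$ the product map, - $m\cdot(1\otimes\alpha)(S\otimes 1)\Delta(a)=\epsilon(a)\alpha$ for all $a$, i.e. $\sum S(a_{(1)})\alpha a_{(2)}=\epsilon(a)\alpha$ where $\Delta(a)=\sum a_{(1)}\otimes a_{(2)}$; - $m\cdot(1\otimes\beta)(1\otimes S)\Delta(a)=\epsilon(a)\beta$ for all $a$, i.e. $\sum a_{(1)}\beta S(a_{(2)})=\epsilon(a)\beta$; - $m\cdot(m\otimes1)\cdot(1\otimes\beta\otimes\alpha)(1\otimes S\otimes1)\Phi^{-1}=1$, i.e. $\sum\bar X_\nu\beta S(\bar Y_\nu)\alpha\bar Z_\nu=1$ where $\Phi^{-1}=\sum\bar X_\nu\otimes\bar Y_\nu\otimes\bar Z_\nu$; - $m\cdot(m\otimes1)\cdot(S\otimes1\otimes1)(1\otimes\alpha\otimes\beta)(1\otimes1\otimes S)\Phi=1$, i.e. $\sum S(X_\nu)\alpha Y_\nu\beta S(Z_\nu)=1$ where $\Phi=\sum X_\nu\otimes Y_\nu\otimes Z_\nu$. Explicitly, if $F=\sum_i f_i\otimes f^i$ and $F^{-1}=\sum_i\bar f_i\otimes\bar f^i$, then $\alpha_F=\sum_iS(\bar f_i)\alpha\bar f^i$ and $\beta_F=\sum_i f_i\beta S(f^i)$. The graded twist map is $T(a\otimes b)=(-1)^{[a][b]}b\otimes a$ for homogeneous $a,b$, and $\Delta^T=T\cdot\Delta$. Index notation: $\mathcal R_{12}=\mathcal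 R\otimes1$, $\mathcal R_{23}=1\otimes\mathcal R$, $\mathcal R_{13}=(1\otimes T)\mathcal R_{12}$. Further $\Phi_{123}=\Phi$, $\Phi_{132}=(1\otimes T)\Phi$, $\Phi_{213}=(T\otimes1)\Phi$, $\Phi_{312}=(T\otimes1)(1\otimes T)\Phi$, $\Phi_{231}=(1\otimes T)(T\otimes1)\Phi$, and $\Phi^{-1}_{ijk}=(\Phi_{ijk})^{-1}$. (Thus, up to signs, $\Phi_{312}=\sum Z\otimes X\otimes Y$ and $\Phi_{231}=\sum Y\otimes Z\otimes X$ for $\Phi=\sum X\otimes Y\otimes Z$.) A quasi-Hopf superalgebra $(A,\Delta,\epsilon,\Phi)$ is quasi-triangular, with $\mathcal R$, if $\mathcal R\in A\otimes A$ is an invertible homogeneous element such that - $\Delta^T(a)\mathcal R=\mathcal R\Delta(a)$ for all $a\in A$; - $(\Delta\otimes1)\mathcal R=\Phi^{-1}_{231}\mathcal R_{13}\Phi_{132}\mathcal R_{23}\Phi^{-1}_{123}$; - $(1\otimes\Delta)\mathcal R=\Phi_{312}\mathcal R_{13}\Phi^{-1}_{213}\mathcal R_{12}\Phi_{123}$. *)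

theory Defs
  imports Complex_Main "HOL-Library.Poly_Mapping" "HOL-Library.Z2"
begin

section \<open>Formal sums of words\<close>

text \<open>The free vector space on the words over \<open>'a\<close> is \<open>'a list \<Rightarrow>\<^sub>0 'k\<close>; the word
  \<open>[x\<^sub>1, \<dots>, x\<^sub>n]\<close> is going to represent the pure tensor \<open>x\<^sub>1 \<otimes> \<dots> \<otimes> x\<^sub>n\<close>.\<close>

type_synonym ('k, 'a) formal = "'a list \<Rightarrow>\<^sub>0 'k"

abbreviation word :: "'a list \<Rightarrow> ('k::field, 'a) formal" where
  "word xs \<equiv> Poly_Mapping.single xs 1"

definition fscale :: "'k::field \<Rightarrow> ('k, 'a) formal \<Rightarrow> ('k, 'a) formal" where
  "fscale c p = Poly_Mapping.map ((*) c) p"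

lemma lookup_fscale [simp]: "Poly_Mapping.lookup (fscale c p) xs = c * Poly_Mapping.lookup p xs"
  unfolding fscale_def by transfer (simp add: when_def)

interpretation formal: vector_space fscale
  by unfold_locales (auto intro!: poly_mapping_eqI simp: lookup_add algebra_simps)

definition lin :: "('a list \<Rightarrow> ('k::field, 'a) formal) \<Rightarrow> ('k, 'a) formal \<Rightarrow> ('k, 'a) formal" where
  "lin g p = (\<Sum>xs\<in>Poly_Mapping.keys p. fscale (Poly_Mapping.lookup p xs) (g xs))"

lemma lin_superset:
  assumes "finite A" "Poly_Mapping.keys p \<subseteq> A"
  shows "lin g p = (\<Sum>xs\<in>A. fscale (Poly_Mapping.lookup p xs) (g xs))"
  unfolding lin_def by (rule sum.mono_neutral_left) (use assms in \<open>auto simp: in_keys_iff\<close>)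

lemma lin_add: "lin g (p + q) = lin g p + lin g q"
proof -
  have "finite (Poly_Mapping.keys p \<union> Poly_Mapping.keys q)" "Poly_Mapping.keys (p + q) \<subseteq> Poly_Mapping.keys p \<union> Poly_Mapping.keys q"
    using keys_add[of p q] by auto
  then show ?thesis
    by (simp add: lin_superset[of "Poly_Mapping.keys p \<union> Poly_Mapping.keys q"] lookup_add formal.scale_left_distrib sum.distrib)
qed

lemma lin_scale: "lin g (fscale c p) = fscale c (lin g p)"
proof -
  have "Poly_Mapping.keys (fscale c p) \<subseteq> Poly_Mapping.keys p"
    by (auto simp: in_keys_iff)
  then show ?thesis
    by (simp add: lin_superset[of "Poly_Mapping.keys p"] formal.scale_sum_right)
qed

lemma lin_diff: "lin g (p - q) = lin g p - lin g q"
  using lin_add[of g "p - q" q] by (simp add: algebra_simps)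

lemma lin_word [simp]: "lin g (word xs) = g xs"
  by (simp add: lin_def)

definition fconcat :: "('k::field, 'a) formal \<Rightarrow> ('k, 'a) formal \<Rightarrow> ('k, 'a) formal" where
  "fconcat p q = lin (\<lambda>xs. lin (\<lambda>ys. word (xs @ ys)) q) p"

definition koszul :: "bit list \<Rightarrow> bit list \<Rightarrow> 'k::field" where
  "koszul ds es = (\<Prod>i<length ds. \<Prod>j<i. if ds ! i = 1 \<and> es ! j = 1 then - 1 else 1)"


section \<open>Superalgebras and their tensor powers\<close>

text \<open>An algebra over the field \<open>'k\<close> is a unital ring \<open>'a\<close> with a compatible scalar
  multiplication. The class \<open>ring_1\<close> excludes the zero ring, which does not admit a counit.\<close>

locale superalgebra = vector_space scale
  for scale :: "'k::field \<Rightarrow> 'a::ring_1 \<Rightarrow> 'a" (infixr "*s" 75) +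
  fixes gr :: "bit \<Rightarrow> 'a set"
  assumes scale_mult_left: "(c *s x) * y = c *s (x * y)"
    and scale_mult_right: "x * (c *s y) = c *s (x * y)"
    and gr_subspace: "subspace (gr d)"
    and gr_sum: "\<exists>y\<in>gr 0. \<exists>z\<in>gr 1. x = y + z"
    and gr_Int: "gr 0 \<inter> gr 1 = {0}"
    and gr_one: "1 \<in> gr 0"
    and gr_mult: "x \<in> gr d \<Longrightarrow> y \<in> gr e \<Longrightarrow> x * y \<in> gr (d + e)"
begin

definition part :: "bit \<Rightarrow> 'a \<Rightarrow> 'a" where
  "part d x = (THE y. y \<in> gr d \<and> x - y \<in> gr (d + 1))"

text \<open>The relations express that words are linear in every letter. The quotient
  is the tensor algebra of the vector space \<open>'a\<close>, and the classes of the formal sums of words of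
  length \<open>n\<close> make up its component of degree \<open>n\<close>, the tensor power \<open>'a \<otimes> \<dots> \<otimes> 'a\<close>
  (\<open>n\<close> factors). Since word concatenation is the tensor product of tensors, the
  identifications of \<open>K \<otimes> A\<close> and \<open>A \<otimes> K\<close> with \<open>A\<close> hold on the nose.\<close>

definition relators :: "('k, 'a) formal set" where
  "relators =
     {word (us @ (x + y) # vs) - word (us @ x # vs) - word (us @ y # vs) | us x y vs. True} \<union>
     {word (us @ (c *s x) # vs) - fscale c (word (us @ x # vs)) | us c x vs. True}"

definition tensor_rel :: "(('k, 'a) formal \<times> ('k, 'a) formal) set" where
  "tensor_rel = {(p, q). p - q \<in> formal.span relators}"

definition cls :: "('k, 'a) formal \<Rightarrow> ('k, 'a) formal set" where
  "cls p = tensor_rel `` {p}"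

definition rep :: "('k, 'a) formal set \<Rightarrow> ('k, 'a) formal" where
  "rep X = (SOME p. p \<in> X)"

definition tpower :: "nat \<Rightarrow> ('k, 'a) formal set set" where
  "tpower n = cls ` {p. \<forall>xs\<in>Poly_Mapping.keys p. length xs = n}"

definition tpower_gr :: "nat \<Rightarrow> bit \<Rightarrow> ('k, 'a) formal set set" where
  "tpower_gr n d = cls ` {p. \<forall>xs\<in>Poly_Mapping.keys p. length xs = n \<and>
     (\<exists>ds. list_all2 (\<lambda>x e. x \<in> gr e) xs ds \<and> sum_list ds = d)}"

definition tensor_homogeneous :: "nat \<Rightarrow> ('k, 'a) formal set \<Rightarrow> bool" where
  "tensor_homogeneous n X \<longleftrightarrow> (\<exists>d. X \<in> tpower_gr n d)"

definition tadd :: "('k, 'a) formal set \<Rightarrow> ('k, 'a) formal set \<Rightarrow> ('k, 'a) formal set" where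
  "tadd X Y = cls (rep X + rep Y)"

definition tscale :: "'k \<Rightarrow> ('k, 'a) formal set \<Rightarrow> ('k, 'a) formal set" where
  "tscale c X = cls (fscale c (rep X))"

definition otimes :: "('k, 'a) formal set \<Rightarrow> ('k, 'a) formal set \<Rightarrow> ('k, 'a) formal set"
    (infixl "\<otimes>" 75) where
  "X \<otimes> Y = cls (fconcat (rep X) (rep Y))"

definition emb :: "'a \<Rightarrow> ('k, 'a) formal set" where
  "emb x = cls (word [x])"

definition emb_K :: "'k \<Rightarrow> ('k, 'a) formal set" where
  "emb_K c = cls (fscale c (word []))"

definition tone :: "nat \<Rightarrow> ('k, 'a) formal set" where
  "tone n = cls (word (replicate n 1))"

text \<open>For homogeneous letters only one term of the sum in \<open>word_mult\<close> is not zero as a tensor,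
  namely \<open>(-1)\<^sup>s x\<^sub>1 y\<^sub>1 \<otimes> \<dots> \<otimes> x\<^sub>n y\<^sub>n\<close> with \<open>s\<close> the sum of all \<open>[x\<^sub>i] [y\<^sub>j]\<close> for \<open>j < i\<close>;
  see \<open>tmult_homogeneous\<close> below.\<close>

definition word_mult :: "'a list \<Rightarrow> 'a list \<Rightarrow> ('k, 'a) formal" where
  "word_mult xs ys =
     (if length xs = length ys
      then \<Sum>ds | length ds = length xs. \<Sum>es | length es = length ys.
             fscale (koszul ds es) (word (map2 (*) (map2 part ds xs) (map2 part es ys)))
      else 0)"

definition tmult :: "('k, 'a) formal set \<Rightarrow> ('k, 'a) formal set \<Rightarrow> ('k, 'a) formal set"
    (infixl "\<cdot>" 70) where
  "X \<cdot> Y = cls (lin (\<lambda>xs. lin (\<lambda>ys. word_mult xs ys) (rep Y)) (rep X))"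

definition is_tinv :: "nat \<Rightarrow> ('k, 'a) formal set \<Rightarrow> ('k, 'a) formal set \<Rightarrow> bool" where
  "is_tinv n X Y \<longleftrightarrow> X \<in> tpower n \<and> Y \<in> tpower n \<and> X \<cdot> Y = tone n \<and> Y \<cdot> X = tone n"

definition tensor_invertible :: "nat \<Rightarrow> ('k, 'a) formal set \<Rightarrow> bool" where
  "tensor_invertible n X \<longleftrightarrow> (\<exists>Y. is_tinv n X Y)"

definition tinv :: "nat \<Rightarrow> ('k, 'a) formal set \<Rightarrow> ('k, 'a) formal set" where
  "tinv n X = (THE Y. is_tinv n X Y)"

text \<open>\<open>tmap [f\<^sub>1, \<dots>, f\<^sub>n]\<close> is \<open>f\<^sub>1 \<otimes> \<dots> \<otimes> f\<^sub>n\<close> for linear maps \<open>f\<^sub>i\<close> of degree 0 into tensor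
  powers: it maps \<open>x\<^sub>1 \<otimes> \<dots> \<otimes> x\<^sub>n\<close> to \<open>f\<^sub>1(x\<^sub>1) \<otimes> \<dots> \<otimes> f\<^sub>n(x\<^sub>n)\<close>. The identity map of the
  algebra is entered as \<open>emb\<close> and the counit as \<open>emb_K \<circ> \<epsilon>\<close>.\<close>

definition tmap :: "('a \<Rightarrow> ('k, 'a) formal set) list \<Rightarrow> ('k, 'a) formal set \<Rightarrow> ('k, 'a) formal set" where
  "tmap fs X = cls (lin (\<lambda>xs. if length xs = length fs
                              then foldr fconcat (map2 (\<lambda>f x. rep (f x)) fs xs) (word [])
                              else 0) (rep X))"

text \<open>\<open>gtwist k\<close> is the graded twist map acting on the factors number \<open>k\<close> and \<open>k + 1\<close> of a
  tensor, counted from \<open>0\<close>. So \<open>gtwist 0\<close> is \<open>T\<close> or \<open>T \<otimes> 1\<close>, and \<open>gtwist 1\<close> is \<open>1 \<otimes> T\<close>.\<close>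

definition word_twist :: "nat \<Rightarrow> 'a list \<Rightarrow> ('k, 'a) formal" where
  "word_twist k xs =
     (if k + 1 < length xs
      then \<Sum>d\<in>{0, 1}. \<Sum>e\<in>{0, 1}. fscale (if d = 1 \<and> e = 1 then - 1 else 1)
             (word (xs[k := part e (xs ! (k + 1)), k + 1 := part d (xs ! k)]))
      else 0)"

definition gtwist :: "nat \<Rightarrow> ('k, 'a) formal set \<Rightarrow> ('k, 'a) formal set" where
  "gtwist k X = cls (lin (word_twist k) (rep X))"

definition contract :: "('a list \<Rightarrow> 'a) \<Rightarrow> ('k, 'a) formal set \<Rightarrow> 'a" where
  "contract f X = (\<Sum>xs\<in>Poly_Mapping.keys (rep X). Poly_Mapping.lookup (rep X) xs *s f xs)"

definition S_left :: "('a \<Rightarrow> 'a) \<Rightarrow> 'a \<Rightarrow> ('k, 'a) formal set \<Rightarrow> 'a" where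
  "S_left S \<alpha> = contract (\<lambda>xs. case xs of [x, y] \<Rightarrow> S x * \<alpha> * y | _ \<Rightarrow> 0)"

definition S_right :: "('a \<Rightarrow> 'a) \<Rightarrow> 'a \<Rightarrow> ('k, 'a) formal set \<Rightarrow> 'a" where
  "S_right S \<beta> = contract (\<lambda>xs. case xs of [x, y] \<Rightarrow> x * \<beta> * S y | _ \<Rightarrow> 0)"

end


section \<open>Quasi-triangular quasi-Hopf superalgebras\<close>

locale graded_quasi_bialgebra = superalgebra scale gr
  for scale :: "'k::field \<Rightarrow> 'a::ring_1 \<Rightarrow> 'a" (infixr "*s" 75) and gr +
  fixes \<Delta> :: "'a \<Rightarrow> ('k, 'a) formal set" and \<epsilon> :: "'a \<Rightarrow> 'k"
    and \<Phi> :: "('k, 'a) formal set"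
  assumes counit_add: "\<epsilon> (x + y) = \<epsilon> x + \<epsilon> y"
    and counit_scale: "\<epsilon> (c *s x) = c * \<epsilon> x"
    and counit_mult: "\<epsilon> (x * y) = \<epsilon> x * \<epsilon> y"
    and counit_one: "\<epsilon> 1 = 1"
    and counit_odd: "x \<in> gr 1 \<Longrightarrow> \<epsilon> x = 0"
    and coprod_tpower: "\<Delta> x \<in> tpower 2"
    and coprod_add: "\<Delta> (x + y) = tadd (\<Delta> x) (\<Delta> y)"
    and coprod_scale: "\<Delta> (c *s x) = tscale c (\<Delta> x)"
    and coprod_mult: "\<Delta> (x * y) = \<Delta> x \<cdot> \<Delta> y"
    and coprod_one: "\<Delta> 1 = tone 2"
    and coprod_gr: "x \<in> gr d \<Longrightarrow> \<Delta> x \<in> tpower_gr 2 d"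
    and associator_invertible: "tensor_invertible 3 \<Phi>"
    and associator_homogeneous: "tensor_homogeneous 3 \<Phi>"
    and quasi_coassoc: "tmap [emb, \<Delta>] (\<Delta> x) = tinv 3 \<Phi> \<cdot> tmap [\<Delta>, emb] (\<Delta> x) \<cdot> \<Phi>"
    and pentagon: "tmap [\<Delta>, emb, emb] \<Phi> \<cdot> tmap [emb, emb, \<Delta>] \<Phi> =
                   (\<Phi> \<otimes> emb 1) \<cdot> tmap [emb, \<Delta>, emb] \<Phi> \<cdot> (emb 1 \<otimes> \<Phi>)"
    and counit_left: "tmap [emb_K \<circ> \<epsilon>, emb] (\<Delta> x) = emb x"
    and counit_right: "tmap [emb, emb_K \<circ> \<epsilon>] (\<Delta> x) = emb x"
    and counit_associator: "tmap [emb, emb_K \<circ> \<epsilon>, emb] \<Phi> = tone 2"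

locale quasi_hopf_superalgebra = graded_quasi_bialgebra scale gr \<Delta> \<epsilon> \<Phi>
  for scale :: "'k::field \<Rightarrow> 'a::ring_1 \<Rightarrow> 'a" (infixr "*s" 75) and gr \<Delta> \<epsilon> \<Phi> +
  fixes S :: "'a \<Rightarrow> 'a" and \<alpha> \<beta> :: 'a
  assumes antipode_add: "S (x + y) = S x + S y"
    and antipode_scale: "S (c *s x) = c *s S x"
    and antipode_one: "S 1 = 1"
    and antipode_gr: "x \<in> gr d \<Longrightarrow> S x \<in> gr d"
    and antipode_mult: "x \<in> gr d \<Longrightarrow> y \<in> gr e \<Longrightarrow>
          S (x * y) = (if d = 1 \<and> e = 1 then - (S y * S x) else S y * S x)"
    and alpha_even: "\<alpha> \<in> gr 0"
    and beta_even: "\<beta> \<in> gr 0"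
    and antipode_alpha: "S_left S \<alpha> (\<Delta> x) = \<epsilon> x *s \<alpha>"
    and antipode_beta: "S_right S \<beta> (\<Delta> x) = \<epsilon> x *s \<beta>"
    and antipode_associator_inv:
          "contract (\<lambda>xs. case xs of [x, y, z] \<Rightarrow> x * \<beta> * S y * \<alpha> * z | _ \<Rightarrow> 0) (tinv 3 \<Phi>) = 1"
    and antipode_associator:
          "contract (\<lambda>xs. case xs of [x, y, z] \<Rightarrow> S x * \<alpha> * y * \<beta> * S z | _ \<Rightarrow> 0) \<Phi> = 1"

locale quasitriangular_quasi_hopf_superalgebra =
  quasi_hopf_superalgebra scale gr \<Delta> \<epsilon> \<Phi> S \<alpha> \<beta>
  for scale :: "'k::field \<Rightarrow> 'a::ring_1 \<Rightarrow> 'a" (infixr "*s" 75) and gr \<Delta> \<epsilon> \<Phi> S \<alpha> \<beta> +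
  fixes R :: "('k, 'a) formal set"
  assumes R_invertible: "tensor_invertible 2 R"
    and R_homogeneous: "tensor_homogeneous 2 R"
    and R_intertwines: "gtwist 0 (\<Delta> x) \<cdot> R = R \<cdot> \<Delta> x"
    and hexagon_left:
          "tmap [\<Delta>, emb] R =
             tinv 3 (gtwist 1 (gtwist 0 \<Phi>)) \<cdot> gtwist 1 (R \<otimes> emb 1) \<cdot> gtwist 1 \<Phi> \<cdot>
             (emb 1 \<otimes> R) \<cdot> tinv 3 \<Phi>"
    and hexagon_right:
          "tmap [emb, \<Delta>] R =
             gtwist 0 (gtwist 1 \<Phi>) \<cdot> gtwist 1 (R \<otimes> emb 1) \<cdot> tinv 3 (gtwist 0 \<Phi>) \<cdot>
             (R \<otimes> emb 1) \<cdot> \<Phi>"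


section \<open>Twisting\<close>

context superalgebra
begin

definition twist_coprod ::
    "('a \<Rightarrow> ('k, 'a) formal set) \<Rightarrow> ('k, 'a) formal set \<Rightarrow> 'a \<Rightarrow> ('k, 'a) formal set" where
  "twist_coprod \<Delta> F = (\<lambda>x. F \<cdot> \<Delta> x \<cdot> tinv 2 F)"

definition twist_associator ::
    "('a \<Rightarrow> ('k, 'a) formal set) \<Rightarrow> ('k, 'a) formal set \<Rightarrow> ('k, 'a) formal set \<Rightarrow>
     ('k, 'a) formal set" where
  "twist_associator \<Delta> F \<Phi> =
     (F \<otimes> emb 1) \<cdot> tmap [\<Delta>, emb] F \<cdot> \<Phi> \<cdot> tmap [emb, \<Delta>] (tinv 2 F) \<cdot> (emb 1 \<otimes> tinv 2 F)"

definition twist_R ::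
    "('k, 'a) formal set \<Rightarrow> ('k, 'a) formal set \<Rightarrow> ('k, 'a) formal set" where
  "twist_R F R = gtwist 0 F \<cdot> R \<cdot> tinv 2 F"

definition twist_alpha :: "('a \<Rightarrow> 'a) \<Rightarrow> 'a \<Rightarrow> ('k, 'a) formal set \<Rightarrow> 'a" where
  "twist_alpha S \<alpha> F = S_left S \<alpha> (tinv 2 F)"

definition twist_beta :: "('a \<Rightarrow> 'a) \<Rightarrow> 'a \<Rightarrow> ('k, 'a) formal set \<Rightarrow> 'a" where
  "twist_beta S \<beta> F = S_right S \<beta> F"

end


section \<open>The operations on tensors are well defined\<close>

text \<open>The operations are defined through representatives. The lemmas \<open>otimes_cls\<close>, \<open>tmult_cls\<close>,
  \<open>gtwist_cls\<close> and \<open>tmap_cls\<close> show that they do not depend on the choice of the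
  representatives; \<open>otimes_word\<close>, \<open>tmult_homogeneous\<close>, \<open>gtwist_homogeneous\<close> and \<open>tmap_word\<close>
  give their values on pure tensors.\<close>

lemma lin_fun_add: "lin (\<lambda>xs. g xs + h xs) p = lin g p + lin h p"
  by (simp add: lin_def formal.scale_right_distrib sum.distrib)

lemma lin_fun_scale: "lin (\<lambda>xs. fscale c (g xs)) p = fscale c (lin g p)"
  by (simp add: lin_def formal.scale_sum_right mult.commute)

lemma lin_fun_sum: "lin (\<lambda>xs. \<Sum>i\<in>I. g i xs) p = (\<Sum>i\<in>I. lin (g i) p)"
  unfolding lin_def by (subst sum.swap) (simp add: formal.scale_sum_right)

lemma lin_fun_zero [simp]: "lin (\<lambda>xs. 0) p = 0"
  by (simp add: lin_def)

lemma lin_lin_commute: "lin (\<lambda>xs. lin (\<lambda>ys. g xs ys) q) p = lin (\<lambda>ys. lin (\<lambda>xs. g xs ys) p) q"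
  unfolding lin_def formal.scale_sum_right by (subst sum.swap) (simp add: mult.commute)

context superalgebra
begin

lemma cls_eq_iff: "cls p = cls q \<longleftrightarrow> p - q \<in> formal.span relators"
proof
  assume "cls p = cls q"
  then have "q \<in> cls p" by (simp add: cls_def tensor_rel_def formal.span_zero)
  then show "p - q \<in> formal.span relators" by (simp add: cls_def tensor_rel_def)
next
  assume *: "p - q \<in> formal.span relators"
  have "p - r \<in> formal.span relators \<longleftrightarrow> q - r \<in> formal.span relators" for r
    using formal.span_add_eq[OF *, of "q - r"] by (simp add: algebra_simps)
  then show "cls p = cls q" by (simp add: cls_def tensor_rel_def)
qed

lemma rep_cls: "rep (cls p) - p \<in> formal.span relators"
proof -
  have "p \<in> cls p" by (simp add: cls_def tensor_rel_def formal.span_zero)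
  then have "rep (cls p) \<in> cls p" unfolding rep_def by (rule someI)
  then have "p - rep (cls p) \<in> formal.span relators" by (simp add: cls_def tensor_rel_def)
  from formal.span_neg[OF this] show ?thesis by simp
qed

text \<open>A linear map of formal sums that preserves the relations descends to tensors.\<close>

lemma lin_span:
  assumes "\<And>r. r \<in> relators \<Longrightarrow> lin g r \<in> formal.span relators" "p \<in> formal.span relators"
  shows "lin g p \<in> formal.span relators"
  using assms(2)
proof (induction rule: formal.span_induct_alt)
  case base
  then show ?case by (simp add: lin_def formal.span_zero)
next
  case (step c x y)
  then show ?case by (simp add: lin_add lin_scale assms(1) formal.span_add formal.span_scale)
qed

lemma cls_lin_rep:
  assumes "\<And>r. r \<in> relators \<Longrightarrow> lin g r \<in> formal.span relators"
  shows "cls (lin g (rep (cls p))) = cls (lin g p)"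
  using lin_span[OF assms rep_cls] by (simp add: cls_eq_iff lin_diff)

lemma word_add_span:
  "word (us @ (x + y) # vs) - word (us @ x # vs) - word (us @ y # vs) \<in> formal.span relators"
  by (rule formal.span_base) (unfold relators_def, blast)

lemma word_scale_span:
  "word (us @ (c *s x) # vs) - fscale c (word (us @ x # vs)) \<in> formal.span relators"
  by (rule formal.span_base) (unfold relators_def, blast)

lemma word_0: "0 \<in> set xs \<Longrightarrow> word xs \<in> formal.span relators"
proof -
  assume "0 \<in> set xs"
  then obtain us vs where "xs = us @ 0 # vs" by (auto dest: split_list)
  moreover have "word (us @ (0 *s 0) # vs) - fscale 0 (word (us @ 0 # vs)) \<in> relators"
    unfolding relators_def by blast
  ultimately show ?thesis using formal.span_base by fastforce
qed

lemma relators_cases [consumes 1, case_names add scale]: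
  assumes "r \<in> relators"
  obtains us x y vs where "r = word (us @ (x + y) # vs) - word (us @ x # vs) - word (us @ y # vs)"
    | us c x vs where "r = word (us @ (c *s x) # vs) - fscale c (word (us @ x # vs))"
  using assms unfolding relators_def by blast

lemma lin_relatorI:
  assumes "\<And>us x y vs. g (us @ (x + y) # vs) - g (us @ x # vs) - g (us @ y # vs) \<in> formal.span relators"
    and "\<And>us c x vs. g (us @ (c *s x) # vs) - fscale c (g (us @ x # vs)) \<in> formal.span relators"
    and "r \<in> relators"
  shows "lin g r \<in> formal.span relators"
  using assms(3) by (cases rule: relators_cases) (simp_all add: lin_diff lin_scale assms(1,2))

lemma letterwise_relators:
  assumes "\<And>h. h \<in> set hs \<Longrightarrow> (\<forall>x y. h (x + y) = h x + h y) \<and> (\<forall>c x. h (c *s x) = c *s h x)"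
    and "r \<in> relators"
  shows "lin (\<lambda>xs. if length xs = length hs then word (map2 (\<lambda>h x. h x) hs xs) else 0) r
           \<in> formal.span relators"
  using assms(2)
proof (rule lin_relatorI[rotated 2], goal_cases)
  case (1 us x y vs)
  show ?case
  proof (cases "Suc (length us + length vs) = length hs")
    case True
    define h1 h h2 where h: "h1 = take (length us) hs" "h = hs ! length us" "h2 = drop (Suc (length us)) hs"
    have hs: "hs = h1 @ h # h2" "length h1 = length us" "length h2 = length vs"
      using True by (simp_all add: h id_take_nth_drop[symmetric])
    have "word (map2 (\<lambda>h x. h x) h1 us @ (h x + h y) # map2 (\<lambda>h x. h x) h2 vs)
      - word (map2 (\<lambda>h x. h x) h1 us @ h x # map2 (\<lambda>h x. h x) h2 vs)
      - word (map2 (\<lambda>h x. h x) h1 us @ h y # map2 (\<lambda>h x. h x) h2 vs) \<in> relators"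
      unfolding relators_def by blast
    then show ?thesis using assms(1)[of h] by (simp add: hs formal.span_base)
  qed (simp add: formal.span_zero)
next
  case (2 us c x vs)
  show ?case
  proof (cases "Suc (length us + length vs) = length hs")
    case True
    define h1 h h2 where h: "h1 = take (length us) hs" "h = hs ! length us" "h2 = drop (Suc (length us)) hs"
    have hs: "hs = h1 @ h # h2" "length h1 = length us" "length h2 = length vs"
      using True by (simp_all add: h id_take_nth_drop[symmetric])
    have "word (map2 (\<lambda>h x. h x) h1 us @ (c *s h x) # map2 (\<lambda>h x. h x) h2 vs)
      - fscale c (word (map2 (\<lambda>h x. h x) h1 us @ h x # map2 (\<lambda>h x. h x) h2 vs)) \<in> relators"
      unfolding relators_def by blast
    then show ?thesis using assms(1)[of h] by (simp add: hs formal.span_base)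
  qed (simp add: formal.span_zero)
qed

lemma part_unique: 
  assumes "y \<in> gr d" "x - y \<in> gr (d + 1)"
  shows "part d x = y"
  unfolding part_def
proof (rule the_equality)
  fix y' assume *: "y' \<in> gr d \<and> x - y' \<in> gr (d + 1)"
  have "y' - y \<in> gr d" using * assms gr_subspace subspace_diff by blast
  moreover have "(x - y) - (x - y') \<in> gr (d + 1)" using * assms gr_subspace subspace_diff by blast
  ultimately have "y' - y \<in> gr 0 \<inter> gr 1" by (cases d) auto
  then show "y' = y" using gr_Int by auto
qed (use assms in auto)

lemma part_in: "part d x \<in> gr d" and part_diff: "x - part d x \<in> gr (d + 1)"
proof -
  obtain y z where yz: "y \<in> gr 0" "z \<in> gr 1" "x = y + z" using gr_sum by blast
  then have "\<exists>y\<in>gr d. x - y \<in> gr (d + 1)" by (cases d) (auto intro: bexI[of _ y] bexI[of _ z])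
  then show "part d x \<in> gr d" "x - part d x \<in> gr (d + 1)" using part_unique by metis+
qed

lemma part_add: "part d (x + y) = part d x + part d y"
proof (rule part_unique)
  have "(x - part d x) + (y - part d y) \<in> gr (d + 1)"
    by (rule subspace_add[OF gr_subspace part_diff part_diff])
  then show "x + y - (part d x + part d y) \<in> gr (d + 1)" by (simp add: algebra_simps)
qed (intro subspace_add[OF gr_subspace] part_in)

lemma part_scale: "part d (c *s x) = c *s part d x"
proof (rule part_unique)
  have "c *s (x - part d x) \<in> gr (d + 1)"
    by (rule subspace_scale[OF gr_subspace part_diff])
  then show "c *s x - c *s part d x \<in> gr (d + 1)" by (simp add: scale_right_diff_distrib)
qed (intro subspace_scale[OF gr_subspace] part_in)

lemma part_homogeneous: "x \<in> gr d \<Longrightarrow> part e x = (if e = d then x else 0)"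
  by (rule part_unique) (cases d; cases e; auto simp: subspace_0[OF gr_subspace])+


lemma word_mult_left_relators:
  assumes "r \<in> relators"
  shows "lin (\<lambda>xs. word_mult xs ys) r \<in> formal.span relators"
proof -
  define hs where "hs = (\<lambda>ds es. map2 (\<lambda>d b x. part d x * b) ds (map2 part es ys))"
  have "map2 (\<lambda>h x. h x) (hs ds es) xs = map2 (*) (map2 part ds xs) (map2 part es ys)"
    if "length ds = length ys" "length es = length ys" "length xs = length ys" for ds es xs
    using that by (auto simp: hs_def intro!: nth_equalityI)
  then have *: "word_mult xs ys = (\<Sum>ds | length ds = length ys. \<Sum>es | length es = length ys.
     fscale (koszul ds es) (if length xs = length (hs ds es) then word (map2 (\<lambda>h x. h x) (hs ds es) xs) else 0))" for xs
    unfolding word_mult_def by (auto simp: hs_def intro!: sum.cong sum.neutral[symmetric])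
  show ?thesis
    unfolding * lin_fun_sum lin_fun_scale
    by (intro formal.span_sum formal.span_scale letterwise_relators assms)
       (auto simp: hs_def set_zip part_add part_scale distrib_right scale_mult_left)
qed

lemma word_mult_right_relators:
  assumes "r \<in> relators"
  shows "lin (\<lambda>ys. word_mult xs ys) r \<in> formal.span relators"
proof -
  define hs where "hs = (\<lambda>ds es. map2 (\<lambda>a e y. a * part e y) (map2 part ds xs) es)"
  have "map2 (\<lambda>h x. h x) (hs ds es) ys = map2 (*) (map2 part ds xs) (map2 part es ys)"
    if "length ds = length xs" "length es = length xs" "length ys = length xs" for ds es ys
    using that by (auto simp: hs_def intro!: nth_equalityI)
  then have *: "word_mult xs ys = (\<Sum>ds | length ds = length xs. \<Sum>es | length es = length xs.
     fscale (koszul ds es) (if length ys = length (hs ds es) then word (map2 (\<lambda>h x. h x) (hs ds es) ys) else 0))" for ys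
    unfolding word_mult_def by (auto simp: hs_def intro!: sum.cong sum.neutral[symmetric])
  show ?thesis
    unfolding * lin_fun_sum lin_fun_scale
    by (intro formal.span_sum formal.span_scale letterwise_relators assms)
       (auto simp: hs_def set_zip part_add part_scale distrib_left scale_mult_right)
qed

lemma cls_bilinear:
  assumes "\<And>ys r. r \<in> relators \<Longrightarrow> lin (\<lambda>xs. w xs ys) r \<in> formal.span relators"
    and "\<And>xs r. r \<in> relators \<Longrightarrow> lin (\<lambda>ys. w xs ys) r \<in> formal.span relators"
  shows "cls (lin (\<lambda>xs. lin (w xs) (rep (cls q))) (rep (cls p))) = cls (lin (\<lambda>xs. lin (w xs) q) p)"
proof -
  have L: "lin g p \<in> formal.span relators" if "\<And>xs. g xs \<in> formal.span relators" for g p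
    unfolding lin_def by (intro formal.span_sum formal.span_scale that)
  have "cls (lin (\<lambda>xs. lin (w xs) (rep (cls q))) (rep (cls p))) = cls (lin (\<lambda>xs. lin (w xs) (rep (cls q))) p)"
    by (rule cls_lin_rep) (subst lin_lin_commute, intro L assms(1))
  also have "\<dots> = cls (lin (\<lambda>ys. lin (\<lambda>xs. w xs ys) p) (rep (cls q)))"
    by (simp add: lin_lin_commute[of w])
  also have "\<dots> = cls (lin (\<lambda>ys. lin (\<lambda>xs. w xs ys) p) q)"
    by (rule cls_lin_rep) (subst lin_lin_commute, intro L assms(2))
  finally show ?thesis by (simp add: lin_lin_commute[of w])
qed

lemma tmult_cls: "cls p \<cdot> cls q = cls (lin (\<lambda>xs. lin (\<lambda>ys. word_mult xs ys) q) p)"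
  unfolding tmult_def by (intro cls_bilinear word_mult_left_relators word_mult_right_relators)

lemma otimes_cls: "cls p \<otimes> cls q = cls (fconcat p q)"
proof -
  have l: "lin (\<lambda>xs. word (xs @ ys)) r \<in> formal.span relators" if "r \<in> relators" for ys r
    using that by (rule lin_relatorI[rotated 2])
      (simp_all add: word_add_span[of _ _ _ "_ @ ys", simplified] word_scale_span[of _ _ _ "_ @ ys", simplified])
  have r: "lin (\<lambda>ys. word (xs @ ys)) r \<in> formal.span relators" if "r \<in> relators" for xs r
    using that by (rule lin_relatorI[rotated 2])
      (simp_all add: word_add_span[of "xs @ _", simplified] word_scale_span[of "xs @ _", simplified])
  show ?thesis unfolding otimes_def fconcat_def by (intro cls_bilinear l r)
qed

lemma otimes_word: "cls (word xs) \<otimes> cls (word ys) = cls (word (xs @ ys))"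
  by (simp add: otimes_cls fconcat_def)

lemma cls_sum_cong:
  assumes "finite I" "\<And>i. i \<in> I \<Longrightarrow> p i - q i \<in> formal.span relators"
  shows "cls (sum p I) = cls (sum q I)"
  using formal.span_sum[OF assms(2)] by (simp add: cls_eq_iff sum_subtractf)

lemma tmult_homogeneous:
  assumes "list_all2 (\<lambda>x d. x \<in> gr d) xs ds" "list_all2 (\<lambda>y e. y \<in> gr e) ys es"
    and "length xs = length ys"
  shows "cls (word xs) \<cdot> cls (word ys) = cls (fscale (koszul ds es) (word (map2 (*) xs ys)))"
proof -
  let ?t = "\<lambda>ds' es'. fscale (koszul ds' es') (word (map2 (*) (map2 part ds' xs) (map2 part es' ys)))"
  have len: "length ds = length xs" "length es = length xs"
    using assms by (auto dest: list_all2_lengthD)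
  have fin: "finite {ds :: bit list. length ds = n}" for n
    using finite_lists_length_eq[of "{0, 1::bit}" n] by (rule finite_subset[rotated]) (auto intro: bit.exhaust)
  have p: "map2 part ds xs = xs" "map2 part es ys = ys"
    using assms len by (auto intro!: nth_equalityI simp: list_all2_conv_all_nth part_homogeneous)
  have z: "?t ds' es' \<in> formal.span relators"
    if "length ds' = length xs" "length es' = length ys" "(ds', es') \<noteq> (ds, es)" for ds' es'
  proof -
    have "ds' \<noteq> ds \<or> es' \<noteq> es"
      using that(3) by blast
    then have "\<exists>i<length xs. ds' ! i \<noteq> ds ! i \<or> es' ! i \<noteq> es ! i"
      using that(1,2) len assms(3) by (simp only: list_eq_iff_nth_eq) blast
    then obtain i where i: "i < length xs" "ds' ! i \<noteq> ds ! i \<or> es' ! i \<noteq> es ! i"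
      by blast
    then have "part (ds' ! i) (xs ! i) = 0 \<or> part (es' ! i) (ys ! i) = 0"
      using assms len by (auto simp: list_all2_conv_all_nth part_homogeneous)
    then have "map2 (*) (map2 part ds' xs) (map2 part es' ys) ! i = 0"
      using that i assms(3) by auto
    then have "0 \<in> set (map2 (*) (map2 part ds' xs) (map2 part es' ys))"
      using that i assms(3) by (metis (no_types, lifting) length_map length_zip min.idem nth_mem)
    then show ?thesis by (intro formal.span_scale word_0)
  qed
  let ?I = "{ds :: bit list. length ds = length xs} \<times> {es :: bit list. length es = length ys}"
  have "cls (word xs) \<cdot> cls (word ys) = cls (\<Sum>(ds', es')\<in>?I. ?t ds' es')"
    using assms(3) by (simp add: tmult_cls word_mult_def sum.cartesian_product)
  also have "\<dots> = cls (\<Sum>k\<in>?I. if k = (ds, es) then ?t ds es else 0)"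
    by (rule cls_sum_cong) (use z fin in \<open>auto simp: formal.span_zero\<close>)
  also have "\<dots> = cls (?t ds es)"
    using fin len assms(3) by (subst sum.delta) auto
  finally show ?thesis by (simp add: p)
qed

lemma word_update_relators:
  assumes "i < length ws"
  shows "word (ws[i := x + y]) - word (ws[i := x]) - word (ws[i := y]) \<in> formal.span relators"
    and "word (ws[i := c *s x]) - fscale c (word (ws[i := x])) \<in> formal.span relators"
  using assms by (simp_all add: upd_conv_take_nth_drop word_add_span word_scale_span)

lemma word_twist_relators:
  assumes "r \<in> relators"
  shows "lin (word_twist k) r \<in> formal.span relators"
proof -
  define g where "g = (\<lambda>d e xs. xs[k := part e (xs ! (k + 1)), k + 1 := part d (xs ! k)])"
  have g_update: "\<exists>ws j h. j < length ws \<and> (\<forall>x y. h (x + y) = h x + h y) \<and>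
      (\<forall>c x. h (c *s x) = c *s h x) \<and> (\<forall>x. g d e (us @ x # vs) = ws[j := h x])"
    if "k + 1 < length (us @ 0 # vs)" for d e us vs
  proof -
    define i zs where "i = length us" "zs = us @ 0 # vs"
    have zs: "us @ x # vs = zs[i := x]" "i < length zs" "k + 1 < length zs" for x
      using that by (simp_all add: i_zs_def)
    consider "i = k" | "i = k + 1" | "i \<noteq> k" "i \<noteq> k + 1" by blast
    then show ?thesis
    proof cases
      case 1
      show ?thesis unfolding g_def zs using zs 1
        by (intro exI[of _ "zs[k := part e (zs ! (k + 1))]"] exI[of _ "k + 1"] exI[of _ "part d"])
           (auto simp: part_add part_scale)
    next
      case 2
      show ?thesis unfolding g_def zs using zs 2
        by (intro exI[of _ "zs[k + 1 := part d (zs ! k)]"] exI[of _ k] exI[of _ "part e"])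
           (auto simp: part_add part_scale list_update_swap[of k "Suc k"])
    next
      case 3
      show ?thesis unfolding g_def zs using zs 3
        by (intro exI[of _ "g d e zs"] exI[of _ i] exI[of _ "\<lambda>x. x"])
           (auto simp: g_def list_update_swap)
    qed
  qed
  have g: "lin (\<lambda>xs. if k + 1 < length xs then word (g d e xs) else 0) r \<in> formal.span relators" for d e
    using assms
  proof (rule lin_relatorI[rotated 2], goal_cases)
    case (1 us x y vs)
    then show ?case using g_update[of us vs d e]
      by (auto simp: formal.span_zero word_update_relators)
  next
    case (2 us c x vs)
    then show ?case using g_update[of us vs d e]
      by (auto simp: formal.span_zero word_update_relators)
  qed
  have "word_twist k = (\<lambda>xs. \<Sum>d\<in>{0, 1}. \<Sum>e\<in>{0, 1}. fscale (if d = 1 \<and> e = 1 then - 1 else 1)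
          (if k + 1 < length xs then word (g d e xs) else 0))"
    by (auto simp: fun_eq_iff word_twist_def g_def)
  then show ?thesis
    using g by (simp only: lin_fun_sum lin_fun_scale) (intro formal.span_sum formal.span_scale)
qed

lemma gtwist_cls: "gtwist k (cls p) = cls (lin (word_twist k) p)"
  unfolding gtwist_def by (intro cls_lin_rep word_twist_relators)

lemma gtwist_homogeneous:
  assumes "list_all2 (\<lambda>x d. x \<in> gr d) xs ds" "k + 1 < length xs"
  shows "gtwist k (cls (word xs)) =
    cls (fscale (if ds ! k = 1 \<and> ds ! (k + 1) = 1 then - 1 else 1)
          (word (xs[k := xs ! (k + 1), k + 1 := xs ! k])))"
proof -
  let ?t = "\<lambda>d e. fscale (if d = 1 \<and> e = 1 then - 1 else 1)
              (word (xs[k := part e (xs ! (k + 1)), k + 1 := part d (xs ! k)]))"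
  let ?I = "{0, 1::bit} \<times> {0, 1::bit}"
  have xs: "xs ! k \<in> gr (ds ! k)" "xs ! (k + 1) \<in> gr (ds ! (k + 1))"
    using assms by (auto simp: list_all2_conv_all_nth)
  have z: "?t d e \<in> formal.span relators" if "(d, e) \<noteq> (ds ! k, ds ! (k + 1))" for d e
  proof -
    have "part d (xs ! k) = 0 \<or> part e (xs ! (k + 1)) = 0"
      using that xs by (auto simp: part_homogeneous)
    then have "0 \<in> set (xs[k := part e (xs ! (k + 1)), k + 1 := part d (xs ! k)])"
      using assms(2) by (auto simp: in_set_conv_nth nth_list_update intro: exI[of _ k] exI[of _ "k + 1"])
    then show ?thesis by (intro formal.span_scale word_0)
  qed
  have "gtwist k (cls (word xs)) = cls (\<Sum>(d, e)\<in>?I. ?t d e)"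
    unfolding sum.cartesian_product[symmetric] using assms(2) by (simp add: gtwist_cls word_twist_def)
  also have "\<dots> = cls (\<Sum>i\<in>?I. if i = (ds ! k, ds ! (k + 1)) then ?t (ds ! k) (ds ! (k + 1)) else 0)"
    by (rule cls_sum_cong) (use z in \<open>auto simp: formal.span_zero simp del: bit_not_zero_iff bit_not_one_iff\<close>)
  also have "\<dots> = cls (?t (ds ! k) (ds ! (k + 1)))"
    by (subst sum.delta) (auto simp: bit.exhaust)
  finally show ?thesis
    using xs by (simp add: part_homogeneous)
qed

lemma fconcat_span:
  assumes "p \<in> formal.span relators"
  shows "fconcat p q \<in> formal.span relators" "fconcat q p \<in> formal.span relators"
  using otimes_cls[of p q] otimes_cls[of 0 q] otimes_cls[of q p] otimes_cls[of q 0] assms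
    cls_eq_iff[of p 0] cls_eq_iff[of "fconcat p q" 0] cls_eq_iff[of "fconcat q p" 0]
  by (auto simp: fconcat_def lin_def[of _ 0])

lemma fconcat_diff:
  fixes p q :: "('k, 'a) formal"
  shows
  "fconcat (p - p') q = fconcat p q - fconcat p' q" "fconcat p (q - q') = fconcat p q - fconcat p q'"
  "fconcat (fscale c p) q = fscale c (fconcat p q)" "fconcat p (fscale c q) = fscale c (fconcat p q)"
proof -
  have "lin (\<lambda>xs. g xs - h xs) p = lin g p - lin h p" for g h :: "'a list \<Rightarrow> ('k, 'a) formal" and p
    by (simp add: lin_def formal.scale_right_diff_distrib sum_subtractf)
  then show "fconcat (p - p') q = fconcat p q - fconcat p' q" "fconcat p (q - q') = fconcat p q - fconcat p q'"
  "fconcat (fscale c p) q = fscale c (fconcat p q)" "fconcat p (fscale c q) = fscale c (fconcat p q)"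
    by (simp_all add: fconcat_def lin_diff lin_scale lin_fun_scale)
qed

lemma tmap_cls:
  assumes "\<And>f x y c. f \<in> set fs \<Longrightarrow> f (x + y) = tadd (f x) (f y) \<and> f (c *s x) = tscale c (f x)"
  shows "tmap fs (cls p) = cls (lin (\<lambda>xs. if length xs = length fs
                              then foldr fconcat (map2 (\<lambda>f x. rep (f x)) fs xs) (word [])
                              else 0) p)"
proof -
  let ?g = "\<lambda>fs xs. foldr fconcat (map2 (\<lambda>f x. rep (f x)) fs xs) (word [])"
  have rep_add: "rep (f (x + y)) - rep (f x) - rep (f y) \<in> formal.span relators"
    and rep_scale: "rep (f (c *s x)) - fscale c (rep (f x)) \<in> formal.span relators"
    if "f \<in> set fs" for f x y c
    using assms[OF that, of x y c] rep_cls[of "rep (f x) + rep (f y)"] rep_cls[of "fscale c (rep (f x))"]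
    by (simp_all add: tadd_def tscale_def algebra_simps)
  have add: "?g gs (us @ (x + y) # vs) - ?g gs (us @ x # vs) - ?g gs (us @ y # vs) \<in> formal.span relators"
    if "set gs \<subseteq> set fs" "Suc (length us + length vs) = length gs" for gs us x y vs
    using that
  proof (induction us arbitrary: gs)
    case Nil
    then obtain f hs where gs: "gs = f # hs" by (cases gs) auto
    show ?case using Nil rep_add[of f x y] fconcat_span(1)[OF rep_add[of f x y]]
      by (simp add: gs fconcat_diff)
  next
    case (Cons u us)
    then obtain f hs where gs: "gs = f # hs" by (cases gs) auto
    show ?case using Cons.prems fconcat_span(2)[OF Cons.IH[of hs]] by (simp add: gs fconcat_diff)
  qed
  have scale: "?g gs (us @ (c *s x) # vs) - fscale c (?g gs (us @ x # vs)) \<in> formal.span relators"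
    if "set gs \<subseteq> set fs" "Suc (length us + length vs) = length gs" for gs us c x vs
    using that
  proof (induction us arbitrary: gs)
    case Nil
    then obtain f hs where gs: "gs = f # hs" by (cases gs) auto
    show ?case using Nil fconcat_span(1)[OF rep_scale[of f c x]]
      by (simp add: gs fconcat_diff)
  next
    case (Cons u us)
    then obtain f hs where gs: "gs = f # hs" by (cases gs) auto
    show ?case using Cons.prems fconcat_span(2)[OF Cons.IH[of hs]] by (simp add: gs fconcat_diff)
  qed
  show ?thesis
    unfolding tmap_def
    by (rule cls_lin_rep, erule lin_relatorI[rotated 2])
       (use add[of fs] scale[of fs] in \<open>auto simp: formal.span_zero\<close>)
qed

lemma tmap_word:
  assumes "\<And>f x y c. f \<in> set fs \<Longrightarrow> f (x + y) = tadd (f x) (f y) \<and> f (c *s x) = tscale c (f x)"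
    and "\<And>f x. f \<in> set fs \<Longrightarrow> f x \<in> range cls"
    and "length xs = length fs"
  shows "tmap fs (cls (word xs)) = foldr (\<otimes>) (map2 (\<lambda>f x. f x) fs xs) (cls (word []))"
proof -
  have cls_rep: "cls (rep X) = X" if "X \<in> range cls" for X
    using that rep_cls by (metis cls_eq_iff rangeE)
  have "cls (foldr fconcat (map2 (\<lambda>f x. rep (f x)) gs xs) (word [])) =
      foldr (\<otimes>) (map2 (\<lambda>f x. f x) gs xs) (cls (word []))"
    if "length xs = length gs" "set gs \<subseteq> set fs" for gs xs
    using that
  proof (induction xs gs rule: list_induct2)
    case (Cons x xs g gs)
    then show ?case using assms(2)[of g x] by (simp add: cls_rep flip: otimes_cls)
  qed simp
  then show ?thesis using tmap_cls[OF assms(1), of fs "word xs"] assms(3) by simp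
qed

end

end

theory Submission
  imports Defs
begin

text \<open>
  Every ingredient of the twisted structure is an old ingredient multiplied by tensors built from
  \<open>F\<close>, and every axiom for the twisted structure reduces to the same axiom of \<open>A\<close> because
  the factors built from \<open>F\<close> cancel in pairs. Written out, for instance,
  \<open>(\<Delta>\<^sub>F \<otimes> 1) X = F\<^sub>1\<^sub>2 (\<Delta> \<otimes> 1)X F\<^sub>1\<^sub>2\<^sup>-\<^sup>1\<close> (\<open>tmap_twist\<close>), so that both sides of the twisted pentagon
  become one and the same word in invertible elements of \<open>A \<otimes> A \<otimes> A \<otimes> A\<close>, up to the old pentagon and two
  applications of quasi-coassociativity (\<open>twist_pentagon\<close>). In the hexagons the tensors in the middle
  disappear because \<open>\<R>\<^sub>1\<^sub>2\<close>, \<open>\<R>\<^sub>2\<^sub>3\<close> and \<open>\<R>\<^sub>1\<^sub>3\<close> turn \<open>\<Delta>\<close> into \<open>\<Delta>\<^sup>T\<close> in the two legs that they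
  act on (\<open>R_legs\<close>, \<open>R13_leg\<close>).

  Such computations are legitimate in the graded setting for two reasons.

  First, \<open>F\<close>, \<open>\<Phi>\<close>, \<open>\<R>\<close> and their inverses are all even, so that they pass other tensor legs
  without a sign. Homogeneity alone does not say so, but the counit normalisations do: a degree
  preserving map sends \<open>F\<close> to the unit, which is even, and if \<open>F\<close> were odd then the unit would
  vanish (\<open>homogeneous_even\<close>). The inverse of an even tensor is even because the projection to
  the even part commutes with multiplication by even tensors (\<open>is_tinv_even\<close>). For \<open>\<R>\<close> the
  first hexagon shows that \<open>(\<Delta> \<otimes> 1)\<R>\<close> has twice the degree of \<open>\<R>\<close>, and
  \<open>\<R> = (\<epsilon> \<otimes> 1 \<otimes> 1)(\<Delta> \<otimes> 1)\<R>\<close> (\<open>R_even\<close>).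

  Second, the maps \<open>f\<^sub>1 \<otimes> \<dots> \<otimes> f\<^sub>n\<close>, the graded twists and \<open>X \<mapsto> X \<otimes> 1\<close>, \<open>X \<mapsto> 1 \<otimes> X\<close> are all
  graded algebra homomorphisms between tensor powers (\<open>tensor_hom_tmap\<close>, \<open>tensor_hom_gtwist\<close>).
  They preserve products and inverses, and an identity between compositions of them has to be
  checked on homogeneous pure tensors only (\<open>tpower_ext\<close>), where the Koszul signs are explicit.

  For the antipode, a contraction such as \<open>x \<otimes> y \<mapsto> S(x) a y\<close> behaves like an action:
  contracting a product \<open>X Y\<close> with \<open>X\<close> even is the same as contracting \<open>Y\<close> with \<open>a\<close> replaced by
  the contraction of \<open>X\<close> (\<open>S_left_tmult_even\<close>). Hence replacing \<open>\<alpha>\<close> by \<open>\<alpha>\<^sub>F\<close> multiplies the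
  argument by \<open>F\<^sup>-\<^sup>1\<close>, which cancels the \<open>F\<close> of \<open>\<Delta>\<^sub>F\<close> and \<open>\<Phi>\<^sub>F\<close>, and what is left of \<open>F\<close> is
  absorbed by the axioms for \<open>\<alpha>\<close> and \<open>\<beta>\<close> and the counit normalisation
  (\<open>zigzag_inv_coprod_left\<close> and its companions).
\<close>

section \<open>Koszul signs\<close>

(* Degrees are added; rewriting sums to exclusive disjunctions would hide the additivity of the sign. *)
declare add_bit_eq_xor [simp del]

lemma bit_add_self [simp]: "d + d = (0::bit)" "d + (d + e) = (e::bit)"
  by (cases d; cases e; simp add: add_bit_eq_xor)+

definition ksign :: "bit \<Rightarrow> bit \<Rightarrow> 'k::field" where
  "ksign d e = (if d = 1 \<and> e = 1 then - 1 else 1)"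

lemma ksign_0 [simp]: "ksign 0 e = 1" "ksign d 0 = 1"
  by (simp_all add: ksign_def)

lemma ksign_add: "ksign (a + b) c = ksign a c * ksign b c" "ksign c (a + b) = ksign c a * ksign c b"
  by (cases a; cases b; cases c; simp add: ksign_def add_bit_eq_xor)+

lemma ksign_commute: "ksign a b = ksign b a"
  by (simp add: ksign_def)

lemma ksign_square [simp]: "ksign a b * ksign a b = 1" "ksign a b * (ksign a b * c) = c"
  by (simp_all add: ksign_def)

lemma koszul_Nil [simp]: "koszul [] es = 1"
  by (simp add: koszul_def)

lemma koszul_snoc:
  assumes "length ds = length es"
  shows "koszul (ds @ [d]) (es @ [e]) = (koszul ds es * ksign d (sum_list es) :: 'k::field)"
proof -
  have "(\<Prod>j<length es. ksign d ((es @ [e]) ! j)) = (ksign d (sum_list es) :: 'k)"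
    by (induction es arbitrary: e rule: rev_induct) (simp_all add: nth_append ksign_add)
  moreover have "(koszul ds es :: 'k) = (\<Prod>i<length ds. \<Prod>j<i. ksign ((ds @ [d]) ! i) ((es @ [e]) ! j))"
    unfolding koszul_def ksign_def using assms by (intro prod.cong) (auto simp: nth_append)
  ultimately show ?thesis
    using assms by (simp add: koszul_def ksign_def[symmetric] mult.commute nth_append)
qed

text \<open>The extra sign comes from moving the second block of the left factor past the first block of
  the right factor.\<close>

lemma koszul_append:
  assumes "length ds = length es" "length ds' = length es'"
  shows "koszul (ds @ ds') (es @ es') =
    (koszul ds es * koszul ds' es' * ksign (sum_list ds') (sum_list es) :: 'k::field)"
  using assms(2,1)
proof (induction ds' es' rule: rev_induct2)
  case (4 d ds' e es')
  have "(koszul (ds @ ds' @ [d]) (es @ es' @ [e]) :: 'k) =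
    koszul (ds @ ds') (es @ es') * ksign d (sum_list es + sum_list es')"
    using koszul_snoc[of "ds @ ds'" "es @ es'" d e, where ?'k='k] 4 by simp
  moreover have "koszul (ds' @ [d]) (es' @ [e]) = koszul ds' es' * (ksign d (sum_list es') :: 'k)"
    using 4 by (intro koszul_snoc) simp
  ultimately show ?case using 4 by (simp add: ksign_add mult_ac)
qed auto

lemma sum_list_map2_add:
  "length ds = length es \<Longrightarrow> sum_list (map2 (+) ds es) = sum_list ds + sum_list (es :: bit list)"
  by (induction ds es rule: list_induct2) (simp_all add: add_ac)

text \<open>Associativity of the graded multiplication, on the level of signs.\<close>

lemma koszul_cocycle:
  assumes "length ds = length es" "length es = length fs"
  shows "koszul ds es * koszul (map2 (+) ds es) fs =
    (koszul ds (map2 (+) es fs) * koszul es fs :: 'k::field)"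
proof -
  have *: "koszul (d # ds) (e # es) = (koszul ds es * ksign (sum_list ds) e :: 'k)"
    if "length ds = length es" for d e ds es
    using koszul_append[of "[d]" "[e]" ds es, where ?'k='k] koszul_snoc[of "[]" "[]" d e, where ?'k='k] that by simp
  show ?thesis using assms
  proof (induction ds es fs rule: list_induct3)
    case (Cons d ds e es f fs)
    then show ?case by (simp add: * sum_list_map2_add ksign_add mult_ac)
  qed simp
qed

context superalgebra
begin

section \<open>Linear maps of tensors\<close>

lemma tadd_cls: "tadd (cls p) (cls q) = cls (p + q)"
proof -
  have "(rep (cls p) - p) + (rep (cls q) - q) \<in> formal.span relators"
    by (intro formal.span_add rep_cls)
  then show ?thesis by (simp add: tadd_def cls_eq_iff algebra_simps)
qed

lemma tscale_cls: "tscale c (cls p) = cls (fscale c p)"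
  using formal.span_scale[OF rep_cls[of p], of c]
  by (simp add: tscale_def cls_eq_iff formal.scale_right_diff_distrib)

lemma cls_rep: "X \<in> range cls \<Longrightarrow> cls (rep X) = X"
  using rep_cls by (metis cls_eq_iff rangeE)

text \<open>Tensors are classes of formal sums and do not form a type, so linearity is required on classes
  only and nothing is said about other sets. The number of factors is left open: all tensor powers are
  contained in \<open>range cls\<close>, and the notion is closed under composition without bookkeeping.\<close>

definition tlin :: "(('k, 'a) formal set \<Rightarrow> ('k, 'a) formal set) \<Rightarrow> bool" where
  "tlin g \<longleftrightarrow> (\<forall>p. g (cls p) \<in> range cls) \<and>
     (\<forall>p q. g (cls (p + q)) = tadd (g (cls p)) (g (cls q))) \<and>
     (\<forall>c p. g (cls (fscale c p)) = tscale c (g (cls p)))"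

lemma tlinI:
  assumes "\<And>p. g (cls p) = cls (lin w p)"
  shows "tlin g"
  unfolding tlin_def assms by (simp add: lin_add lin_scale tadd_cls tscale_cls)

lemma tlin_range: "tlin g \<Longrightarrow> X \<in> range cls \<Longrightarrow> g X \<in> range cls"
  by (auto simp: tlin_def)

lemma tlin_tadd: "tlin g \<Longrightarrow> X \<in> range cls \<Longrightarrow> Y \<in> range cls \<Longrightarrow> g (tadd X Y) = tadd (g X) (g Y)"
  by (auto simp: tlin_def tadd_cls)

lemma tlin_tscale: "tlin g \<Longrightarrow> X \<in> range cls \<Longrightarrow> g (tscale c X) = tscale c (g X)"
  by (auto simp: tlin_def tscale_cls)

lemma tlin_id: "tlin (\<lambda>X. X)"
  by (auto simp: tlin_def tadd_cls tscale_cls)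

lemma tlin_comp:
  assumes "tlin g" "tlin h"
  shows "tlin (\<lambda>X. g (h X))"
  unfolding tlin_def
proof (intro conjI allI)
  fix p q c
  have r: "h (cls p) \<in> range cls" for p
    using assms(2) by (simp add: tlin_def)
  show "g (h (cls p)) \<in> range cls"
    by (rule tlin_range[OF assms(1) r])
  show "g (h (cls (p + q))) = tadd (g (h (cls p))) (g (h (cls q)))"
    using tlin_tadd[OF assms(1) r r, of p q] assms(2) by (simp add: tlin_def)
  show "g (h (cls (fscale c p))) = tscale c (g (h (cls p)))"
    using tlin_tscale[OF assms(1) r, of c p] assms(2) by (simp add: tlin_def)
qed

text \<open>The operations read off representatives, so a product does not change when an arbitrary set is
  replaced by the class of its representative. This is why linearity in each argument and
  associativity can be stated for arbitrary sets.\<close>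

lemma tmult_rep: "X \<cdot> Y = cls (rep X) \<cdot> cls (rep Y)"
  by (simp add: tmult_cls) (simp add: tmult_def)

lemma otimes_rep: "X \<otimes> Y = cls (rep X) \<otimes> cls (rep Y)"
  by (simp add: otimes_cls) (simp add: otimes_def)

lemma tmult_range [simp]: "X \<cdot> Y \<in> range cls"
  by (simp add: tmult_def)

lemma otimes_range [simp]: "X \<otimes> Y \<in> range cls"
  by (simp add: otimes_def)

lemma cls_tmult_right: "cls p \<cdot> Y = cls (lin (\<lambda>xs. lin (\<lambda>ys. word_mult xs ys) (rep Y)) p)"
  using tmult_cls[of "rep (cls p)" "rep Y"] tmult_cls[of p "rep Y"]
    cls_rep[of "cls p"] by (simp add: tmult_rep[of "cls p" Y])

lemma cls_otimes_right: "cls p \<otimes> Y = cls (lin (\<lambda>xs. lin (\<lambda>ys. word (xs @ ys)) (rep Y)) p)"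
  using cls_rep[of "cls p"] by (simp add: otimes_rep[of "cls p" Y] otimes_cls fconcat_def)

lemma tlin_tmult_left: "tlin (\<lambda>X. X \<cdot> Y)"
  by (rule tlinI, rule cls_tmult_right)

lemma tlin_tmult_right: "tlin (\<lambda>Y. X \<cdot> Y)"
proof (rule tlinI)
  fix p
  show "X \<cdot> cls p = cls (lin (\<lambda>ys. lin (\<lambda>xs. word_mult xs ys) (rep X)) p)"
    using cls_rep[of "cls p"] tmult_cls[of "rep X" p]
    by (simp add: tmult_rep[of X "cls p"] lin_lin_commute[of word_mult])
qed

lemma tlin_otimes_left: "tlin (\<lambda>X. X \<otimes> Y)"
  by (rule tlinI, rule cls_otimes_right)

lemma tlin_otimes_right: "tlin (\<lambda>Y. X \<otimes> Y)"
proof (rule tlinI)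
  fix p
  show "X \<otimes> cls p = cls (lin (\<lambda>ys. lin (\<lambda>xs. word (xs @ ys)) (rep X)) p)"
    using cls_rep[of "cls p"] otimes_cls[of "rep X" p] 
    by (simp add: otimes_rep[of X "cls p"] fconcat_def lin_lin_commute[of "\<lambda>xs ys. word (xs @ ys)"])
qed

lemma tlin_scaling: "tlin (tscale c)"
  by (auto simp: tlin_def tscale_cls tadd_cls formal.scale_right_distrib mult.commute)

lemma tlin_gtwist: "tlin (gtwist k)"
  by (rule tlinI, rule gtwist_cls)

lemmas tlin_intros =
  tlin_id
  tlin_comp[OF tlin_tmult_left] tlin_comp[OF tlin_tmult_right]
  tlin_comp[OF tlin_otimes_left] tlin_comp[OF tlin_otimes_right]
  tlin_comp[OF tlin_scaling] tlin_comp[OF tlin_gtwist]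

lemma tlin_0: "tlin g \<Longrightarrow> g (cls 0) = cls 0"
proof -
  assume g: "tlin g"
  then obtain q where "g (cls 0) = cls q" unfolding tlin_def by (meson rangeE)
  moreover have "g (cls 0) = tscale 0 (g (cls 0))"
    using tlin_tscale[OF g, of "cls 0" 0] by (simp add: tscale_cls)
  ultimately show ?thesis by (simp add: tscale_cls)
qed

text \<open>Agreement of two linear maps is a linear condition on the formal sum; this and the next lemma
  are what reduces statements about tensors to statements about words.\<close>

lemma subspace_tlin_eq:
  assumes "tlin g" "tlin h"
  shows "formal.subspace {p. g (cls p) = h (cls p)}"
  using assms tlin_0[of g] tlin_0[of h] unfolding formal.subspace_def by (auto simp: tlin_def)

lemma subspace_tlin_vimage:
  assumes "tlin g" "formal.subspace {p. cls p \<in> T}"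
  shows "formal.subspace {p. g (cls p) \<in> T}"
proof (rule formal.subspaceI)
  show "0 \<in> {p. g (cls p) \<in> T}"
    using assms formal.subspace_0[OF assms(2)] by (simp add: tlin_0)
next
  fix p q assume *: "p \<in> {p. g (cls p) \<in> T}" "q \<in> {p. g (cls p) \<in> T}"
  obtain p' q' where pq: "g (cls p) = cls p'" "g (cls q) = cls q'"
    using assms(1) unfolding tlin_def by (meson rangeE)
  then have "g (cls (p + q)) = cls (p' + q')"
    using assms(1) by (simp add: tlin_def tadd_cls)
  then show "p + q \<in> {p. g (cls p) \<in> T}"
    using * pq formal.subspace_add[OF assms(2), of p' q'] by simp
next
  fix c p assume *: "p \<in> {p. g (cls p) \<in> T}"
  obtain p' where p: "g (cls p) = cls p'"
    using assms(1) unfolding tlin_def by (meson rangeE)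
  then have "g (cls (fscale c p)) = cls (fscale c p')"
    using assms(1) by (simp add: tlin_def tscale_cls)
  then show "fscale c p \<in> {p. g (cls p) \<in> T}"
    using * p formal.subspace_scale[OF assms(2), of p' c] by simp
qed

section \<open>Reduction to homogeneous pure tensors\<close>

abbreviation degrees :: "'a list \<Rightarrow> bit list \<Rightarrow> bool" where
  "degrees xs ds \<equiv> list_all2 (\<lambda>x d. x \<in> gr d) xs ds"

lemma formal_eq_sum:
  fixes p :: "('k, 'a) formal"
  shows "p = (\<Sum>xs\<in>Poly_Mapping.keys p. fscale (Poly_Mapping.lookup p xs) (word xs))"
proof (rule poly_mapping_eqI)
  fix ys
  have "Poly_Mapping.lookup (\<Sum>xs\<in>I. fscale (f xs) (word xs)) ys =
      (\<Sum>xs\<in>I. if xs = ys then f xs else 0)" for I :: "'a list set" and f :: "'a list \<Rightarrow> 'k"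
    by (induction I rule: infinite_finite_induct) (auto simp: lookup_add lookup_single when_def)
  then show "Poly_Mapping.lookup p ys = Poly_Mapping.lookup
      (\<Sum>xs\<in>Poly_Mapping.keys p. fscale (Poly_Mapping.lookup p xs) (word xs)) ys"
    by (simp add: in_keys_iff)
qed

lemma formal_induct:
  fixes p :: "('k, 'a) formal"
  assumes "formal.subspace V" "\<And>xs. xs \<in> Poly_Mapping.keys p \<Longrightarrow> word xs \<in> V"
  shows "p \<in> V"
proof -
  have "(\<Sum>xs\<in>Poly_Mapping.keys p. fscale (Poly_Mapping.lookup p xs) (word xs)) \<in> V"
    by (intro formal.subspace_sum formal.subspace_scale assms)
  then show ?thesis using formal_eq_sum[of p] by simp
qed

lemma part_sum: "part 0 x + part 1 x = x"
proof -
  have "x - part 0 x \<in> gr 1" using part_diff[of x 0] by simp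
  then have "part 1 x = x - part 0 x"
    using part_in[of 0 x] by (intro part_unique) simp_all
  then show ?thesis by simp
qed

lemma tpower_gr_induct:
  assumes "X \<in> tpower_gr n d" "formal.subspace {p. P (cls p)}"
    and "\<And>xs ds. length xs = n \<Longrightarrow> degrees xs ds \<Longrightarrow> sum_list ds = d \<Longrightarrow> P (cls (word xs))"
  shows "P X"
proof -
  obtain p where p: "X = cls p" and
    *: "\<forall>xs\<in>Poly_Mapping.keys p. length xs = n \<and> (\<exists>ds. degrees xs ds \<and> sum_list ds = d)"
    using assms(1) unfolding tpower_gr_def by blast
  have "p \<in> {p. P (cls p)}"
    by (rule formal_induct[OF assms(2)]) (use * assms(3) in blast)
  then show ?thesis using p by simp
qed

text \<open>Splitting each letter into its even and odd part writes every pure tensor as a sum of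
  homogeneous ones.\<close>

lemma word_homogeneous_decomposition:
  assumes "formal.subspace {p. P (cls p)}"
    and "\<And>ys ds. length ys = length xs \<Longrightarrow> degrees ys ds \<Longrightarrow> P (cls (word ys))"
  shows "P (cls (word xs))"
proof -
  \<comment> \<open>The letters in \<open>us\<close> have been replaced by homogeneous ones already.\<close>
  have "P (cls (word (us @ xs)))"
    if "degrees us es" "\<And>ys ds. length ys = length (us @ xs) \<Longrightarrow> degrees ys ds \<Longrightarrow> P (cls (word ys))" for us es
    using that
  proof (induction xs arbitrary: us es)
    case (Cons x xs)
    have P: "P (cls (word (us @ part d x # xs)))" for d
      using Cons.IH[of "us @ [part d x]" "es @ [d]"] Cons.prems part_in[of d x]
      by (simp add: list_all2_appendI)
    have "cls (word (us @ x # xs)) = cls (word (us @ part 0 x # xs) + word (us @ part 1 x # xs))"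
      using word_add_span[of us "part 0 x" "part 1 x" xs]
      by (simp only: part_sum cls_eq_iff diff_diff_eq)
    then show ?case using formal.subspace_add[OF assms(1)] P by simp
  qed auto
  from this[of "[]" "[]"] show ?thesis using assms(2) by simp
qed

lemma tpower_induct:
  assumes "X \<in> tpower n" "formal.subspace {p. P (cls p)}"
    and "\<And>xs ds. length xs = n \<Longrightarrow> degrees xs ds \<Longrightarrow> P (cls (word xs))"
  shows "P X"
proof -
  obtain p where p: "X = cls p" and *: "\<forall>xs\<in>Poly_Mapping.keys p. length xs = n"
    using assms(1) unfolding tpower_def by blast
  have w: "P (cls (word xs))" if "length xs = n" for xs
    by (rule word_homogeneous_decomposition[OF assms(2)], rule assms(3)) (use that in simp_all)
  have "p \<in> {p. P (cls p)}"
    by (rule formal_induct[OF assms(2)]) (use * w in simp)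
  then show ?thesis using p by simp
qed

lemma cls_induct:
  assumes "formal.subspace {p. P (cls p)}"
    and "\<And>xs ds. degrees xs ds \<Longrightarrow> P (cls (word xs))"
  shows "P (cls p)"
proof -
  have w: "P (cls (word xs))" for xs
    by (rule word_homogeneous_decomposition[OF assms(1)], rule assms(2))
  have "p \<in> {p. P (cls p)}"
    by (rule formal_induct[OF assms(1)]) (simp add: w)
  then show ?thesis by simp
qed

lemma tpower_gr_ext:
  assumes "X \<in> tpower_gr n d" "tlin g" "tlin h"
    and "\<And>xs ds. length xs = n \<Longrightarrow> degrees xs ds \<Longrightarrow> sum_list ds = d \<Longrightarrow> g (cls (word xs)) = h (cls (word xs))"
  shows "g X = h X"
  using assms(1) subspace_tlin_eq[OF assms(2,3)] assms(4) by (rule tpower_gr_induct)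

text \<open>The main device of the development: identities between multilinear expressions are checked
  one argument at a time, on homogeneous pure tensors.\<close>

lemma tpower_ext:
  assumes "X \<in> tpower n" "tlin g" "tlin h"
    and "\<And>xs ds. length xs = n \<Longrightarrow> degrees xs ds \<Longrightarrow> g (cls (word xs)) = h (cls (word xs))"
  shows "g X = h X"
  using assms(1) subspace_tlin_eq[OF assms(2,3)] assms(4) by (rule tpower_induct)

lemma cls_ext:
  assumes "tlin g" "tlin h"
    and "\<And>xs ds. degrees xs ds \<Longrightarrow> g (cls (word xs)) = h (cls (word xs))"
  shows "g (cls p) = h (cls p)"
  using subspace_tlin_eq[OF assms(1,2)] assms(3) by (rule cls_induct)

text \<open>Makes membership in a tensor power, or in one of its homogeneous components, a linear
  condition on the formal sum, so that the induction principles apply to it.\<close>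

lemma subspace_cls_image:
  assumes "formal.subspace V"
  shows "formal.subspace {p. cls p \<in> cls ` V}"
proof -
  have "{p. cls p \<in> cls ` V} = {x + y |x y. x \<in> formal.span relators \<and> y \<in> V}"
  proof (intro set_eqI iffI)
    fix p assume "p \<in> {p. cls p \<in> cls ` V}"
    then obtain v where "v \<in> V" "p - v \<in> formal.span relators"
      by (auto simp only: mem_Collect_eq image_iff cls_eq_iff)
    then show "p \<in> {x + y |x y. x \<in> formal.span relators \<and> y \<in> V}"
      unfolding mem_Collect_eq by (intro exI[of _ "p - v"] exI[of _ v]) simp
  next
    fix p assume "p \<in> {x + y |x y. x \<in> formal.span relators \<and> y \<in> V}"
    then obtain x v where "p = x + v" "x \<in> formal.span relators" "v \<in> V" by blast
    then have "cls p = cls v" "v \<in> V" by (simp_all add: cls_eq_iff)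
    then show "p \<in> {p. cls p \<in> cls ` V}" by simp
  qed
  then show ?thesis
    using formal.subspace_sums[OF formal.subspace_span[of relators] assms] by simp
qed

lemma subspace_keys:
  fixes Q :: "'a list \<Rightarrow> bool"
  shows "formal.subspace {p :: ('k, 'a) formal. \<forall>xs\<in>Poly_Mapping.keys p. Q xs}"
proof (rule formal.subspaceI)
  fix p q :: "('k, 'a) formal"
  assume "p \<in> {p. \<forall>xs\<in>Poly_Mapping.keys p. Q xs}" "q \<in> {p. \<forall>xs\<in>Poly_Mapping.keys p. Q xs}"
  then show "p + q \<in> {p. \<forall>xs\<in>Poly_Mapping.keys p. Q xs}" using keys_add[of p q] by blast
qed (auto simp: in_keys_iff)

lemma subspace_tpower: "formal.subspace {p. cls p \<in> tpower n}"
  unfolding tpower_def by (intro subspace_cls_image subspace_keys)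

lemma subspace_tpower_gr: "formal.subspace {p. cls p \<in> tpower_gr n d}"
  unfolding tpower_gr_def by (intro subspace_cls_image subspace_keys)

lemma tpower_gr_subset: "X \<in> tpower_gr n d \<Longrightarrow> X \<in> tpower n"
  unfolding tpower_gr_def tpower_def by blast

lemma tpower_range: "X \<in> tpower n \<Longrightarrow> X \<in> range cls"
  unfolding tpower_def by blast

lemma tpower_gr_range: "X \<in> tpower_gr n d \<Longrightarrow> X \<in> range cls"
  unfolding tpower_gr_def by blast

lemma word_tpower: "length xs = n \<Longrightarrow> cls (word xs) \<in> tpower n"
  unfolding tpower_def by (intro image_eqI[of _ _ "word xs"]) auto

lemma word_tpower_gr: "length xs = n \<Longrightarrow> degrees xs ds \<Longrightarrow> sum_list ds = d \<Longrightarrow> cls (word xs) \<in> tpower_gr n d"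
  unfolding tpower_gr_def by (intro image_eqI[of _ _ "word xs"]) auto

lemma tscale_tpower_gr:
  assumes "X \<in> tpower_gr n d"
  shows "tscale c X \<in> tpower_gr n d"
proof -
  obtain p where "X = cls p" using tpower_gr_range[OF assms] by blast
  then show ?thesis
    using formal.subspace_scale[OF subspace_tpower_gr, of p n d c] assms by (simp add: tscale_cls)
qed

lemma tscale_1: "X \<in> range cls \<Longrightarrow> tscale 1 X = X"
  by (auto simp: tscale_cls)

lemma tlin_tpower:
  assumes "tlin g" "X \<in> tpower n" 
    and "\<And>xs ds. length xs = n \<Longrightarrow> degrees xs ds \<Longrightarrow> g (cls (word xs)) \<in> tpower m"
  shows "g X \<in> tpower m"
  using assms(2) subspace_tlin_vimage[OF assms(1) subspace_tpower] assms(3) by (rule tpower_induct)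

lemma tlin_tpower_gr:
  assumes "tlin g" "X \<in> tpower_gr n d" 
    and "\<And>xs ds. length xs = n \<Longrightarrow> degrees xs ds \<Longrightarrow> sum_list ds = d \<Longrightarrow> g (cls (word xs)) \<in> tpower_gr m e"
  shows "g X \<in> tpower_gr m e"
  using assms(2) subspace_tlin_vimage[OF assms(1) subspace_tpower_gr] assms(3) by (rule tpower_gr_induct)

section \<open>The graded multiplication and the tensor product\<close>

lemma degrees_length: "degrees xs ds \<Longrightarrow> length ds = length xs"
  by (simp add: list_all2_lengthD)

lemma degrees_append: "degrees xs ds \<Longrightarrow> degrees ys es \<Longrightarrow> degrees (xs @ ys) (ds @ es)"
  by (rule list_all2_appendI)

lemma degrees_map2:
  "degrees xs ds \<Longrightarrow> degrees ys es \<Longrightarrow> length xs = length ys \<Longrightarrow> degrees (map2 (*) xs ys) (map2 (+) ds es)"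
  by (auto simp: list_all2_conv_all_nth gr_mult)

lemma tmult_words:
  assumes "degrees xs ds" "degrees ys es" "length xs = length ys"
  shows "cls (word xs) \<cdot> cls (word ys) = tscale (koszul ds es) (cls (word (map2 (*) xs ys)))"
  using tmult_homogeneous[OF assms] by (simp add: tscale_cls)

lemma tmult_words_neq:
  "length xs \<noteq> length ys \<Longrightarrow> cls (word xs) \<cdot> cls (word ys) = cls 0"
  by (simp add: tmult_cls word_mult_def)

lemma tmult_0 [simp]: "cls 0 \<cdot> X = cls 0" "X \<cdot> cls 0 = cls 0"
  using tlin_0[OF tlin_tmult_left] tlin_0[OF tlin_tmult_right] by auto

lemma tscale_0 [simp]: "tscale c (cls 0) = cls 0"
  by (simp add: tscale_cls)

lemma tmult_tscale_left [simp]: "X \<in> range cls \<Longrightarrow> tscale c X \<cdot> Y = tscale c (X \<cdot> Y)"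
  by (rule tlin_tscale[OF tlin_tmult_left])

lemma tmult_tscale_right [simp]: "Y \<in> range cls \<Longrightarrow> X \<cdot> tscale c Y = tscale c (X \<cdot> Y)"
  by (rule tlin_tscale[OF tlin_tmult_right])

lemma otimes_tscale_left [simp]: "X \<in> range cls \<Longrightarrow> tscale c X \<otimes> Y = tscale c (X \<otimes> Y)"
  by (rule tlin_tscale[OF tlin_otimes_left])

lemma otimes_tscale_right [simp]: "Y \<in> range cls \<Longrightarrow> X \<otimes> tscale c Y = tscale c (X \<otimes> Y)"
  by (rule tlin_tscale[OF tlin_otimes_right])

lemma tscale_tscale [simp]: "X \<in> range cls \<Longrightarrow> tscale c (tscale d X) = tscale (c * d) X"
  by (auto simp: tscale_cls)

text \<open>Words of different lengths have product \<open>0\<close> in either bracketing; for equal lengths the signs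
  agree by \<open>koszul_cocycle\<close>.\<close>

lemma tmult_assoc: "X \<cdot> Y \<cdot> Z = X \<cdot> (Y \<cdot> Z)"
proof -
  have *: "cls (word xs) \<cdot> cls (word ys) \<cdot> cls (word zs) = cls (word xs) \<cdot> (cls (word ys) \<cdot> cls (word zs))"
    if "degrees xs ds" "degrees ys es" "degrees zs fs" for xs ys zs ds es fs
  proof (cases "length xs = length ys \<and> length ys = length zs")
    case True
    then have len: "length ds = length es" "length es = length fs"
      using that by (simp_all add: degrees_length)
    have "map2 (*) (map2 (*) xs ys) zs = map2 (*) xs (map2 (*) ys zs)"
      using True by (auto intro!: nth_equalityI simp: mult.assoc)
    moreover have "cls (word (map2 (*) xs ys)) \<cdot> cls (word zs) = 
        tscale (koszul (map2 (+) ds es) fs) (cls (word (map2 (*) (map2 (*) xs ys) zs)))"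
      by (rule tmult_words) (use True that degrees_map2 in auto)
    moreover have "cls (word xs) \<cdot> cls (word (map2 (*) ys zs)) = 
        tscale (koszul ds (map2 (+) es fs)) (cls (word (map2 (*) xs (map2 (*) ys zs))))"
      by (rule tmult_words) (use True that degrees_map2 in auto)
    ultimately show ?thesis using True koszul_cocycle[OF len, where ?'k='k]
      by (simp add: tmult_words[OF that(1,2)] tmult_words[OF that(2,3)] mult.commute)
  next
    case False
    then consider "length xs \<noteq> length ys" "length ys \<noteq> length zs" | "length xs = length ys" "length ys \<noteq> length zs"
      | "length xs \<noteq> length ys" "length ys = length zs" by blast
    then show ?thesis
      using that by cases (simp_all add: tmult_words tmult_words_neq)
  qed
  have "cls p \<cdot> cls q \<cdot> cls r = cls p \<cdot> (cls q \<cdot> cls r)" for p q r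
    by (rule cls_ext[of "\<lambda>X. X \<cdot> _ \<cdot> _"], (intro tlin_intros)+,
        rule cls_ext[of "\<lambda>Y. _ \<cdot> Y \<cdot> _"], (intro tlin_intros)+,
        rule cls_ext[of "\<lambda>Z. _ \<cdot> _ \<cdot> Z"], (intro tlin_intros)+, rule *)
  then have "cls (rep X) \<cdot> cls (rep Y) \<cdot> cls (rep Z) = cls (rep X) \<cdot> (cls (rep Y) \<cdot> cls (rep Z))" .
  then show ?thesis
    by (simp flip: tmult_rep add: tmult_rep[of "_ \<cdot> _" Z] tmult_rep[of X "_ \<cdot> _"] cls_rep)
qed

lemma otimes_assoc: "X \<otimes> Y \<otimes> Z = X \<otimes> (Y \<otimes> Z)"
proof -
  have "cls p \<otimes> cls q \<otimes> cls r = cls p \<otimes> (cls q \<otimes> cls r)" for p q r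
    by (rule cls_ext[of "\<lambda>X. X \<otimes> _ \<otimes> _"], (intro tlin_intros)+,
        rule cls_ext[of "\<lambda>Y. _ \<otimes> Y \<otimes> _"], (intro tlin_intros)+,
        rule cls_ext[of "\<lambda>Z. _ \<otimes> _ \<otimes> Z"], (intro tlin_intros)+, simp add: otimes_word)
  then have "cls (rep X) \<otimes> cls (rep Y) \<otimes> cls (rep Z) = cls (rep X) \<otimes> (cls (rep Y) \<otimes> cls (rep Z))" .
  then show ?thesis
    by (simp flip: otimes_rep add: otimes_rep[of "_ \<otimes> _" Z] otimes_rep[of X "_ \<otimes> _"] cls_rep)
qed

lemma otimes_Nil [simp]:
  assumes "X \<in> range cls"
  shows "cls (word []) \<otimes> X = X" "X \<otimes> cls (word []) = X"
proof -
  obtain p where p: "X = cls p" using assms by blast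
  show "cls (word []) \<otimes> X = X" unfolding p
    by (rule cls_ext[of "\<lambda>X. _ \<otimes> X" "\<lambda>X. X"]) ((intro tlin_intros)+, simp add: otimes_word)
  show "X \<otimes> cls (word []) = X" unfolding p
    by (rule cls_ext[of "\<lambda>X. X \<otimes> _" "\<lambda>X. X"]) ((intro tlin_intros)+, simp add: otimes_word)
qed

lemma tone_gr: "tone n \<in> tpower_gr n 0"
proof -
  have "degrees (replicate n 1) (replicate n 0)"
    using gr_one by (simp add: list_all2_conv_all_nth)
  moreover have "sum_list (replicate n (0::bit)) = 0" by (induction n) auto
  ultimately show ?thesis unfolding tone_def by (intro word_tpower_gr) auto
qed

lemma koszul_replicate_0: 
  "length es = n \<Longrightarrow> koszul (replicate n 0) es = 1" "length es = n \<Longrightarrow> koszul es (replicate n 0) = 1"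
  unfolding koszul_def by (auto intro!: prod.neutral)

lemma tone_mult [simp]:
  assumes "X \<in> tpower n"
  shows "tone n \<cdot> X = X" "X \<cdot> tone n = X"
proof -
  have 1: "degrees (replicate n 1) (replicate n 0)"
    using gr_one by (simp add: list_all2_conv_all_nth)
  have 2: "map2 (*) (replicate n 1) xs = xs" "map2 (*) xs (replicate n 1) = xs"
    if "length xs = n" for xs :: "'a list"
    using that by (auto intro!: nth_equalityI)
  show "tone n \<cdot> X = X"
    using assms by (rule tpower_ext[of _ _ "\<lambda>X. _ \<cdot> X" "\<lambda>X. X"]; (intro tlin_intros)?)
      (simp add: tone_def tmult_words[OF 1] 2 koszul_replicate_0 degrees_length tscale_1)
  show "X \<cdot> tone n = X"
    using assms by (rule tpower_ext[of _ _ "\<lambda>X. X \<cdot> _" "\<lambda>X. X"]; (intro tlin_intros)?)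
      (simp add: tone_def tmult_words[OF _ 1] 2 koszul_replicate_0 degrees_length tscale_1)
qed

lemma otimes_tone [simp]: "tone m \<otimes> tone n = tone (m + n)"
  by (simp add: tone_def otimes_word replicate_add)

lemma tone_0: "tone 0 = cls (word [])" and tone_1: "tone (Suc 0) = emb 1"
  by (simp_all add: tone_def emb_def)

lemma emb_gr: "x \<in> gr d \<Longrightarrow> emb x \<in> tpower_gr 1 d"
  unfolding emb_def by (rule word_tpower_gr[of _ _ "[d]"]) auto

lemma emb_tpower: "emb x \<in> tpower 1"
  unfolding emb_def by (rule word_tpower) simp

lemma otimes_gr:
  assumes "X \<in> tpower_gr m d" "Y \<in> tpower_gr n e"
  shows "X \<otimes> Y \<in> tpower_gr (m + n) (d + e)"
  using assms(1)
proof (rule tlin_tpower_gr[rotated])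
  fix xs ds assume 1: "length xs = m" "degrees xs ds" "sum_list ds = d"
  show "cls (word xs) \<otimes> Y \<in> tpower_gr (m + n) (d + e)"
    using assms(2)
  proof (rule tlin_tpower_gr[rotated])
    fix ys es assume 2: "length ys = n" "degrees ys es" "sum_list es = e"
    show "cls (word xs) \<otimes> cls (word ys) \<in> tpower_gr (m + n) (d + e)"
      unfolding otimes_word using 1 2
      by (intro word_tpower_gr[of _ _ "ds @ es"] degrees_append) auto
  qed (intro tlin_intros)
qed (intro tlin_intros)

lemma otimes_tpower:
  assumes "X \<in> tpower m" "Y \<in> tpower n"
  shows "X \<otimes> Y \<in> tpower (m + n)"
  using assms(1)
proof (rule tlin_tpower[rotated])
  fix xs ds assume 1: "length xs = m" "degrees xs ds"
  show "cls (word xs) \<otimes> Y \<in> tpower (m + n)"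
    using assms(2) by (rule tlin_tpower[rotated]) (use 1 in \<open>auto simp: otimes_word intro: tlin_intros word_tpower\<close>)
qed (intro tlin_intros)

lemma tmult_gr:
  assumes "X \<in> tpower_gr n d" "Y \<in> tpower_gr n e"
  shows "X \<cdot> Y \<in> tpower_gr n (d + e)"
  using assms(1)
proof (rule tlin_tpower_gr[rotated])
  fix xs ds assume 1: "length xs = n" "degrees xs ds" "sum_list ds = d"
  show "cls (word xs) \<cdot> Y \<in> tpower_gr n (d + e)"
    using assms(2)
  proof (rule tlin_tpower_gr[rotated])
    fix ys es assume 2: "length ys = n" "degrees ys es" "sum_list es = e"
    have "cls (word (map2 (*) xs ys)) \<in> tpower_gr n (d + e)"
      using 1 2 by (intro word_tpower_gr[of _ _ "map2 (+) ds es"] degrees_map2) (auto simp: sum_list_map2_add degrees_length)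
    then show "cls (word xs) \<cdot> cls (word ys) \<in> tpower_gr n (d + e)"
      using 1 2 by (simp add: tmult_words tscale_tpower_gr)
  qed (intro tlin_intros)
qed (intro tlin_intros)

lemma tscale_tpower:
  assumes "X \<in> tpower n"
  shows "tscale c X \<in> tpower n"
proof -
  obtain p where "X = cls p" using tpower_range[OF assms] by blast
  then show ?thesis
    using formal.subspace_scale[OF subspace_tpower, of p n c] assms by (simp add: tscale_cls)
qed

lemma tmult_tpower:
  assumes "X \<in> tpower n" "Y \<in> tpower n"
  shows "X \<cdot> Y \<in> tpower n"
  using assms(1)
proof (rule tlin_tpower[rotated])
  fix xs ds assume 1: "length xs = n" "degrees xs ds"
  show "cls (word xs) \<cdot> Y \<in> tpower n"
    using assms(2) by (rule tlin_tpower[rotated])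
      (use 1 in \<open>auto simp: tmult_words intro!: tlin_intros tscale_tpower word_tpower\<close>)
qed (intro tlin_intros)

text \<open>The graded interchange law. Only the two inner tensors have to be homogeneous, since they are
  the ones that change places. If one of them is even, the other one can be arbitrary, which is
  the content of the two lemmas that follow.\<close>

lemma otimes_tmult:
  assumes "X \<in> tpower m" "Y \<in> tpower_gr n d" "X' \<in> tpower_gr m e" "Y' \<in> tpower n"
  shows "(X \<otimes> Y) \<cdot> (X' \<otimes> Y') = tscale (ksign d e) ((X \<cdot> X') \<otimes> (Y \<cdot> Y'))"
  using assms(1)
proof (rule tpower_ext; (intro tlin_intros)?)
  fix xs as assume X: "length xs = m" "degrees xs as"
  show "(cls (word xs) \<otimes> Y) \<cdot> (X' \<otimes> Y') = tscale (ksign d e) ((cls (word xs) \<cdot> X') \<otimes> (Y \<cdot> Y'))"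
    using assms(2)
  proof (rule tpower_gr_ext; (intro tlin_intros)?)
    fix ys bs assume Y: "length ys = n" "degrees ys bs" "sum_list bs = d"
    show "(cls (word xs) \<otimes> cls (word ys)) \<cdot> (X' \<otimes> Y') =
        tscale (ksign d e) ((cls (word xs) \<cdot> X') \<otimes> (cls (word ys) \<cdot> Y'))"
      using assms(3)
    proof (rule tpower_gr_ext; (intro tlin_intros)?)
      fix xs' as' assume X': "length xs' = m" "degrees xs' as'" "sum_list as' = e"
      show "(cls (word xs) \<otimes> cls (word ys)) \<cdot> (cls (word xs') \<otimes> Y') =
          tscale (ksign d e) ((cls (word xs) \<cdot> cls (word xs')) \<otimes> (cls (word ys) \<cdot> Y'))"
        using assms(4)
      proof (rule tpower_ext; (intro tlin_intros)?)
        fix ys' bs' assume Y': "length ys' = n" "degrees ys' bs'"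
        have "koszul (as @ bs) (as' @ bs') = koszul as as' * koszul bs bs' * (ksign d e :: 'k)"
          using X X' Y Y' by (simp add: koszul_append degrees_length)
        moreover have "cls (word (xs @ ys)) \<cdot> cls (word (xs' @ ys')) =
            tscale (koszul (as @ bs) (as' @ bs')) (cls (word (map2 (*) (xs @ ys) (xs' @ ys'))))"
          using X X' Y Y' by (intro tmult_words degrees_append) simp_all
        ultimately show "(cls (word xs) \<otimes> cls (word ys)) \<cdot> (cls (word xs') \<otimes> cls (word ys')) =
          tscale (ksign d e) ((cls (word xs) \<cdot> cls (word xs')) \<otimes> (cls (word ys) \<cdot> cls (word ys')))"
          using X X' Y Y' 
          by (simp add: otimes_word tmult_words mult_ac)
      qed
    qed
  qed
qed

lemma otimes_tmult_even1:
  assumes "X \<in> tpower m" "Y \<in> tpower_gr n 0" "X' \<in> tpower m" "Y' \<in> tpower n"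
  shows "(X \<otimes> Y) \<cdot> (X' \<otimes> Y') = (X \<cdot> X') \<otimes> (Y \<cdot> Y')"
  using assms(3)
proof (rule tpower_ext; (intro tlin_intros)?)
  fix xs ds assume "length xs = m" "degrees xs ds"
  then show "(X \<otimes> Y) \<cdot> (cls (word xs) \<otimes> Y') = (X \<cdot> cls (word xs)) \<otimes> (Y \<cdot> Y')"
    using otimes_tmult[OF assms(1,2) word_tpower_gr assms(4)] by (simp add: tscale_1)
qed

lemma otimes_tmult_even2:
  assumes "X \<in> tpower m" "Y \<in> tpower n" "X' \<in> tpower_gr m 0" "Y' \<in> tpower n"
  shows "(X \<otimes> Y) \<cdot> (X' \<otimes> Y') = (X \<cdot> X') \<otimes> (Y \<cdot> Y')"
  using assms(2)
proof (rule tpower_ext; (intro tlin_intros)?)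
  fix ys ds assume "length ys = n" "degrees ys ds"
  then show "(X \<otimes> cls (word ys)) \<cdot> (X' \<otimes> Y') = (X \<cdot> X') \<otimes> (cls (word ys) \<cdot> Y')"
    using otimes_tmult[OF assms(1) word_tpower_gr assms(3,4)] by (simp add: tscale_1)
qed

lemma otimes_tpower_eq: "X \<in> tpower m \<Longrightarrow> Y \<in> tpower n \<Longrightarrow> m + n = k \<Longrightarrow> X \<otimes> Y \<in> tpower k"
  using otimes_tpower by blast

lemma tmult_even: "X \<in> tpower_gr n 0 \<Longrightarrow> Y \<in> tpower_gr n 0 \<Longrightarrow> X \<cdot> Y \<in> tpower_gr n 0"
  using tmult_gr[of X n 0 Y 0] by simp

lemma tpower_otimes_ext:
  assumes "X \<in> tpower (m + n)" "tlin g" "tlin h"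
    and "\<And>U V d e. U \<in> tpower_gr m d \<Longrightarrow> V \<in> tpower_gr n e \<Longrightarrow> g (U \<otimes> V) = h (U \<otimes> V)"
  shows "g X = h X"
  using assms(1-3)
proof (rule tpower_ext)
  fix xs ds assume *: "length xs = m + n" "degrees xs ds"
  have "cls (word (take m xs)) \<in> tpower_gr m (sum_list (take m ds))"
    "cls (word (drop m xs)) \<in> tpower_gr n (sum_list (drop m ds))"
    using * by (auto intro!: word_tpower_gr list_all2_takeI list_all2_dropI)
  from assms(4)[OF this] show "g (cls (word xs)) = h (cls (word xs))"
    by (simp add: otimes_word)
qed

lemma tpower_otimes3_ext:
  assumes "X \<in> tpower (k + (m + n))" "tlin g" "tlin h"
    and "\<And>U V W d e f. U \<in> tpower_gr k d \<Longrightarrow> V \<in> tpower_gr m e \<Longrightarrow> W \<in> tpower_gr n f \<Longrightarrow>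
           g (U \<otimes> (V \<otimes> W)) = h (U \<otimes> (V \<otimes> W))"
  shows "g X = h X"
  using assms(1-3)
proof (rule tpower_otimes_ext)
  fix U V' d e assume *: "U \<in> tpower_gr k d" "V' \<in> tpower_gr (m + n) e"
  show "g (U \<otimes> V') = h (U \<otimes> V')"
    using tpower_gr_subset[OF *(2)] tlin_comp[OF assms(2) tlin_otimes_right]
      tlin_comp[OF assms(3) tlin_otimes_right]
  proof (rule tpower_otimes_ext)
    fix V W e f assume "V \<in> tpower_gr m e" "W \<in> tpower_gr n f"
    with *(1) show "g (U \<otimes> (V \<otimes> W)) = h (U \<otimes> (V \<otimes> W))" by (rule assms(4))
  qed
qed

section \<open>Inverses\<close>

lemma is_tinv_unique: "is_tinv n X Y \<Longrightarrow> is_tinv n X Z \<Longrightarrow> Y = Z"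
  unfolding is_tinv_def by (metis tmult_assoc tone_mult)

lemma tinv_eqI: "is_tinv n X Y \<Longrightarrow> tinv n X = Y"
  unfolding tinv_def by (rule the_equality) (assumption, erule (1) is_tinv_unique)

lemma is_tinv_tinv: "tensor_invertible n X \<Longrightarrow> is_tinv n X (tinv n X)"
  unfolding tensor_invertible_def using tinv_eqI by metis

lemma is_tinv_sym: "is_tinv n X Y \<Longrightarrow> is_tinv n Y X"
  by (auto simp: is_tinv_def)

lemma is_tinv_tmult:
  assumes "is_tinv n X X'" "is_tinv n Y Y'"
  shows "is_tinv n (X \<cdot> Y) (Y' \<cdot> X')"
proof -
  have *: "A \<cdot> B \<cdot> (B' \<cdot> A') = tone n"
    if "A \<in> tpower n" "A' \<in> tpower n" "A \<cdot> A' = tone n" "B \<cdot> B' = tone n" for A A' B B'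
  proof -
    have "A \<cdot> B \<cdot> (B' \<cdot> A') = A \<cdot> ((B \<cdot> B') \<cdot> A')" by (simp only: tmult_assoc)
    then show ?thesis using that by simp
  qed
  show ?thesis
    using assms *[of X X' Y Y'] *[of Y' Y X' X] by (auto simp: is_tinv_def intro: tmult_tpower)
qed

lemma is_tinv_cancel:
  assumes "is_tinv n X Y" "Z \<in> tpower n"
  shows "X \<cdot> (Y \<cdot> Z) = Z" "Y \<cdot> (X \<cdot> Z) = Z"
  using assms by (simp_all add: is_tinv_def flip: tmult_assoc)

lemma is_tinv_tpower: "is_tinv n X Y \<Longrightarrow> X \<in> tpower n" "is_tinv n X Y \<Longrightarrow> Y \<in> tpower n"
  by (simp_all add: is_tinv_def)

section \<open>The even part of a tensor\<close>

text \<open>The component of degree \<open>d\<close>: the sum over all distributions of degrees to the letters with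
  total \<open>d\<close>. Unlike \<open>(1 \<plusminus> \<gamma>) / 2\<close> with the parity automorphism \<open>\<gamma>\<close>, it makes sense in
  characteristic 2 as well.\<close>

definition tproj :: "nat \<Rightarrow> bit \<Rightarrow> ('k, 'a) formal set \<Rightarrow> ('k, 'a) formal set" where
  "tproj n d X = cls (lin (\<lambda>xs. \<Sum>ds | length ds = n \<and> sum_list ds = d.
     if length xs = n then word (map2 part ds xs) else 0) (rep X))"

lemma finite_bit_lists: "finite {ds :: bit list. length ds = n \<and> P ds}"
proof -
  have "(UNIV :: bit set) \<subseteq> {0, 1}" by (auto intro: bit.exhaust)
  then have "finite (UNIV :: bit set)" by (rule finite_subset) simp
  from finite_lists_length_eq[OF this, of n] show ?thesis by (rule finite_subset[rotated]) auto
qed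

lemma tproj_cls: "tproj n d (cls p) = cls (lin (\<lambda>xs. \<Sum>ds | length ds = n \<and> sum_list ds = d.
     if length xs = n then word (map2 part ds xs) else 0) p)"
  unfolding tproj_def
proof (rule cls_lin_rep)
  fix r assume r: "r \<in> relators"
  have *: "lin (\<lambda>xs. if length xs = n then word (map2 part ds xs) else 0) r \<in> formal.span relators"
    if "length ds = n" for ds
  proof -
    have "lin (\<lambda>xs. if length xs = length (map part ds)
        then word (map2 (\<lambda>h x. h x) (map part ds) xs) else 0) r \<in> formal.span relators"
      by (rule letterwise_relators[OF _ r]) (auto simp: part_add part_scale)
    then show ?thesis using that by (simp add: zip_map1 case_prod_unfold comp_def cong: if_cong)
  qed
  show "lin (\<lambda>xs. \<Sum>ds | length ds = n \<and> sum_list ds = d.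
     if length xs = n then word (map2 part ds xs) else 0) r \<in> formal.span relators"
    unfolding lin_fun_sum by (intro formal.span_sum *) simp
qed

lemma tlin_tproj: "tlin (tproj n d)"
  by (rule tlinI, rule tproj_cls)

lemma tproj_word:
  assumes "degrees xs es" "length xs = n"
  shows "tproj n d (cls (word xs)) = (if sum_list es = d then cls (word xs) else cls 0)"
proof -
  let ?I = "{ds. length ds = n \<and> sum_list ds = d}"
  have len: "length es = n" using assms by (simp add: degrees_length)
  have p: "map2 part es xs = xs"
    using assms len by (auto intro!: nth_equalityI simp: list_all2_conv_all_nth part_homogeneous)
  have z: "word (map2 part ds xs) \<in> formal.span relators" if "length ds = n" "ds \<noteq> es" for ds
  proof -
    have "\<not> (\<forall>i<n. ds ! i = es ! i)"
      using that len nth_equalityI[of ds es] by auto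
    then obtain i where i: "i < n" "ds ! i \<noteq> es ! i" by blast
    have "xs ! i \<in> gr (es ! i)"
      using assms i by (simp add: list_all2_conv_all_nth)
    then have "map2 part ds xs ! i = 0" using i that assms by (simp add: part_homogeneous del: bit_not_zero_iff bit_not_one_iff)
    then have "0 \<in> set (map2 part ds xs)"
      using i(1) that(1) assms(2) by (metis (no_types, lifting) length_map length_zip min.idem nth_mem)
    then show ?thesis by (rule word_0)
  qed
  have "tproj n d (cls (word xs)) = cls (\<Sum>ds\<in>?I. word (map2 part ds xs))"
    using assms by (simp add: tproj_cls)
  also have "\<dots> = cls (\<Sum>ds\<in>?I. if ds = es then word xs else 0)"
    by (rule cls_sum_cong[OF finite_bit_lists]) (use z p in \<open>auto simp: formal.span_zero\<close>)
  also have "\<dots> = (if sum_list es = d then cls (word xs) else cls 0)"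
    using len by (simp add: sum.delta[OF finite_bit_lists])
  finally show ?thesis .
qed

lemma tproj_homogeneous:
  assumes "X \<in> tpower_gr n d"
  shows "tproj n d X = X" "e \<noteq> d \<Longrightarrow> tproj n e X = cls 0"
proof -
  show "tproj n d X = X"
    using assms tlin_tproj tlin_id by (rule tpower_gr_ext) (simp add: tproj_word)
  have "tlin (\<lambda>X. cls 0)" by (rule tlinI[of _ "\<lambda>xs. 0"]) simp
  with assms tlin_tproj show "tproj n e X = cls 0" if "e \<noteq> d"
    by (rule tpower_gr_ext) (use that in \<open>auto simp: tproj_word simp del: bit_not_zero_iff bit_not_one_iff\<close>)
qed

lemma cls_0_gr: "cls 0 \<in> tpower_gr n d"
  using formal.subspace_0[OF subspace_tpower_gr] by simp

lemma tproj_gr: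
  assumes "X \<in> tpower n"
  shows "tproj n d X \<in> tpower_gr n d"
  using assms subspace_tlin_vimage[OF tlin_tproj subspace_tpower_gr]
proof (rule tpower_induct)
  fix xs ds assume "length xs = n" "degrees xs ds"
  then show "tproj n d (cls (word xs)) \<in> tpower_gr n d"
    using word_tpower_gr[of xs n ds d] by (simp add: tproj_word cls_0_gr)
qed

lemma tproj_tmult_even:
  assumes "F \<in> tpower_gr n 0" "X \<in> tpower n"
  shows "tproj n 0 (F \<cdot> X) = F \<cdot> tproj n 0 X"
  using assms(2) tlin_comp[OF tlin_tproj tlin_tmult_right] tlin_comp[OF tlin_tmult_right tlin_tproj]
proof (rule tpower_ext)
  fix xs ds assume xs: "length xs = n" "degrees xs ds"
  then have "F \<cdot> cls (word xs) \<in> tpower_gr n (sum_list ds)"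
    using tmult_gr[OF assms(1) word_tpower_gr] by simp
  from tproj_homogeneous[OF this] tproj_homogeneous[OF word_tpower_gr[OF xs refl]]
  show "tproj n 0 (F \<cdot> cls (word xs)) = F \<cdot> tproj n 0 (cls (word xs))"
    by (cases "sum_list ds = 0") (auto simp del: bit_not_zero_iff bit_not_one_iff)
qed

text \<open>The even part of an inverse \<open>G\<close> of \<open>F\<close> satisfies \<open>F G\<^sub>0 = (F G)\<^sub>0 = 1\<close>, so it is an inverse too
  and equals \<open>G\<close>.\<close>

lemma is_tinv_even:
  assumes "is_tinv n F G" "F \<in> tpower_gr n 0"
  shows "G \<in> tpower_gr n 0"
proof -
  have G: "G \<in> tpower n" "F \<cdot> G = tone n" "G \<cdot> F = tone n"
    using assms(1) by (simp_all add: is_tinv_def)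
  have p: "tproj n 0 G \<in> tpower n"
    using tproj_gr[OF G(1)] tpower_gr_subset by blast
  have "tproj n 0 G = (G \<cdot> F) \<cdot> tproj n 0 G"
    using G p by simp
  also have "\<dots> = G \<cdot> tproj n 0 (F \<cdot> G)"
    by (simp only: tmult_assoc tproj_tmult_even[OF assms(2) G(1)])
  also have "\<dots> = G"
    using G tproj_homogeneous(1)[OF tone_gr] by simp
  finally show ?thesis using tproj_gr[OF G(1), of 0] by simp
qed

section \<open>Graded homomorphisms of tensor powers\<close>

text \<open>The maps between tensor powers that occur in the axioms are all of this kind; the notion
  bundles what is needed to push them through products, inverses and degree arguments.\<close>

definition tensor_hom :: "nat \<Rightarrow> nat \<Rightarrow> (('k, 'a) formal set \<Rightarrow> ('k, 'a) formal set) \<Rightarrow> bool" where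
  "tensor_hom n m g \<longleftrightarrow> tlin g \<and> (\<forall>d. \<forall>X\<in>tpower_gr n d. g X \<in> tpower_gr m d) \<and>
     (\<forall>X\<in>tpower n. \<forall>Y\<in>tpower n. g (X \<cdot> Y) = g X \<cdot> g Y) \<and> g (tone n) = tone m"

lemma tensor_homD:
  assumes "tensor_hom n m g"
  shows "tlin g" "X \<in> tpower_gr n d \<Longrightarrow> g X \<in> tpower_gr m d"
    "X \<in> tpower n \<Longrightarrow> Y \<in> tpower n \<Longrightarrow> g (X \<cdot> Y) = g X \<cdot> g Y" "g (tone n) = tone m"
    "X \<in> tpower n \<Longrightarrow> g X \<in> tpower m"
proof -
  show "tlin g" "X \<in> tpower_gr n d \<Longrightarrow> g X \<in> tpower_gr m d"
    "X \<in> tpower n \<Longrightarrow> Y \<in> tpower n \<Longrightarrow> g (X \<cdot> Y) = g X \<cdot> g Y" "g (tone n) = tone m"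
    using assms by (auto simp: tensor_hom_def)
  show "X \<in> tpower n \<Longrightarrow> g X \<in> tpower m"
    by (rule tlin_tpower[of g X n])
       (use assms in \<open>auto simp: tensor_hom_def intro!: tpower_gr_subset[of _ m] word_tpower_gr\<close>)
qed

lemma tensor_homI:
  assumes "tlin g"
    and "\<And>xs ds. length xs = n \<Longrightarrow> degrees xs ds \<Longrightarrow> g (cls (word xs)) \<in> tpower_gr m (sum_list ds)"
    and "\<And>xs ds ys es. length xs = n \<Longrightarrow> degrees xs ds \<Longrightarrow> length ys = n \<Longrightarrow> degrees ys es \<Longrightarrow>
           g (cls (word xs) \<cdot> cls (word ys)) = g (cls (word xs)) \<cdot> g (cls (word ys))"
    and "g (tone n) = tone m"
  shows "tensor_hom n m g"
  unfolding tensor_hom_def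
proof (intro conjI allI ballI assms(1,4))
  fix X d assume "X \<in> tpower_gr n d"
  with assms(1) show "g X \<in> tpower_gr m d"
    by (rule tlin_tpower_gr) (use assms(2) in blast)
next
  fix X Y assume X: "X \<in> tpower n" and Y: "Y \<in> tpower n"
  note tlin_g = tlin_comp[OF assms(1)]
  show "g (X \<cdot> Y) = g X \<cdot> g Y"
    using X
  proof (rule tpower_ext; (intro tlin_intros tlin_g)?)
    fix xs ds assume xs: "length xs = n" "degrees xs ds"
    show "g (cls (word xs) \<cdot> Y) = g (cls (word xs)) \<cdot> g Y"
      using Y by (rule tpower_ext[of _ _ "\<lambda>Y. g (_ \<cdot> Y)"]; (intro tlin_intros tlin_g)?)
        (rule assms(3)[OF xs])
  qed
qed

lemma tensor_hom_comp:
  assumes "tensor_hom m k g" "tensor_hom n m h"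
  shows "tensor_hom n k (\<lambda>X. g (h X))"
  unfolding tensor_hom_def
  by (intro conjI allI ballI tlin_comp[OF assms[THEN tensor_homD(1)]])
    (simp_all add: tensor_homD(2-5)[OF assms(1)] tensor_homD(2-5)[OF assms(2)])

lemma tensor_hom_is_tinv:
  assumes "tensor_hom n m g" "is_tinv n X Y"
  shows "is_tinv m (g X) (g Y)"
  using assms(2) tensor_homD(3)[OF assms(1), of X Y, symmetric] tensor_homD(3)[OF assms(1), of Y X, symmetric]
  by (simp add: is_tinv_def tensor_homD(4,5)[OF assms(1)])

lemma tensor_hom_otimes_tone_right:
  assumes "n + k = m"
  shows "tensor_hom n m (\<lambda>X. X \<otimes> tone k)"
  unfolding tensor_hom_def
proof (intro conjI allI ballI tlin_intros)
  note t = tone_gr[of k] tpower_gr_subset[OF tone_gr[of k]]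
  show "X \<otimes> tone k \<in> tpower_gr m d" if "X \<in> tpower_gr n d" for X d
    using otimes_gr[OF that t(1)] assms by simp
  show "(X \<cdot> Y) \<otimes> tone k = (X \<otimes> tone k) \<cdot> (Y \<otimes> tone k)" if "X \<in> tpower n" "Y \<in> tpower n" for X Y
    using otimes_tmult_even1[OF that(1) t(1) that(2) t(2)] t by simp
qed (use assms in simp)

lemma tensor_hom_otimes_tone_left:
  assumes "k + n = m"
  shows "tensor_hom n m (\<lambda>X. tone k \<otimes> X)"
  unfolding tensor_hom_def
proof (intro conjI allI ballI tlin_intros)
  note t = tone_gr[of k] tpower_gr_subset[OF tone_gr[of k]]
  show "tone k \<otimes> X \<in> tpower_gr m d" if "X \<in> tpower_gr n d" for X d
    using otimes_gr[OF t(1) that] assms by simp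
  show "tone k \<otimes> (X \<cdot> Y) = (tone k \<otimes> X) \<cdot> (tone k \<otimes> Y)" if "X \<in> tpower n" "Y \<in> tpower n" for X Y
    using otimes_tmult_even2[OF t(2) that(1) t(1) that(2)] t by simp
qed (use assms in simp)

text \<open>If \<open>X\<close> is odd, so is its image \<open>tone m\<close>, which is also even and therefore zero. Then
  \<open>tone n\<close> is zero, and every tensor with \<open>n\<close> factors, in particular \<open>X\<close>, is zero and hence even.\<close>

lemma homogeneous_even:
  assumes "tensor_hom n m g" "X \<in> tpower_gr n d" "g X = tone m" "m \<le> n"
  shows "X \<in> tpower_gr n 0"
proof (cases "d = 0")
  case False
  then have "tone m \<in> tpower_gr m 1"
    using tensor_homD(2)[OF assms(1,2)] assms(3) by simp
  then have "tone m = cls 0"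
    using tproj_homogeneous(2)[of "tone m" m 1 0] tproj_homogeneous(1)[OF tone_gr[of m]] by simp
  moreover have "tone n = tone m \<otimes> tone (n - m)"
    using assms(4) by simp
  ultimately have "tone n = cls 0"
    using tlin_0[OF tlin_otimes_left[of "tone (n - m)"]] by simp
  then have "X = cls 0"
    using tone_mult(1)[OF tpower_gr_subset[OF assms(2)]] by simp
  then show ?thesis by (simp add: cls_0_gr)
qed (use assms(2) in simp)

section \<open>Tensor products of homomorphisms\<close>

text \<open>The maps allowed as entries of \<open>tmap\<close>: the counit (\<open>k = 0\<close>), the identity (\<open>k = 1\<close>), and
  comultiplications (\<open>k = 2\<close>).\<close>

definition letter_hom :: "nat \<Rightarrow> ('a \<Rightarrow> ('k, 'a) formal set) \<Rightarrow> bool" where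
  "letter_hom k f \<longleftrightarrow> (\<forall>x y. f (x + y) = tadd (f x) (f y)) \<and> (\<forall>c x. f (c *s x) = tscale c (f x)) \<and>
     (\<forall>d. \<forall>x\<in>gr d. f x \<in> tpower_gr k d) \<and> (\<forall>x y. f (x * y) = f x \<cdot> f y) \<and> f 1 = tone k"

lemma tadd_tpower:
  assumes "X \<in> tpower n" "Y \<in> tpower n"
  shows "tadd X Y \<in> tpower n"
proof -
  obtain p q where "X = cls p" "Y = cls q" using assms tpower_range by blast
  then show ?thesis
    using formal.subspace_add[OF subspace_tpower, of p n q] assms by (simp add: tadd_cls)
qed

lemma letter_hom_tpower: "letter_hom k f \<Longrightarrow> f x \<in> tpower k"
  unfolding letter_hom_def by (metis part_sum part_in tadd_tpower tpower_gr_subset)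

lemma emb_add: "emb (x + y) = tadd (emb x) (emb y)"
  using word_add_span[of "[]" x y "[]"] by (simp add: emb_def tadd_cls cls_eq_iff algebra_simps)

lemma emb_scale: "emb (c *s x) = tscale c (emb x)"
  using word_scale_span[of "[]" c x "[]"] by (simp add: emb_def tscale_cls cls_eq_iff)

lemma koszul_1 [simp]: "koszul [d] [e] = 1"
  by (simp add: koszul_def)

lemma emb_mult: "emb (x * y) = emb x \<cdot> emb y"
proof -
  have h: "emb (x * y) = emb x \<cdot> emb y" if "x \<in> gr d" "y \<in> gr e" for x y d e
    using tmult_words[of "[x]" "[d]" "[y]" "[e]"] that by (simp add: emb_def tscale_1)
  have e: "emb z = tadd (emb (part 0 z)) (emb (part 1 z))" for z
    by (simp add: part_sum flip: emb_add)
  have r: "emb z \<in> range cls" for z by (simp add: emb_def)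
  have *: "emb (x * part d y) = emb x \<cdot> emb (part d y)" for d
  proof -
    have "emb (x * part d y) = tadd (emb (part 0 x * part d y)) (emb (part 1 x * part d y))"
      by (simp flip: emb_add distrib_right add: part_sum)
    also have "\<dots> = tadd (emb (part 0 x)) (emb (part 1 x)) \<cdot> emb (part d y)"
      by (simp add: h[OF part_in part_in] tlin_tadd[OF tlin_tmult_left r r])
    finally show ?thesis using e[of x] by simp
  qed
  have "emb (x * y) = tadd (emb (x * part 0 y)) (emb (x * part 1 y))"
    by (simp flip: emb_add distrib_left add: part_sum)
  also have "\<dots> = emb x \<cdot> emb y"
    unfolding * e[of y] by (simp add: tlin_tadd[OF tlin_tmult_right r r])
  finally show ?thesis .
qed

lemma letter_hom_emb: "letter_hom 1 emb"
  using emb_gr by (auto simp: letter_hom_def emb_add emb_scale emb_mult tone_1)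

lemma cls_word_Cons: "cls (word (x # xs)) = emb x \<otimes> cls (word xs)"
  by (simp add: emb_def otimes_word)

lemma letter_homs_linear:
  assumes "list_all2 letter_hom ks fs" "f \<in> set fs"
  shows "f (x + y) = tadd (f x) (f y) \<and> f (c *s x) = tscale c (f x)" "f x \<in> range cls"
proof -
  obtain k where "letter_hom k f"
    using assms by (auto simp: list_all2_conv_all_nth in_set_conv_nth)
  then show "f (x + y) = tadd (f x) (f y) \<and> f (c *s x) = tscale c (f x)" "f x \<in> range cls"
    using tpower_range[OF letter_hom_tpower[of k f x]] by (simp_all add: letter_hom_def)
qed

lemma tlin_tmap: "list_all2 letter_hom ks fs \<Longrightarrow> tlin (tmap fs)"
  by (rule tlinI, rule tmap_cls, rule letter_homs_linear)

lemma tmap_words: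
  assumes "list_all2 letter_hom ks fs" "length xs = length fs"
  shows "tmap fs (cls (word xs)) = foldr (\<otimes>) (map2 (\<lambda>f x. f x) fs xs) (cls (word []))"
  using letter_homs_linear[OF assms(1)] by (rule tmap_word) (use assms in auto)

lemma foldr_otimes_append:
  "foldr (\<otimes>) (Xs @ Ys) (cls (word [])) =
     foldr (\<otimes>) Xs (cls (word [])) \<otimes> foldr (\<otimes>) Ys (cls (word []))"
proof (induction Xs)
  case Nil
  have "foldr (\<otimes>) Ys (cls (word [])) \<in> range cls" by (cases Ys) simp_all
  then show ?case by simp
qed (simp add: otimes_assoc)

lemma tmap_append:
  assumes fs: "list_all2 letter_hom ks fs" and gs: "list_all2 letter_hom ls gs"
    and X: "X \<in> tpower (length fs)" and Y: "Y \<in> tpower (length gs)"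
  shows "tmap (fs @ gs) (X \<otimes> Y) = tmap fs X \<otimes> tmap gs Y"
proof -
  have fgs: "list_all2 letter_hom (ks @ ls) (fs @ gs)"
    using fs gs by (rule list_all2_appendI)
  note tlins = tlin_intros tlin_comp[OF tlin_tmap[OF fgs]] tlin_comp[OF tlin_tmap[OF fs]]
    tlin_comp[OF tlin_tmap[OF gs]]
  show ?thesis using X
  proof (rule tpower_ext; (intro tlins)?)
    fix xs ds assume xs: "length xs = length fs" "degrees xs ds"
    show "tmap (fs @ gs) (cls (word xs) \<otimes> Y) = tmap fs (cls (word xs)) \<otimes> tmap gs Y"
      using Y
    proof (rule tpower_ext; (intro tlins)?)
      fix ys es assume ys: "length ys = length gs" "degrees ys es"
      show "tmap (fs @ gs) (cls (word xs) \<otimes> cls (word ys)) =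
          tmap fs (cls (word xs)) \<otimes> tmap gs (cls (word ys))"
        using xs ys by (simp add: otimes_word tmap_words[OF fs] tmap_words[OF gs] tmap_words[OF fgs]
            foldr_otimes_append del: foldr_append)
    qed
  qed
qed

lemma tmap_single: "letter_hom k f \<Longrightarrow> tmap [f] (emb x) = f x"
  using tmap_words[of "[k]" "[f]" "[x]"] tpower_range[OF letter_hom_tpower[of k f x]] by (simp add: emb_def)

lemma tmap_Nil: "tmap [] (cls (word [])) = cls (word [])"
  using tmap_words[of "[]" "[]" "[]"] by simp

lemma tmap_Cons:
  assumes "letter_hom k f" "list_all2 letter_hom ks fs" "X \<in> tpower (length fs)"
  shows "tmap (f # fs) (emb x \<otimes> X) = f x \<otimes> tmap fs X"
  using tmap_append[of "[k]" "[f]" ks fs "emb x" X] assms emb_tpower[of x] by (simp add: tmap_single)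

lemma tmap_word_gr:
  assumes "list_all2 letter_hom ks fs" "degrees xs ds" "length xs = length fs"
  shows "tmap fs (cls (word xs)) \<in> tpower_gr (sum_list ks) (sum_list ds)"
  using assms
proof (induction ks fs arbitrary: xs ds rule: list_all2_induct)
  case Nil
  then show ?case using word_tpower_gr[of "[]" 0 "[]"] by (simp add: tmap_Nil)
next
  case (Cons k ks f fs)
  obtain x xs' d ds' where x: "xs = x # xs'" "ds = d # ds'" "x \<in> gr d" "degrees xs' ds'"
    using Cons.prems by (cases xs; cases ds) auto
  have "f x \<otimes> tmap fs (cls (word xs')) \<in> tpower_gr (k + sum_list ks) (d + sum_list ds')"
    using Cons x by (intro otimes_gr) (auto simp: letter_hom_def)
  then show ?case
    using Cons x by (simp add: cls_word_Cons tmap_Cons word_tpower)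
qed

text \<open>Split off the first factor: the sign of the interchange law is the same before and after
  applying the maps because they preserve degrees.\<close>

lemma tmap_word_tmult:
  assumes "list_all2 letter_hom ks fs" "degrees xs ds" "length xs = length fs"
    "degrees ys es" "length ys = length fs"
  shows "tmap fs (cls (word xs) \<cdot> cls (word ys)) = tmap fs (cls (word xs)) \<cdot> tmap fs (cls (word ys))"
  using assms
proof (induction ks fs arbitrary: xs ds ys es rule: list_all2_induct)
  case Nil
  have "cls (word []) \<cdot> cls (word []) = cls (word [])"
    using tone_mult(1)[OF word_tpower[of "[]" 0]] by (simp add: tone_0)
  then show ?case using Nil by (simp add: tmap_Nil)
next
  case (Cons k ks f fs)
  obtain x xs' d ds' where x: "xs = x # xs'" "ds = d # ds'" "x \<in> gr d" "degrees xs' ds'"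
    using Cons.prems by (cases xs; cases ds) auto
  obtain y ys' e es' where y: "ys = y # ys'" "es = e # es'" "y \<in> gr e" "degrees ys' es'"
    using Cons.prems by (cases ys; cases es) auto
  let ?n = "length fs"
  have len: "length xs' = ?n" "length ys' = ?n" using x y Cons.prems by simp_all
  have Xs: "cls (word xs') \<in> tpower_gr ?n (sum_list ds')" "cls (word ys') \<in> tpower_gr ?n (sum_list es')"
    using x y len by (auto intro: word_tpower_gr)
  have lin: "tlin (tmap (f # fs))" using Cons.hyps by (intro tlin_tmap[of "k # ks"]) simp
  have prod: "cls (word xs') \<cdot> cls (word ys') \<in> tpower ?n"
    using tmult_tpower Xs tpower_gr_subset by blast
  have fs: "tmap fs (cls (word xs')) \<in> tpower_gr (sum_list ks) (sum_list ds')"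
    "tmap fs (cls (word ys')) \<in> tpower (sum_list ks)"
    using tmap_word_gr[OF Cons.hyps(2)] x y len tpower_gr_subset by blast+
  have f: "f x \<in> tpower k" "f y \<in> tpower_gr k e"
    using Cons.hyps(1) letter_hom_tpower y by (auto simp: letter_hom_def)
  have "tmap (f # fs) (cls (word xs) \<cdot> cls (word ys)) =
      tmap (f # fs) (tscale (ksign (sum_list ds') e) (emb (x * y) \<otimes> (cls (word xs') \<cdot> cls (word ys'))))"
    unfolding x y cls_word_Cons emb_mult
    using otimes_tmult[OF emb_tpower Xs(1) emb_gr[OF y(3)] tpower_gr_subset[OF Xs(2)]] by simp
  also have "\<dots> = tscale (ksign (sum_list ds') e) (f (x * y) \<otimes> tmap fs (cls (word xs') \<cdot> cls (word ys')))"
    using tmap_Cons[OF Cons.hyps prod] by (simp add: tlin_tscale[OF lin])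
  also have "\<dots> = (f x \<otimes> tmap fs (cls (word xs'))) \<cdot> (f y \<otimes> tmap fs (cls (word ys')))"
    using Cons.IH[OF x(4) len(1) y(4) len(2)] Cons.hyps(1) otimes_tmult[OF f(1) fs(1) f(2) fs(2)]
    by (simp add: letter_hom_def)
  finally show ?case
    using tmap_Cons[OF Cons.hyps] Xs tpower_gr_subset by (auto simp: x y cls_word_Cons)
qed

lemma tensor_hom_tmap:
  assumes "list_all2 letter_hom ks fs" "length fs = n" "sum_list ks = m"
  shows "tensor_hom n m (tmap fs)"
proof (rule tensor_homI)
  show "tmap fs (tone n) = tone m"
    using assms
  proof (induction ks fs arbitrary: n m rule: list_all2_induct)
    case (Cons k ks f fs)
    have "emb 1 \<otimes> tone (length fs) = tone n"
      using Cons.prems otimes_tone[of 1 "length fs"] by (simp add: tone_1)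
    then show ?case
      using Cons tmap_Cons[OF Cons.hyps(1,2), of "tone (length fs)" 1] tone_gr[THEN tpower_gr_subset]
      by (auto simp: letter_hom_def)
  qed (simp add: tone_0 tmap_Nil)
qed (use assms tlin_tmap tmap_word_gr tmap_word_tmult in auto)

lemma tensor_hom_otimes_1:
  "Suc n = m \<Longrightarrow> tensor_hom n m (\<lambda>X. X \<otimes> emb 1)" "Suc n = m \<Longrightarrow> tensor_hom n m (\<lambda>X. emb 1 \<otimes> X)"
  using tensor_hom_otimes_tone_right[of n "Suc 0" m] tensor_hom_otimes_tone_left[of "Suc 0" n m]
  by (simp_all add: tone_1)

lemma otimes_emb_1: "tone n \<otimes> emb 1 = tone (Suc n)" "emb 1 \<otimes> tone n = tone (Suc n)"
  using otimes_tone[of n 1] otimes_tone[of 1 n] by (simp_all add: tone_1)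

lemma tmap_emb: 
  assumes "X \<in> tpower n"
  shows "tmap (replicate n emb) X = X"
proof -
  have homs: "list_all2 letter_hom (replicate n 1) (replicate n emb)"
    using letter_hom_emb by (simp add: list_all2_conv_all_nth)
  have "foldr (\<otimes>) (map2 (\<lambda>f x. f x) (replicate (length xs) emb) xs) (cls (word [])) = cls (word xs)" for xs
    by (induction xs) (simp_all add: cls_word_Cons)
  note fold = this
  show ?thesis
    using assms tlin_tmap[OF homs] tlin_id
  proof (rule tpower_ext)
    fix xs ds assume "length xs = n" "degrees xs ds"
    then show "tmap (replicate n emb) (cls (word xs)) = cls (word xs)"
      using fold[of xs] by (simp add: tmap_words[OF homs])
  qed
qed

lemmas tmap_emb2 = tmap_emb[where n = 2, simplified numeral_2_eq_2 replicate.simps, folded numeral_2_eq_2]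

lemma tmap_emb1: "tmap [emb] (emb x) = emb x"
  by (rule tmap_single[OF letter_hom_emb])

section \<open>The graded twist\<close>

lemma gtwist_word2:
  "x \<in> gr d \<Longrightarrow> y \<in> gr e \<Longrightarrow> gtwist 0 (cls (word [x, y])) = tscale (ksign d e) (cls (word [y, x]))"
  using gtwist_homogeneous[of "[x, y]" "[d, e]" 0] by (simp add: ksign_def tscale_cls)

lemma length_2_degreesE:
  assumes "length xs = 2" "degrees xs ds"
  obtains x y d e where "xs = [x, y]" "ds = [d, e]" "x \<in> gr d" "y \<in> gr e"
  using assms by (auto simp: length_Suc_conv numeral_2_eq_2 list_all2_Cons1)

lemma length_3_degreesE:
  assumes "length xs = 3" "degrees xs ds"
  obtains x y z d e f where "xs = [x, y, z]" "ds = [d, e, f]" "x \<in> gr d" "y \<in> gr e" "z \<in> gr f"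
  using assms by (auto simp: length_Suc_conv numeral_3_eq_3 list_all2_Cons1)

lemma koszul_2: "koszul [a, b] [c, d] = (ksign b c :: 'k)"
  using koszul_snoc[of "[a]" "[c]" b d, where ?'k='k] by simp

text \<open>The sign from multiplying and then exchanging, \<open>[y][x'] + ([x] + [x'])([y] + [y'])\<close>, and the one
  from exchanging and then multiplying, \<open>[x][y] + [x'][y'] + [x][y']\<close>, differ by \<open>2 [y][x']\<close>.\<close>

lemma tensor_hom_gtwist_2: "tensor_hom 2 2 (gtwist 0)"
proof (rule tensor_homI)
  show "gtwist 0 (tone 2) = tone 2"
    using gtwist_word2[OF gr_one gr_one] by (simp add: tone_def numeral_2_eq_2 tscale_1)
next
  fix xs ds assume "length xs = 2" "degrees xs ds"
  then show "gtwist 0 (cls (word xs)) \<in> tpower_gr 2 (sum_list ds)"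
    by (elim length_2_degreesE) (auto simp: gtwist_word2 add.commute intro!: tscale_tpower_gr word_tpower_gr)
next
  fix xs ds ys es assume *: "length xs = 2" "degrees xs ds" "length ys = 2" "degrees ys es"
  show "gtwist 0 (cls (word xs) \<cdot> cls (word ys)) = gtwist 0 (cls (word xs)) \<cdot> gtwist 0 (cls (word ys))"
  proof (rule length_2_degreesE[OF *(1,2)], rule length_2_degreesE[OF *(3,4)])
    fix x y d e x' y' d' e'
    assume **: "xs = [x, y]" "ds = [d, e]" "x \<in> gr d" "y \<in> gr e"
      "ys = [x', y']" "es = [d', e']" "x' \<in> gr d'" "y' \<in> gr e'"
    have "gtwist 0 (cls (word xs) \<cdot> cls (word ys)) =
        tscale (ksign e d' * ksign (d + d') (e + e')) (cls (word [y * y', x * x']))"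
      using ** tmult_words[of "[x, y]" "[d, e]" "[x', y']" "[d', e']"]
      by (simp add: koszul_2 tlin_tscale[OF tlin_gtwist] gtwist_word2[OF gr_mult gr_mult])
    moreover have "gtwist 0 (cls (word xs)) \<cdot> gtwist 0 (cls (word ys)) =
        tscale (ksign d e * ksign d' e' * ksign d e') (cls (word [y * y', x * x']))"
      using ** tmult_words[of "[y, x]" "[e, d]" "[y', x']" "[e', d']"]
      by (simp add: koszul_2 gtwist_word2 mult_ac)
    moreover have "ksign e d' * ksign (d + d') (e + e') = (ksign d e * ksign d' e' * ksign d e' :: 'k)"
      by (simp add: ksign_add ksign_commute[of d' e] mult_ac)
    ultimately show ?thesis by simp
  qed
qed (rule tlin_gtwist)

lemma gtwist_word:
  assumes "degrees xs ds" "k + 1 < length xs"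
  shows "gtwist k (cls (word xs)) = tscale (ksign (ds ! k) (ds ! (k + 1)))
    (cls (word (xs[k := xs ! (k + 1), k + 1 := xs ! k])))"
  using gtwist_homogeneous[OF assms] by (simp add: ksign_def tscale_cls)

lemma gtwist_otimes_left:
  assumes "X \<in> tpower m" "Y \<in> tpower n" "k + 1 < n"
  shows "gtwist (m + k) (X \<otimes> Y) = X \<otimes> gtwist k Y"
  using assms(1)
proof (rule tpower_ext; (intro tlin_intros)?)
  fix xs ds assume xs: "length xs = m" "degrees xs ds"
  show "gtwist (m + k) (cls (word xs) \<otimes> Y) = cls (word xs) \<otimes> gtwist k Y"
    using assms(2)
  proof (rule tpower_ext; (intro tlin_intros)?)
    fix ys es assume ys: "length ys = n" "degrees ys es"
    have "degrees (xs @ ys) (ds @ es)" using xs ys by (intro degrees_append)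
    from gtwist_word[OF this, of "m + k"] show
      "gtwist (m + k) (cls (word xs) \<otimes> cls (word ys)) = cls (word xs) \<otimes> gtwist k (cls (word ys))"
      using xs ys assms(3)
      by (simp add: otimes_word gtwist_word nth_append list_update_append degrees_length)
  qed
qed

lemma gtwist_otimes_right:
  assumes "X \<in> tpower m" "Y \<in> tpower n" "k + 1 < m"
  shows "gtwist k (X \<otimes> Y) = gtwist k X \<otimes> Y"
  using assms(1)
proof (rule tpower_ext; (intro tlin_intros)?)
  fix xs ds assume xs: "length xs = m" "degrees xs ds"
  show "gtwist k (cls (word xs) \<otimes> Y) = gtwist k (cls (word xs)) \<otimes> Y"
    using assms(2)
  proof (rule tpower_ext; (intro tlin_intros)?)
    fix ys es assume ys: "length ys = n" "degrees ys es"
    have "degrees (xs @ ys) (ds @ es)" using xs ys by (intro degrees_append)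
    from gtwist_word[OF this, of k] show
      "gtwist k (cls (word xs) \<otimes> cls (word ys)) = gtwist k (cls (word xs)) \<otimes> cls (word ys)"
      using xs ys assms(3)
      by (simp add: otimes_word gtwist_word nth_append list_update_append degrees_length)
  qed
qed

text \<open>A twist inside a longer tensor is a twist of two factors, tensored with identity maps on
  both sides.\<close>

lemma tensor_hom_gtwist:
  assumes "k + 2 \<le> n"
  shows "tensor_hom n n (gtwist k)"
proof -
  define l where "l = n - k - 2"
  have n: "n = k + (2 + l)" using assms by (simp add: l_def)
  have G: "gtwist k (U \<otimes> (V \<otimes> W)) = U \<otimes> (gtwist 0 V \<otimes> W)"
    if "U \<in> tpower k" "V \<in> tpower 2" "W \<in> tpower l" for U V W
    using gtwist_otimes_left[OF that(1) otimes_tpower[OF that(2,3)], of 0] gtwist_otimes_right[OF that(2,3), of 0]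
    by simp
  have split: "\<exists>us ms vs as bs cs. xs = us @ ms @ vs \<and> ds = as @ bs @ cs \<and> 
      length us = k \<and> length ms = 2 \<and> length vs = l \<and> degrees us as \<and> degrees ms bs \<and> degrees vs cs"
    if "length xs = n" "degrees xs ds" for xs ds
    using that unfolding n
    by (intro exI[of _ "take k xs"] exI[of _ "take 2 (drop k xs)"] exI[of _ "drop 2 (drop k xs)"] 
      exI[of _ "take k ds"] exI[of _ "take 2 (drop k ds)"] exI[of _ "drop 2 (drop k ds)"]
      conjI list_all2_takeI list_all2_dropI) (simp_all del: drop_drop)
  show ?thesis
  proof (rule tensor_homI)
    show "gtwist k (tone n) = tone n"
      using G[of "tone k" "tone 2" "tone l"] tone_gr[THEN tpower_gr_subset] 
      by (simp add: n tensor_homD(4)[OF tensor_hom_gtwist_2])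
  next
    fix xs ds assume "length xs = n" "degrees xs ds"
    then obtain us ms vs as bs cs where *: "xs = us @ ms @ vs" "ds = as @ bs @ cs"
      "length us = k" "length ms = 2" "length vs = l" "degrees us as" "degrees ms bs" "degrees vs cs"
      using split by blast
    have "cls (word us) \<otimes> (gtwist 0 (cls (word ms)) \<otimes> cls (word vs)) \<in>
        tpower_gr (k + (2 + l)) (sum_list as + (sum_list bs + sum_list cs))"
      using * by (intro otimes_gr tensor_homD(2)[OF tensor_hom_gtwist_2] word_tpower_gr) auto
    then show "gtwist k (cls (word xs)) \<in> tpower_gr n (sum_list ds)"
      using * G[of "cls (word us)" "cls (word ms)" "cls (word vs)"]
      by (simp add: n otimes_word word_tpower)
  next
    fix xs ds ys es assume xy: "length xs = n" "degrees xs ds" "length ys = n" "degrees ys es"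
    obtain us ms vs as bs cs where x: "xs = us @ ms @ vs" "ds = as @ bs @ cs"
      "length us = k" "length ms = 2" "length vs = l" "degrees us as" "degrees ms bs" "degrees vs cs"
      using split[OF xy(1,2)] by blast
    obtain us' ms' vs' as' bs' cs' where y: "ys = us' @ ms' @ vs'" "es = as' @ bs' @ cs'"
      "length us' = k" "length ms' = 2" "length vs' = l" "degrees us' as'" "degrees ms' bs'" "degrees vs' cs'"
      using split[OF xy(3,4)] by blast
    define U V W U' V' W' where UVW: "U = cls (word us)" "V = cls (word ms)" "W = cls (word vs)"
      "U' = cls (word us')" "V' = cls (word ms')" "W' = cls (word vs')"
    define b c a' b' where abc: "b = sum_list bs" "c = sum_list cs" "a' = sum_list as'" "b' = sum_list bs'"
    have X: "cls (word xs) = U \<otimes> (V \<otimes> W)" "cls (word ys) = U' \<otimes> (V' \<otimes> W')"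
      by (simp_all add: UVW otimes_word x y)
    have gr: "V \<in> tpower_gr 2 b" "W \<in> tpower_gr l c" "U' \<in> tpower_gr k a'" "V' \<in> tpower_gr 2 b'"
      using x y by (auto simp: UVW abc intro: word_tpower_gr)
    have tp: "U \<in> tpower k" "W' \<in> tpower l"
      using x y by (auto simp: UVW intro: word_tpower)
    have mult: "(U \<otimes> (P \<otimes> W)) \<cdot> (U' \<otimes> (P' \<otimes> W')) =
        tscale (ksign (b + c) a' * ksign c b') ((U \<cdot> U') \<otimes> ((P \<cdot> P') \<otimes> (W \<cdot> W')))"
      if "P \<in> tpower_gr 2 b" "P' \<in> tpower_gr 2 b'" for P P'
      using otimes_tmult[OF tp(1) otimes_gr[OF that(1) gr(2)] gr(3) 
          otimes_tpower[OF tpower_gr_subset[OF that(2)] tp(2)]]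
        otimes_tmult[OF tpower_gr_subset[OF that(1)] gr(2) that(2) tp(2)] by simp
    have V: "V \<in> tpower 2" "V' \<in> tpower 2" using gr tpower_gr_subset by blast+
    have prods: "U \<cdot> U' \<in> tpower k" "V \<cdot> V' \<in> tpower 2" "W \<cdot> W' \<in> tpower l"
      using gr tp V tpower_gr_subset by (auto intro: tmult_tpower)
    have "gtwist k (cls (word xs) \<cdot> cls (word ys)) = tscale (ksign (b + c) a' * ksign c b') 
        ((U \<cdot> U') \<otimes> (gtwist 0 (V \<cdot> V') \<otimes> (W \<cdot> W')))"
      unfolding X mult[OF gr(1,4)] by (simp add: tlin_tscale[OF tlin_gtwist] G[OF prods])
    also have "gtwist 0 (V \<cdot> V') = gtwist 0 V \<cdot> gtwist 0 V'"
      by (rule tensor_homD(3)[OF tensor_hom_gtwist_2 V])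
    also have "tscale (ksign (b + c) a' * ksign c b') 
        ((U \<cdot> U') \<otimes> ((gtwist 0 V \<cdot> gtwist 0 V') \<otimes> (W \<cdot> W'))) =
        (U \<otimes> (gtwist 0 V \<otimes> W)) \<cdot> (U' \<otimes> (gtwist 0 V' \<otimes> W'))"
      using gr by (intro mult[symmetric] tensor_homD(2)[OF tensor_hom_gtwist_2])
    also have "\<dots> = gtwist k (cls (word xs)) \<cdot> gtwist k (cls (word ys))"
      unfolding X using gr tp V tpower_gr_subset by (simp add: G)
    finally show "gtwist k (cls (word xs) \<cdot> cls (word ys)) = gtwist k (cls (word xs)) \<cdot> gtwist k (cls (word ys))" .
  qed (rule tlin_gtwist)
qed

lemma tensor_hom_gtwist_3:
  "tensor_hom 3 3 (gtwist 0)" "tensor_hom 3 3 (gtwist 1)"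
  by (rule tensor_hom_gtwist; simp)+

lemma gtwist_word3:
  assumes "x \<in> gr d" "y \<in> gr e" "z \<in> gr f"
  shows "gtwist 0 (cls (word [x, y, z])) = tscale (ksign d e) (cls (word [y, x, z]))"
    "gtwist (Suc 0) (cls (word [x, y, z])) = tscale (ksign e f) (cls (word [x, z, y]))"
  using gtwist_word[of "[x, y, z]" "[d, e, f]" 0] gtwist_word[of "[x, y, z]" "[d, e, f]" 1] assms
  by (simp_all add: numeral_2_eq_2)

text \<open>The two cyclic permutations behind the indices 231 and 312: a single factor jumps over a
  tensor with two factors.\<close>

lemma gtwist_cycle_left:
  assumes "a \<in> gr d" "Z \<in> tpower_gr 2 e"
  shows "gtwist 1 (gtwist 0 (emb a \<otimes> Z)) = tscale (ksign d e) (Z \<otimes> emb a)"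
  using assms(2)
proof (rule tpower_gr_ext; (intro tlin_intros)?)
  fix xs ds assume "length xs = 2" "degrees xs ds" "sum_list ds = e"
  then show "gtwist 1 (gtwist 0 (emb a \<otimes> cls (word xs))) = tscale (ksign d e) (cls (word xs) \<otimes> emb a)"
    using assms(1)
    by (elim length_2_degreesE) (auto simp: emb_def otimes_word gtwist_word3 tlin_tscale[OF tlin_gtwist] ksign_add)
qed

lemma gtwist_cycle_right:
  assumes "a \<in> gr d" "Z \<in> tpower_gr 2 e"
  shows "gtwist 0 (gtwist 1 (Z \<otimes> emb a)) = tscale (ksign e d) (emb a \<otimes> Z)"
  using assms(2)
proof (rule tpower_gr_ext; (intro tlin_intros)?)
  fix xs ds assume "length xs = 2" "degrees xs ds" "sum_list ds = e"
  then show "gtwist 0 (gtwist 1 (cls (word xs) \<otimes> emb a)) = tscale (ksign e d) (emb a \<otimes> cls (word xs))"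
    using assms(1)
    by (elim length_2_degreesE) (auto simp: emb_def otimes_word gtwist_word3 tlin_tscale[OF tlin_gtwist] ksign_add mult.commute)
qed

text \<open>Both sides are \<open>Z\<^sub>1\<^sub>3\<close>.\<close>

lemma gtwist_13:
  assumes "Z \<in> tpower 2"
  shows "gtwist 0 (emb 1 \<otimes> Z) = gtwist 1 (Z \<otimes> emb 1)"
  using assms
proof (rule tpower_ext; (intro tlin_intros)?)
  fix xs ds assume "length xs = 2" "degrees xs ds"
  then show "gtwist 0 (emb 1 \<otimes> cls (word xs)) = gtwist 1 (cls (word xs) \<otimes> emb 1)"
    using gr_one
    by (elim length_2_degreesE) (auto simp: emb_def otimes_word gtwist_word3)
qed

lemma tpower_2_ext:
  assumes "X \<in> tpower 2" "tlin g" "tlin h"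
    and "\<And>x y d e. x \<in> gr d \<Longrightarrow> y \<in> gr e \<Longrightarrow> g (emb x \<otimes> emb y) = h (emb x \<otimes> emb y)"
  shows "g X = h X"
  using assms(1-3)
  by (rule tpower_ext) (use assms(4) in \<open>auto simp: emb_def otimes_word elim!: length_2_degreesE\<close>)

end

context superalgebra
begin

section \<open>Linear maps from tensors to the algebra\<close>

definition alin :: "(('k, 'a) formal set \<Rightarrow> 'a) \<Rightarrow> bool" where
  "alin g \<longleftrightarrow> (\<forall>p q. g (cls (p + q)) = g (cls p) + g (cls q)) \<and>
     (\<forall>c p. g (cls (fscale c p)) = c *s g (cls p))"

lemma alin_tadd: "alin g \<Longrightarrow> X \<in> range cls \<Longrightarrow> Y \<in> range cls \<Longrightarrow> g (tadd X Y) = g X + g Y"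
  by (auto simp: alin_def tadd_cls)

lemma alin_tscale: "alin g \<Longrightarrow> X \<in> range cls \<Longrightarrow> g (tscale c X) = c *s g X"
  by (auto simp: alin_def tscale_cls)

lemma alin_tlin:
  assumes "alin g" "tlin h"
  shows "alin (\<lambda>X. g (h X))"
proof -
  have "h (cls p) \<in> range cls" for p using assms(2) by (simp add: tlin_def)
  then show ?thesis
    using assms alin_tadd[OF assms(1)] alin_tscale[OF assms(1)] by (simp add: alin_def[of "\<lambda>X. g (h X)"] tlin_def)
qed

lemma alin_mult_left: "alin g \<Longrightarrow> alin (\<lambda>X. a * g X)"
  and alin_mult_right: "alin g \<Longrightarrow> alin (\<lambda>X. g X * a)"
  and alin_scale: "alin g \<Longrightarrow> alin (\<lambda>X. c *s g X)"
  by (simp_all add: alin_def distrib_left distrib_right scale_mult_left scale_mult_right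
      scale_right_distrib mult.commute)

lemma subspace_alin_eq:
  assumes "alin g" "alin h"
  shows "formal.subspace {p. g (cls p) = h (cls p)}"
proof -
  have "g (cls 0) = 0" if "alin g" for g
    using alin_tscale[OF that, of "cls 0" 0] by (simp add: tscale_cls)
  from this[OF assms(1)] this[OF assms(2)] show ?thesis
    using assms unfolding formal.subspace_def by (simp add: alin_def)
qed

lemma alin_gr_ext:
  assumes "X \<in> tpower_gr n d" "alin g" "alin h"
    and "\<And>xs ds. length xs = n \<Longrightarrow> degrees xs ds \<Longrightarrow> sum_list ds = d \<Longrightarrow> g (cls (word xs)) = h (cls (word xs))"
  shows "g X = h X"
  using assms(1) subspace_alin_eq[OF assms(2,3)] assms(4) by (rule tpower_gr_induct)

lemma alin_ext:
  assumes "X \<in> tpower n" "alin g" "alin h"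
    and "\<And>xs ds. length xs = n \<Longrightarrow> degrees xs ds \<Longrightarrow> g (cls (word xs)) = h (cls (word xs))"
  shows "g X = h X"
  using assms(1) subspace_alin_eq[OF assms(2,3)] assms(4) by (rule tpower_induct)

text \<open>Exactly what makes \<open>contract f\<close> independent of the representative.\<close>

definition multilinear :: "('a list \<Rightarrow> 'a) \<Rightarrow> bool" where
  "multilinear f \<longleftrightarrow> (\<forall>us x y vs. f (us @ (x + y) # vs) = f (us @ x # vs) + f (us @ y # vs)) \<and>
     (\<forall>us c x vs. f (us @ (c *s x) # vs) = c *s f (us @ x # vs))"

lemma contract_cls:
  assumes "multilinear f"
  shows "contract f (cls p) = (\<Sum>xs\<in>Poly_Mapping.keys p. Poly_Mapping.lookup p xs *s f xs)"
proof -
  define w where "w = (\<lambda>p. \<Sum>xs\<in>Poly_Mapping.keys p. Poly_Mapping.lookup p xs *s f xs)"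
  have w: "w p = (\<Sum>xs\<in>A. Poly_Mapping.lookup p xs *s f xs)" if "finite A" "Poly_Mapping.keys p \<subseteq> A" for A p
    unfolding w_def by (rule sum.mono_neutral_left) (use that in \<open>auto simp: in_keys_iff\<close>)
  have add: "w (p + q) = w p + w q" for p q
    using keys_add[of p q] w[of "Poly_Mapping.keys p \<union> Poly_Mapping.keys q"]
    by (simp add: lookup_add scale_left_distrib sum.distrib)
  have scale: "w (fscale c p) = c *s w p" for c p
  proof -
    have "Poly_Mapping.keys (fscale c p) \<subseteq> Poly_Mapping.keys p" by (auto simp: in_keys_iff)
    then show ?thesis using w[of "Poly_Mapping.keys p"] by (simp add: scale_sum_right)
  qed
  have diff: "w (p - q) = w p - w q" for p q
    using add[of "p - q" q] by (simp add: algebra_simps)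
  have word: "w (word xs) = f xs" for xs by (simp add: w_def)
  have "w p = 0" if "p \<in> formal.span relators" for p
    using that
  proof (induction rule: formal.span_induct_alt)
    case base
    then show ?case by (simp add: w_def)
  next
    case (step c r p)
    from step(1) have "w r = 0"
      by (cases rule: relators_cases) (use assms in \<open>simp_all add: multilinear_def diff scale word\<close>)
    with step show ?case by (simp add: add scale)
  qed
  from this[OF rep_cls[of p]] have "w (rep (cls p)) = w p"
    by (simp add: diff)
  then show ?thesis by (simp add: contract_def w_def)
qed

lemma contract_word: "multilinear f \<Longrightarrow> contract f (cls (word xs)) = f xs"
  by (simp add: contract_cls)

lemma alin_contract:
  assumes "multilinear f"
  shows "alin (contract f)"
  unfolding alin_def
proof (intro conjI allI)
  have w: "contract f (cls p) = (\<Sum>xs\<in>A. Poly_Mapping.lookup p xs *s f xs)"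
    if "finite A" "Poly_Mapping.keys p \<subseteq> A" for A p
    unfolding contract_cls[OF assms] by (rule sum.mono_neutral_left) (use that in \<open>auto simp: in_keys_iff\<close>)
  show "contract f (cls (p + q)) = contract f (cls p) + contract f (cls q)" for p q
    using keys_add[of p q] w[of "Poly_Mapping.keys p \<union> Poly_Mapping.keys q"]
    by (simp add: lookup_add scale_left_distrib sum.distrib)
  show "contract f (cls (fscale c p)) = c *s contract f (cls p)" for c p
  proof -
    have "Poly_Mapping.keys (fscale c p) \<subseteq> Poly_Mapping.keys p" by (auto simp: in_keys_iff)
    then show ?thesis using w[of "Poly_Mapping.keys p"] by (simp add: scale_sum_right)
  qed
qed

lemma multilinear_2:
  assumes "\<And>x x' y. T (x + x') y = T x y + T x' y" "\<And>x y y'. T x (y + y') = T x y + T x y'"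
    and "\<And>c x y. T (c *s x) y = c *s T x y" "\<And>c x y. T x (c *s y) = c *s T x y"
  shows "multilinear (\<lambda>xs. case xs of [x, y] \<Rightarrow> T x y | _ \<Rightarrow> 0)"
proof -
  have *: "us = [] \<or> (\<exists>u. us = [u]) \<or> (\<exists>u v ws. us = u # v # ws)" for us :: "'a list"
    by (metis list.exhaust)
  show ?thesis
    unfolding multilinear_def
  proof (intro conjI allI)
    fix us x y vs c
    show "(case us @ (x + y) # vs of [x, y] \<Rightarrow> T x y | _ \<Rightarrow> 0) =
        (case us @ x # vs of [x, y] \<Rightarrow> T x y | _ \<Rightarrow> 0) + (case us @ y # vs of [x, y] \<Rightarrow> T x y | _ \<Rightarrow> 0)"
      using *[of us] by (auto simp: assms split: list.split)
    show "(case us @ (c *s x) # vs of [x, y] \<Rightarrow> T x y | _ \<Rightarrow> 0) =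
        c *s (case us @ x # vs of [x, y] \<Rightarrow> T x y | _ \<Rightarrow> 0)"
      using *[of us] by (auto simp: assms split: list.split)
  qed
qed

lemma multilinear_3:
  assumes "\<And>x x' y z. T (x + x') y z = T x y z + T x' y z"
    and "\<And>x y y' z. T x (y + y') z = T x y z + T x y' z"
    and "\<And>x y z z'. T x y (z + z') = T x y z + T x y z'"
    and "\<And>c x y z. T (c *s x) y z = c *s T x y z" "\<And>c x y z. T x (c *s y) z = c *s T x y z"
    and "\<And>c x y z. T x y (c *s z) = c *s T x y z"
  shows "multilinear (\<lambda>xs. case xs of [x, y, z] \<Rightarrow> T x y z | _ \<Rightarrow> 0)"
proof -
  have *: "us = [] \<or> (\<exists>u. us = [u]) \<or> (\<exists>u v. us = [u, v]) \<or> (\<exists>u v w ws. us = u # v # w # ws)"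
    for us :: "'a list"
    by (metis list.exhaust)
  show ?thesis
    unfolding multilinear_def
  proof (intro conjI allI)
    fix us x y vs c
    show "(case us @ (x + y) # vs of [x, y, z] \<Rightarrow> T x y z | _ \<Rightarrow> 0) =
        (case us @ x # vs of [x, y, z] \<Rightarrow> T x y z | _ \<Rightarrow> 0) + (case us @ y # vs of [x, y, z] \<Rightarrow> T x y z | _ \<Rightarrow> 0)"
      using *[of us] by (auto simp: assms split: list.split)
    show "(case us @ (c *s x) # vs of [x, y, z] \<Rightarrow> T x y z | _ \<Rightarrow> 0) =
        c *s (case us @ x # vs of [x, y, z] \<Rightarrow> T x y z | _ \<Rightarrow> 0)"
      using *[of us] by (auto simp: assms split: list.split)
  qed
qed

lemma koszul_3: "koszul [a, b, c] [d, e, f] = (ksign b d * ksign c d * ksign c e :: 'k)"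
  using koszul_snoc[of "[a, b]" "[d, e]" c f, where ?'k='k] by (simp add: koszul_2 ksign_add)

lemma tmult_words2:
  assumes "x \<in> gr a" "y \<in> gr b" "x' \<in> gr c" "y' \<in> gr d"
  shows "cls (word [x, y]) \<cdot> cls (word [x', y']) = tscale (ksign b c) (cls (word [x * x', y * y']))"
  using tmult_words[of "[x, y]" "[a, b]" "[x', y']" "[c, d]"] assms by (simp add: koszul_2)

lemma tmult_words3:
  assumes "x \<in> gr a" "y \<in> gr b" "z \<in> gr c" "x' \<in> gr d" "y' \<in> gr e" "z' \<in> gr f"
  shows "cls (word [x, y, z]) \<cdot> cls (word [x', y', z']) =
    tscale (ksign b d * ksign c d * ksign c e) (cls (word [x * x', y * y', z * z']))"
  using tmult_words[of "[x, y, z]" "[a, b, c]" "[x', y', z']" "[d, e, f]"] assms by (simp add: koszul_3)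

lemma emb_K_tscale: "emb_K c = tscale c (cls (word []))"
  by (simp add: emb_K_def tscale_cls)

lemma otimes_emb_K:
  assumes "X \<in> range cls"
  shows "emb_K c \<otimes> X = tscale c X" "X \<otimes> emb_K c = tscale c X"
  using assms by (simp_all add: emb_K_tscale)

lemma emb_range [simp]: "emb x \<in> range cls"
  by (simp add: emb_def)

end

section \<open>Comultiplication and counit as homomorphisms\<close>

context graded_quasi_bialgebra
begin

lemma letter_hom_coprod: "letter_hom 2 \<Delta>"
  using coprod_add coprod_scale coprod_gr coprod_mult coprod_one by (auto simp: letter_hom_def)

lemma letter_hom_counit: "letter_hom 0 (emb_K \<circ> \<epsilon>)"
proof -
  have "emb_K (\<epsilon> x) \<in> tpower_gr 0 d" if "x \<in> gr d" for x d
  proof (cases "d = 0")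
    case True
    then show ?thesis using tone_gr[of 0] by (simp add: emb_K_tscale tone_0 tscale_tpower_gr)
  next
    case False
    then have "d = 1" by simp
    then have "\<epsilon> x = 0" using that counit_odd by simp
    then show ?thesis by (simp add: emb_K_def cls_0_gr)
  qed
  moreover have "cls (word []) \<cdot> cls (word []) = cls (word [])"
    using tone_mult(1)[OF word_tpower[of "[]" 0]] by (simp add: tone_0)
  ultimately show ?thesis
    by (simp add: letter_hom_def counit_add counit_scale counit_mult counit_one emb_K_tscale tone_0 tscale_1)
      (simp add: tscale_cls tadd_cls formal.scale_left_distrib mult.commute)
qed

lemma letter_homs [simp]: "letter_hom 2 \<Delta>" "letter_hom 0 (emb_K \<circ> \<epsilon>)" "letter_hom (Suc 0) emb"
  using letter_hom_coprod letter_hom_counit letter_hom_emb by simp_all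

lemma tensor_homs:
  "tensor_hom 2 3 (tmap [\<Delta>, emb])" "tensor_hom 2 3 (tmap [emb, \<Delta>])"
  "tensor_hom 3 4 (tmap [\<Delta>, emb, emb])" "tensor_hom 3 4 (tmap [emb, \<Delta>, emb])" "tensor_hom 3 4 (tmap [emb, emb, \<Delta>])"
  "tensor_hom 2 1 (tmap [emb_K \<circ> \<epsilon>, emb])" "tensor_hom 2 1 (tmap [emb, emb_K \<circ> \<epsilon>])"
  "tensor_hom 3 2 (tmap [emb, emb_K \<circ> \<epsilon>, emb])" "tensor_hom 3 2 (tmap [emb_K \<circ> \<epsilon>, emb, emb])"
  by (rule tensor_hom_tmap[of "[2, 1]"] tensor_hom_tmap[of "[1, 2]"]
      tensor_hom_tmap[of "[2, 1, 1]"] tensor_hom_tmap[of "[1, 2, 1]"] tensor_hom_tmap[of "[1, 1, 2]"]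
      tensor_hom_tmap[of "[0, 1]"] tensor_hom_tmap[of "[1, 0]"]
      tensor_hom_tmap[of "[1, 0, 1]"] tensor_hom_tmap[of "[0, 1, 1]"]; simp)+

lemma tmap2_emb:
  "tmap [\<Delta>, emb] (emb x \<otimes> emb y) = \<Delta> x \<otimes> emb y"
  "tmap [emb, \<Delta>] (emb x \<otimes> emb y) = emb x \<otimes> \<Delta> y"
  using tmap_Cons[OF letter_homs(1), of "[1]" "[emb]" "emb y" x] tmap_Cons[OF letter_homs(3), of "[2]" "[\<Delta>]" "emb y" x]
    emb_tpower[of y]
  by (simp_all add: tmap_single[OF letter_homs(1)] tmap_emb1)

lemma tmap3_otimes_emb:
  assumes "X \<in> tpower 2"
  shows "tmap [\<Delta>, emb, emb] (X \<otimes> emb y) = tmap [\<Delta>, emb] X \<otimes> emb y"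
    "tmap [emb, \<Delta>, emb] (X \<otimes> emb y) = tmap [emb, \<Delta>] X \<otimes> emb y"
    "tmap [emb, emb, \<Delta>] (X \<otimes> emb y) = X \<otimes> \<Delta> y"
    "tmap [emb, emb_K \<circ> \<epsilon>, emb] (X \<otimes> emb y) = tmap [emb, emb_K \<circ> \<epsilon>] X \<otimes> emb y"
    "tmap [emb_K \<circ> \<epsilon>, emb, emb] (X \<otimes> emb y) = tmap [emb_K \<circ> \<epsilon>, emb] X \<otimes> emb y"
  using tmap_append[of "[2, 1]" "[\<Delta>, emb]" "[1]" "[emb]" X "emb y"]
    tmap_append[of "[1, 2]" "[emb, \<Delta>]" "[1]" "[emb]" X "emb y"]
    tmap_append[of "[1, 1]" "[emb, emb]" "[2]" "[\<Delta>]" X "emb y"]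
    tmap_append[of "[1, 0]" "[emb, emb_K \<circ> \<epsilon>]" "[1]" "[emb]" X "emb y"]
    tmap_append[of "[0, 1]" "[emb_K \<circ> \<epsilon>, emb]" "[1]" "[emb]" X "emb y"]
    assms assms[unfolded numeral_2_eq_2] emb_tpower[of y]
  by (simp_all add: tmap_single[OF letter_homs(1)] tmap_emb1 tmap_emb2)

lemma tmap3_emb_otimes:
  assumes "X \<in> tpower 2"
  shows "tmap [\<Delta>, emb, emb] (emb x \<otimes> X) = \<Delta> x \<otimes> X"
    "tmap [emb, \<Delta>, emb] (emb x \<otimes> X) = emb x \<otimes> tmap [\<Delta>, emb] X"
    "tmap [emb, emb, \<Delta>] (emb x \<otimes> X) = emb x \<otimes> tmap [emb, \<Delta>] X"
    "tmap [emb, emb_K \<circ> \<epsilon>, emb] (emb x \<otimes> X) = emb x \<otimes> tmap [emb_K \<circ> \<epsilon>, emb] X"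
  using tmap_Cons[OF letter_homs(1), of "[1, 1]" "[emb, emb]" X x]
    tmap_Cons[OF letter_homs(3), of "[2, 1]" "[\<Delta>, emb]" X x]
    tmap_Cons[OF letter_homs(3), of "[1, 2]" "[emb, \<Delta>]" X x]
    tmap_Cons[OF letter_homs(3), of "[0, 1]" "[emb_K \<circ> \<epsilon>, emb]" X x]
    assms assms[unfolded numeral_2_eq_2]
  by (simp_all add: tmap_emb2)

lemmas tlin_homs = tlin_intros
  tensor_homs[THEN tensor_homD(1), THEN tlin_comp]

lemma associator_tinv: "is_tinv 3 \<Phi> (tinv 3 \<Phi>)"
  by (rule is_tinv_tinv[OF associator_invertible])

text \<open>The normalisation \<open>(1 \<otimes> \<epsilon> \<otimes> 1)\<Phi> = 1\<close> excludes an odd associator.\<close>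

lemma associator_even: "\<Phi> \<in> tpower_gr 3 0" "tinv 3 \<Phi> \<in> tpower_gr 3 0"
proof -
  obtain d where "\<Phi> \<in> tpower_gr 3 d"
    using associator_homogeneous by (auto simp: tensor_homogeneous_def)
  from homogeneous_even[OF tensor_homs(8) this counit_associator] show "\<Phi> \<in> tpower_gr 3 0" by simp
  then show "tinv 3 \<Phi> \<in> tpower_gr 3 0"
    by (rule is_tinv_even[OF associator_tinv])
qed

lemma quasi_coassoc_commute:
  "\<Phi> \<cdot> tmap [emb, \<Delta>] (\<Delta> x) = tmap [\<Delta>, emb] (\<Delta> x) \<cdot> \<Phi>"
proof -
  have "tmap [\<Delta>, emb] (\<Delta> x) \<cdot> \<Phi> \<in> tpower 3"
    using associator_tinv tensor_homD(5)[OF tensor_homs(1) coprod_tpower] 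
    by (intro tmult_tpower) (simp_all add: is_tinv_def)
  then show ?thesis
    by (simp add: quasi_coassoc tmult_assoc is_tinv_cancel[OF associator_tinv])
qed

text \<open>Doubling a leg with \<open>\<Delta>\<close> and removing one of the two copies with \<open>\<epsilon>\<close> does nothing.\<close>

lemma counit_coprod_13:
  assumes "X \<in> tpower 2"
  shows "tmap [emb, emb_K \<circ> \<epsilon>, emb] (tmap [\<Delta>, emb] X) = X"
    "tmap [emb, emb_K \<circ> \<epsilon>, emb] (tmap [emb, \<Delta>] X) = X"
    "tmap [emb_K \<circ> \<epsilon>, emb, emb] (tmap [\<Delta>, emb] X) = X"
proof -
  have "tlin (\<lambda>X. tmap [emb, emb_K \<circ> \<epsilon>, emb] (tmap [\<Delta>, emb] X))"
    "tlin (\<lambda>X. tmap [emb, emb_K \<circ> \<epsilon>, emb] (tmap [emb, \<Delta>] X))"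
    "tlin (\<lambda>X. tmap [emb_K \<circ> \<epsilon>, emb, emb] (tmap [\<Delta>, emb] X))"
    by (intro tlin_homs)+
  note ext = this[THEN tpower_2_ext[OF assms _ tlin_id]]
  show "tmap [emb, emb_K \<circ> \<epsilon>, emb] (tmap [\<Delta>, emb] X) = X"
    by (rule ext(1)) (simp only: tmap2_emb tmap3_otimes_emb[OF coprod_tpower] counit_right)
  show "tmap [emb, emb_K \<circ> \<epsilon>, emb] (tmap [emb, \<Delta>] X) = X"
    by (rule ext(2)) (simp only: tmap2_emb tmap3_emb_otimes[OF coprod_tpower] counit_left)
  show "tmap [emb_K \<circ> \<epsilon>, emb, emb] (tmap [\<Delta>, emb] X) = X"
    by (rule ext(3)) (simp only: tmap2_emb tmap3_otimes_emb[OF coprod_tpower] counit_left)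
qed

text \<open>Quasi-coassociativity inside the first leg of a tensor. It needs \<open>\<Phi>\<close> even, because \<open>\<Phi>\<close> has to
  pass the remaining leg.\<close>

lemma coassoc_left_leg:
  assumes "X \<in> tpower 2"
  shows "(\<Phi> \<otimes> emb 1) \<cdot> tmap [emb, \<Delta>, emb] (tmap [\<Delta>, emb] X) =
    tmap [\<Delta>, emb, emb] (tmap [\<Delta>, emb] X) \<cdot> (\<Phi> \<otimes> emb 1)"
  using assms
proof (rule tpower_2_ext; (intro tlin_homs)?)
  fix x y d e assume "x \<in> gr d" "y \<in> gr e"
  note \<Phi> = associator_even(1) tpower_gr_subset[OF associator_even(1)]
  note \<Delta> = tensor_homD(5)[OF tensor_homs(1) coprod_tpower] tensor_homD(5)[OF tensor_homs(2) coprod_tpower]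
  show "(\<Phi> \<otimes> emb 1) \<cdot> tmap [emb, \<Delta>, emb] (tmap [\<Delta>, emb] (emb x \<otimes> emb y)) =
      tmap [\<Delta>, emb, emb] (tmap [\<Delta>, emb] (emb x \<otimes> emb y)) \<cdot> (\<Phi> \<otimes> emb 1)"
    using otimes_tmult_even1[OF \<Phi>(2) emb_gr[OF gr_one] \<Delta>(2) emb_tpower[of y]]
      otimes_tmult_even2[OF \<Delta>(1) emb_tpower[of y] \<Phi>(1) emb_tpower[of 1]]
    by (simp add: tmap2_emb tmap3_otimes_emb[OF coprod_tpower] quasi_coassoc_commute flip: emb_mult)
qed

lemma coassoc_right_leg:
  assumes "X \<in> tpower 2"
  shows "(emb 1 \<otimes> \<Phi>) \<cdot> tmap [emb, emb, \<Delta>] (tmap [emb, \<Delta>] X) =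
    tmap [emb, \<Delta>, emb] (tmap [emb, \<Delta>] X) \<cdot> (emb 1 \<otimes> \<Phi>)"
  using assms
proof (rule tpower_2_ext; (intro tlin_homs)?)
  fix x y d e assume "x \<in> gr d" "y \<in> gr e"
  note \<Phi> = associator_even(1) tpower_gr_subset[OF associator_even(1)]
  note \<Delta> = tensor_homD(5)[OF tensor_homs(1) coprod_tpower] tensor_homD(5)[OF tensor_homs(2) coprod_tpower]
  show "(emb 1 \<otimes> \<Phi>) \<cdot> tmap [emb, emb, \<Delta>] (tmap [emb, \<Delta>] (emb x \<otimes> emb y)) =
      tmap [emb, \<Delta>, emb] (tmap [emb, \<Delta>] (emb x \<otimes> emb y)) \<cdot> (emb 1 \<otimes> \<Phi>)"
    using otimes_tmult_even1[OF emb_tpower[of 1] \<Phi>(1) emb_tpower[of x] \<Delta>(2)]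
      otimes_tmult_even2[OF emb_tpower[of x] \<Delta>(1) emb_gr[OF gr_one] \<Phi>(2)]
    by (simp add: tmap2_emb tmap3_emb_otimes[OF coprod_tpower] quasi_coassoc_commute flip: emb_mult)
qed

lemma coprod_both_legs:
  assumes "X \<in> tpower 2"
  shows "tmap [\<Delta>, emb, emb] (tmap [emb, \<Delta>] X) = tmap [emb, emb, \<Delta>] (tmap [\<Delta>, emb] X)"
  using assms
  by (rule tpower_2_ext; (intro tlin_homs)?)
    (simp add: tmap2_emb tmap3_emb_otimes[OF coprod_tpower] tmap3_otimes_emb[OF coprod_tpower])

text \<open>Exchanging the legs of \<open>X\<close> first, or carrying the already doubled leg around the other one, is
  the same; this turns \<open>\<Delta>\<close> on one leg into \<open>\<Delta>\<close> on the other.\<close>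

lemma gtwist_coprod:
  assumes "X \<in> tpower 2"
  shows "gtwist 1 (gtwist 0 (tmap [emb, \<Delta>] X)) = tmap [\<Delta>, emb] (gtwist 0 X)"
    and "gtwist 0 (gtwist 1 (tmap [\<Delta>, emb] X)) = tmap [emb, \<Delta>] (gtwist 0 X)"
proof -
  have T: "gtwist 0 (emb x \<otimes> emb y) = tscale (ksign d e) (emb y \<otimes> emb x)"
    if "x \<in> gr d" "y \<in> gr e" for x y d e
    using gtwist_word2[OF that] by (simp add: emb_def otimes_word)
  show "gtwist 1 (gtwist 0 (tmap [emb, \<Delta>] X)) = tmap [\<Delta>, emb] (gtwist 0 X)"
    using assms
    by (rule tpower_2_ext; (intro tlin_homs)?)
      (simp only: tmap2_emb T tlin_tscale[OF tensor_homD(1)[OF tensor_homs(1)] otimes_range]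
        gtwist_cycle_left[OF _ coprod_gr])
  show "gtwist 0 (gtwist 1 (tmap [\<Delta>, emb] X)) = tmap [emb, \<Delta>] (gtwist 0 X)"
    using assms
    by (rule tpower_2_ext; (intro tlin_homs)?)
      (simp only: tmap2_emb T tlin_tscale[OF tensor_homD(1)[OF tensor_homs(2)] otimes_range]
        gtwist_cycle_right[OF _ coprod_gr])
qed

end

section \<open>Contractions with the antipode\<close>

context quasi_hopf_superalgebra
begin

lemma antipode_ksign: "x \<in> gr d \<Longrightarrow> y \<in> gr e \<Longrightarrow> S (x * y) = ksign d e *s (S y * S x)"
  using antipode_mult[of x d y e] by (simp add: ksign_def)

lemmas bilinear_simps = antipode_add antipode_scale distrib_left distrib_right scale_mult_left scale_mult_right

lemma multilinear_S_left: "multilinear (\<lambda>xs. case xs of [x, y] \<Rightarrow> S x * a * y | _ \<Rightarrow> 0)"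
  and multilinear_S_right: "multilinear (\<lambda>xs. case xs of [x, y] \<Rightarrow> x * b * S y | _ \<Rightarrow> 0)"
  by (rule multilinear_2; simp add: bilinear_simps)+

lemma S_left_word: "S_left S a (cls (word [x, y])) = S x * a * y"
  unfolding S_left_def by (simp add: contract_word[OF multilinear_S_left])

lemma S_right_word: "S_right S b (cls (word [x, y])) = x * b * S y"
  unfolding S_right_def by (simp add: contract_word[OF multilinear_S_right])

lemma alin_S_left: "alin (S_left S a)"
  unfolding S_left_def by (rule alin_contract[OF multilinear_S_left])

lemma alin_S_right: "alin (S_right S b)"
  unfolding S_right_def by (rule alin_contract[OF multilinear_S_right])

text \<open>As \<open>S\<close> reverses products, the letters of the second factor end up outside of the contraction of
  the first. The sign \<open>[x'][y]\<close> of the product and the sign \<open>[x][y]\<close> of the antipode combine to the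
  product of \<open>[y]\<close> with the total degree of \<open>X\<close>.\<close>

lemma S_left_tmult_word:
  assumes "X \<in> tpower_gr 2 d" "y \<in> gr e" "y' \<in> gr f"
  shows "S_left S a (X \<cdot> cls (word [y, y'])) = ksign d e *s (S y * S_left S a X * y')"
  using assms(1)
proof (rule alin_gr_ext; (intro alin_scale alin_mult_left alin_mult_right alin_S_left alin_tlin[OF alin_S_left] tlin_intros)?)
  fix xs ds assume *: "length xs = 2" "degrees xs ds" "sum_list ds = d"
  show "S_left S a (cls (word xs) \<cdot> cls (word [y, y'])) = ksign d e *s (S y * S_left S a (cls (word xs)) * y')"
  proof (rule length_2_degreesE[OF *(1,2)])
    fix x x' b c assume x: "xs = [x, x']" "ds = [b, c]" "x \<in> gr b" "x' \<in> gr c"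
    show ?thesis
      using x * by (auto simp: tmult_words2[OF x(3,4) assms(2,3)] alin_tscale[OF alin_S_left] S_left_word
          antipode_ksign[OF x(3) assms(2)] ksign_add scale_mult_left scale_mult_right mult.assoc)
  qed
qed

lemma S_right_word_tmult:
  assumes "x \<in> gr d" "x' \<in> gr e" "Y \<in> tpower_gr 2 f"
  shows "S_right S b (cls (word [x, x']) \<cdot> Y) = ksign e f *s (x * S_right S b Y * S x')"
  using assms(3)
proof (rule alin_gr_ext; (intro alin_scale alin_mult_left alin_mult_right alin_S_right alin_tlin[OF alin_S_right] tlin_intros)?)
  fix ys ds assume *: "length ys = 2" "degrees ys ds" "sum_list ds = f"
  show "S_right S b (cls (word [x, x']) \<cdot> cls (word ys)) = ksign e f *s (x * S_right S b (cls (word ys)) * S x')"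
  proof (rule length_2_degreesE[OF *(1,2)])
    fix y y' c d assume y: "ys = [y, y']" "ds = [c, d]" "y \<in> gr c" "y' \<in> gr d"
    show ?thesis
      using y * by (auto simp: tmult_words2[OF assms(1,2) y(3,4)] alin_tscale[OF alin_S_right] S_right_word
          antipode_ksign[OF assms(2) y(4)] ksign_add scale_mult_left scale_mult_right mult.assoc)
  qed
qed

lemma S_left_tmult_even:
  assumes "X \<in> tpower_gr 2 0" "Y \<in> tpower 2"
  shows "S_left S a (X \<cdot> Y) = S_left S (S_left S a X) Y"
  using assms(2)
proof (rule alin_ext; (intro alin_S_left alin_tlin[OF alin_S_left] tlin_intros)?)
  fix ys ds assume "length ys = 2" "degrees ys ds"
  then obtain y y' e f where y: "ys = [y, y']" "y \<in> gr e" "y' \<in> gr f"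
    by (elim length_2_degreesE)
  show "S_left S a (X \<cdot> cls (word ys)) = S_left S (S_left S a X) (cls (word ys))"
    by (simp add: y(1) S_left_tmult_word[OF assms(1) y(2,3)] S_left_word)
qed

lemma S_right_tmult_even:
  assumes "X \<in> tpower 2" "Y \<in> tpower_gr 2 0"
  shows "S_right S b (X \<cdot> Y) = S_right S (S_right S b Y) X"
  using assms(1)
proof (rule alin_ext; (intro alin_S_right alin_tlin[OF alin_S_right] tlin_intros)?)
  fix xs ds assume "length xs = 2" "degrees xs ds"
  then obtain x x' e f where x: "xs = [x, x']" "x \<in> gr e" "x' \<in> gr f"
    by (elim length_2_degreesE)
  show "S_right S b (cls (word xs) \<cdot> Y) = S_right S (S_right S b Y) (cls (word xs))"
    by (simp add: x(1) S_right_word_tmult[OF x(2,3) assms(2)] S_right_word)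
qed

text \<open>Signs that depend on the degree of \<open>x\<close> are invisible next to \<open>\<epsilon> x\<close>, since \<open>\<epsilon>\<close> vanishes on odd
  elements. So the axioms for \<open>\<alpha>\<close> and \<open>\<beta>\<close> can be applied inside larger products even though
  \<open>\<Delta> x\<close> can be odd.\<close>

lemma ksign_counit: "x \<in> gr d \<Longrightarrow> \<epsilon> x = 0 \<or> ksign d e = (1 :: 'k)"
  using counit_odd[of x] by (cases "d = 0") auto

lemma S_left_coprod_tmult:
  assumes "Y \<in> tpower 2"
  shows "S_left S \<alpha> (\<Delta> x \<cdot> Y) = \<epsilon> x *s S_left S \<alpha> Y"
proof -
  have h: "S_left S \<alpha> (\<Delta> x \<cdot> Y) = \<epsilon> x *s S_left S \<alpha> Y" if x: "x \<in> gr d" for x d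
    using assms
  proof (rule alin_ext; (intro alin_scale alin_S_left alin_tlin[OF alin_S_left] tlin_intros)?)
    fix ys ds assume "length ys = 2" "degrees ys ds"
    then obtain y y' e f where y: "ys = [y, y']" "y \<in> gr e" "y' \<in> gr f"
      by (elim length_2_degreesE)
    show "S_left S \<alpha> (\<Delta> x \<cdot> cls (word ys)) = \<epsilon> x *s S_left S \<alpha> (cls (word ys))"
      using ksign_counit[OF x, of e]
      by (auto simp: y(1) S_left_tmult_word[OF coprod_gr[OF x] y(2,3)] S_left_word antipode_alpha
          scale_mult_left scale_mult_right)
  qed
  have r: "\<Delta> x \<in> range cls" for x using coprod_tpower tpower_range by blast
  have "S_left S \<alpha> (\<Delta> (part 0 x + part 1 x) \<cdot> Y) = \<epsilon> (part 0 x + part 1 x) *s S_left S \<alpha> Y"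
    by (simp only: coprod_add tlin_tadd[OF tlin_tmult_left r r] alin_tadd[OF alin_S_left tmult_range tmult_range]
        h[OF part_in] counit_add scale_left_distrib)
  then show ?thesis by (simp only: part_sum)
qed

lemma S_right_tmult_coprod:
  assumes "Y \<in> tpower 2"
  shows "S_right S \<beta> (Y \<cdot> \<Delta> x) = \<epsilon> x *s S_right S \<beta> Y"
proof -
  have h: "S_right S \<beta> (Y \<cdot> \<Delta> x) = \<epsilon> x *s S_right S \<beta> Y" if x: "x \<in> gr d" for x d
    using assms
  proof (rule alin_ext; (intro alin_scale alin_S_right alin_tlin[OF alin_S_right] tlin_intros)?)
    fix ys ds assume "length ys = 2" "degrees ys ds"
    then obtain y y' e f where y: "ys = [y, y']" "y \<in> gr e" "y' \<in> gr f"
      by (elim length_2_degreesE)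
    show "S_right S \<beta> (cls (word ys) \<cdot> \<Delta> x) = \<epsilon> x *s S_right S \<beta> (cls (word ys))"
      using ksign_counit[OF x, of f]
      by (auto simp: y(1) S_right_word_tmult[OF y(2,3) coprod_gr[OF x]] S_right_word antipode_beta
          scale_mult_left scale_mult_right ksign_commute[of _ d])
  qed
  have r: "\<Delta> x \<in> range cls" for x using coprod_tpower tpower_range by blast
  have "S_right S \<beta> (Y \<cdot> \<Delta> (part 0 x + part 1 x)) = \<epsilon> (part 0 x + part 1 x) *s S_right S \<beta> Y"
    by (simp only: coprod_add tlin_tadd[OF tlin_tmult_right r r] alin_tadd[OF alin_S_right tmult_range tmult_range]
        h[OF part_in] counit_add scale_left_distrib)
  then show ?thesis by (simp only: part_sum)
qed

lemma S_left_gr: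
  assumes "X \<in> tpower_gr 2 d" "a \<in> gr 0"
  shows "S_left S a X \<in> gr d"
proof -
  have "formal.subspace {p. S_left S a (cls p) \<in> gr d}"
    unfolding formal.subspace_def
    using alin_S_left[of a] subspace_0[OF gr_subspace[of d]] subspace_add[OF gr_subspace[of d]]
      subspace_scale[OF gr_subspace[of d]] alin_tscale[OF alin_S_left[of a], of "cls 0" 0]
    by (auto simp: alin_def tscale_cls)
  with assms(1) show ?thesis
  proof (rule tpower_gr_induct)
    fix xs ds assume *: "length xs = 2" "degrees xs ds" "sum_list ds = d"
    show "S_left S a (cls (word xs)) \<in> gr d"
    proof (rule length_2_degreesE[OF *(1,2)])
      fix x y b c assume x: "xs = [x, y]" "ds = [b, c]" "x \<in> gr b" "y \<in> gr c"
      then show ?thesis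
        using * gr_mult[OF gr_mult[OF antipode_gr[OF x(3)] assms(2)] x(4)] by (simp add: S_left_word)
    qed
  qed
qed

lemma S_right_gr:
  assumes "X \<in> tpower_gr 2 d" "b \<in> gr 0"
  shows "S_right S b X \<in> gr d"
proof -
  have "formal.subspace {p. S_right S b (cls p) \<in> gr d}"
    unfolding formal.subspace_def
    using alin_S_right[of b] subspace_0[OF gr_subspace[of d]] subspace_add[OF gr_subspace[of d]]
      subspace_scale[OF gr_subspace[of d]] alin_tscale[OF alin_S_right[of b], of "cls 0" 0]
    by (auto simp: alin_def tscale_cls)
  with assms(1) show ?thesis
  proof (rule tpower_gr_induct)
    fix xs ds assume *: "length xs = 2" "degrees xs ds" "sum_list ds = d"
    show "S_right S b (cls (word xs)) \<in> gr d"
    proof (rule length_2_degreesE[OF *(1,2)])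
      fix x y d' c assume x: "xs = [x, y]" "ds = [d', c]" "x \<in> gr d'" "y \<in> gr c"
      then show ?thesis
        using * gr_mult[OF gr_mult[OF x(3) assms(2)] antipode_gr[OF x(4)]] by (simp add: S_right_word)
    qed
  qed
qed

text \<open>The contractions in the last two axioms of a quasi-Hopf superalgebra, with \<open>\<alpha>\<close> and \<open>\<beta>\<close> turned
  into parameters because twisting replaces them.\<close>

definition zigzag_inv :: "'a \<Rightarrow> 'a \<Rightarrow> ('k, 'a) formal set \<Rightarrow> 'a" where
  "zigzag_inv b a = contract (\<lambda>xs. case xs of [x, y, z] \<Rightarrow> x * b * S y * a * z | _ \<Rightarrow> 0)"

definition zigzag :: "'a \<Rightarrow> 'a \<Rightarrow> ('k, 'a) formal set \<Rightarrow> 'a" where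
  "zigzag a b = contract (\<lambda>xs. case xs of [x, y, z] \<Rightarrow> S x * a * y * b * S z | _ \<Rightarrow> 0)"

lemma multilinear_zigzag_inv: "multilinear (\<lambda>xs. case xs of [x, y, z] \<Rightarrow> x * b * S y * a * z | _ \<Rightarrow> 0)"
  and multilinear_zigzag: "multilinear (\<lambda>xs. case xs of [x, y, z] \<Rightarrow> S x * a * y * b * S z | _ \<Rightarrow> 0)"
  by (rule multilinear_3; simp add: bilinear_simps)+

lemma zigzag_inv_word: "zigzag_inv b a (cls (word [x, y, z])) = x * b * S y * a * z"
  unfolding zigzag_inv_def by (simp add: contract_word[OF multilinear_zigzag_inv])

lemma zigzag_word: "zigzag a b (cls (word [x, y, z])) = S x * a * y * b * S z"
  unfolding zigzag_def by (simp add: contract_word[OF multilinear_zigzag])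

lemma alin_zigzag_inv: "alin (zigzag_inv b a)"
  unfolding zigzag_inv_def by (rule alin_contract[OF multilinear_zigzag_inv])

lemma alin_zigzag: "alin (zigzag a b)"
  unfolding zigzag_def by (rule alin_contract[OF multilinear_zigzag])

lemmas alin_intros = alin_scale alin_mult_left alin_mult_right alin_S_left alin_S_right alin_zigzag_inv alin_zigzag
  alin_tlin[OF alin_zigzag_inv] alin_tlin[OF alin_zigzag] tlin_intros

text \<open>In this lemma and the three after it a tensor with three factors is multiplied by one that
  contains the two factors of \<open>Z\<close>; the antipode brings the two letters of \<open>Z\<close> together, so that they
  are contracted to a single element.\<close>

lemma zigzag_inv_left:
  assumes "f \<in> gr c" "Z \<in> tpower_gr 2 e" "x \<in> gr dx" "y \<in> gr dy" "z \<in> gr dz"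
  shows "zigzag_inv b a ((emb f \<otimes> Z) \<cdot> cls (word [x, y, z])) =
    ksign e (dx + dy) *s (f * x * b * S y * S_left S a Z * z)"
  using assms(2)
proof (rule alin_gr_ext; (intro alin_intros)?)
  fix us ds assume *: "length us = 2" "degrees us ds" "sum_list ds = e"
  show "zigzag_inv b a ((emb f \<otimes> cls (word us)) \<cdot> cls (word [x, y, z])) =
    ksign e (dx + dy) *s (f * x * b * S y * S_left S a (cls (word us)) * z)"
  proof (rule length_2_degreesE[OF *(1,2)])
    fix u v du dv assume u: "us = [u, v]" "ds = [du, dv]" "u \<in> gr du" "v \<in> gr dv"
    have e: "e = du + dv" using * u by simp
    show ?thesis
      by (simp add: u e emb_def otimes_word tmult_words3[OF assms(1) u(3,4) assms(3-5)]
          alin_tscale[OF alin_zigzag_inv] zigzag_inv_word S_left_word antipode_ksign[OF u(3) assms(4)]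
          ksign_add scale_mult_left scale_mult_right mult_ac mult.assoc)
  qed
qed

lemma zigzag_inv_right:
  assumes "h \<in> gr c" "Z \<in> tpower_gr 2 e" "x \<in> gr dx" "y \<in> gr dy" "z \<in> gr dz"
  shows "zigzag_inv b a (cls (word [x, y, z]) \<cdot> (Z \<otimes> emb h)) =
    ksign (dy + dz) e *s (x * S_right S b Z * S y * a * z * h)"
  using assms(2)
proof (rule alin_gr_ext; (intro alin_intros)?)
  fix us ds assume *: "length us = 2" "degrees us ds" "sum_list ds = e"
  show "zigzag_inv b a (cls (word [x, y, z]) \<cdot> (cls (word us) \<otimes> emb h)) =
    ksign (dy + dz) e *s (x * S_right S b (cls (word us)) * S y * a * z * h)"
  proof (rule length_2_degreesE[OF *(1,2)])
    fix u v du dv assume u: "us = [u, v]" "ds = [du, dv]" "u \<in> gr du" "v \<in> gr dv"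
    have e: "e = du + dv" using * u by simp
    show ?thesis
      by (simp add: u e emb_def otimes_word tmult_words3[OF assms(3-5) u(3,4) assms(1)]
          alin_tscale[OF alin_zigzag_inv] zigzag_inv_word S_right_word antipode_ksign[OF assms(4) u(4)]
          ksign_add scale_mult_left scale_mult_right mult_ac mult.assoc)
  qed
qed

lemma zigzag_left:
  assumes "h \<in> gr c" "Z \<in> tpower_gr 2 e" "x \<in> gr dx" "y \<in> gr dy" "z \<in> gr dz"
  shows "zigzag a b ((Z \<otimes> emb h) \<cdot> cls (word [x, y, z])) =
    ksign e dx *s (ksign c (dx + dy + dz) *s (S x * S_left S a Z * y * b * S z * S h))"
  using assms(2)
proof (rule alin_gr_ext; (intro alin_intros)?)
  fix us ds assume *: "length us = 2" "degrees us ds" "sum_list ds = e"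
  show "zigzag a b ((cls (word us) \<otimes> emb h) \<cdot> cls (word [x, y, z])) =
    ksign e dx *s (ksign c (dx + dy + dz) *s (S x * S_left S a (cls (word us)) * y * b * S z * S h))"
  proof (rule length_2_degreesE[OF *(1,2)])
    fix u v du dv assume u: "us = [u, v]" "ds = [du, dv]" "u \<in> gr du" "v \<in> gr dv"
    have e: "e = du + dv" using * u by simp
    show ?thesis
      by (simp add: u e emb_def otimes_word tmult_words3[OF u(3,4) assms(1) assms(3-5)]
          alin_tscale[OF alin_zigzag] zigzag_word S_left_word antipode_ksign[OF u(3) assms(3)]
          antipode_ksign[OF assms(1,5)]
          ksign_add scale_mult_left scale_mult_right mult_ac mult.assoc)
  qed
qed

lemma zigzag_right:
  assumes "f \<in> gr c" "Z \<in> tpower_gr 2 e" "x \<in> gr dx" "y \<in> gr dy" "z \<in> gr dz"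
  shows "zigzag a b (cls (word [x, y, z]) \<cdot> (emb f \<otimes> Z)) =
    ksign e dz *s (ksign (dx + dy + dz) c *s (S f * S x * a * y * S_right S b Z * S z))"
  using assms(2)
proof (rule alin_gr_ext; (intro alin_intros)?)
  fix us ds assume *: "length us = 2" "degrees us ds" "sum_list ds = e"
  show "zigzag a b (cls (word [x, y, z]) \<cdot> (emb f \<otimes> cls (word us))) =
    ksign e dz *s (ksign (dx + dy + dz) c *s (S f * S x * a * y * S_right S b (cls (word us)) * S z))"
  proof (rule length_2_degreesE[OF *(1,2)])
    fix u v du dv assume u: "us = [u, v]" "ds = [du, dv]" "u \<in> gr du" "v \<in> gr dv"
    have e: "e = du + dv" using * u by simp
    show ?thesis
      by (simp add: u e emb_def otimes_word tmult_words3[OF assms(3-5,1) u(3,4)]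
          alin_tscale[OF alin_zigzag] zigzag_word S_right_word antipode_ksign[OF assms(3,1)]
          antipode_ksign[OF assms(5) u(4)] ksign_commute[of _ dz]
          ksign_add scale_mult_left scale_mult_right mult_ac mult.assoc)
  qed
qed

text \<open>The antipode reverses the order of the letters of \<open>G\<close> and \<open>H\<close> that are multiplied to the
  middle letter of \<open>X\<close>, so that the letters of \<open>G\<close> enclose \<open>a\<close> and those of \<open>H\<close> enclose \<open>b\<close>.\<close>

lemma zigzag_inv_twist:
  assumes G: "G \<in> tpower_gr 2 0" and H: "H \<in> tpower_gr 2 0" and X: "X \<in> tpower 3"
  shows "zigzag_inv b a ((emb 1 \<otimes> G) \<cdot> X \<cdot> (H \<otimes> emb 1)) = zigzag_inv (S_right S b H) (S_left S a G) X"
proof -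
  have "zigzag_inv b a (X \<cdot> (H \<otimes> emb 1)) = zigzag_inv (S_right S b H) a X" if "X \<in> tpower 3" for X
    using that
  proof (rule alin_ext; (intro alin_intros)?)
    fix xs ds assume "length xs = 3" "degrees xs ds"
    then obtain x y z d e f where x: "xs = [x, y, z]" "x \<in> gr d" "y \<in> gr e" "z \<in> gr f"
      by (elim length_3_degreesE)
    show "zigzag_inv b a (cls (word xs) \<cdot> (H \<otimes> emb 1)) = zigzag_inv (S_right S b H) a (cls (word xs))"
      by (simp add: x(1) zigzag_inv_right[OF gr_one H x(2-4)] zigzag_inv_word)
  qed
  moreover have "zigzag_inv b' a ((emb 1 \<otimes> G) \<cdot> X) = zigzag_inv b' (S_left S a G) X" for b'
    using X
  proof (rule alin_ext; (intro alin_intros)?)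
    fix xs ds assume "length xs = 3" "degrees xs ds"
    then obtain x y z d e f where x: "xs = [x, y, z]" "x \<in> gr d" "y \<in> gr e" "z \<in> gr f"
      by (elim length_3_degreesE)
    show "zigzag_inv b' a ((emb 1 \<otimes> G) \<cdot> cls (word xs)) = zigzag_inv b' (S_left S a G) (cls (word xs))"
      by (simp add: x(1) zigzag_inv_left[OF gr_one G x(2-4)] zigzag_inv_word)
  qed
  moreover have "(emb 1 \<otimes> G) \<cdot> X \<in> tpower 3"
    by (intro tmult_tpower X otimes_tpower_eq[OF emb_tpower tpower_gr_subset[OF G]]) simp
  ultimately show ?thesis by simp
qed

lemma zigzag_twist:
  assumes G: "G \<in> tpower_gr 2 0" and H: "H \<in> tpower_gr 2 0" and X: "X \<in> tpower 3"
  shows "zigzag a b ((G \<otimes> emb 1) \<cdot> X \<cdot> (emb 1 \<otimes> H)) = zigzag (S_left S a G) (S_right S b H) X"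
proof -
  have "zigzag a b (X \<cdot> (emb 1 \<otimes> H)) = zigzag a (S_right S b H) X" if "X \<in> tpower 3" for X
    using that
  proof (rule alin_ext; (intro alin_intros)?)
    fix xs ds assume "length xs = 3" "degrees xs ds"
    then obtain x y z d e f where x: "xs = [x, y, z]" "x \<in> gr d" "y \<in> gr e" "z \<in> gr f"
      by (elim length_3_degreesE)
    show "zigzag a b (cls (word xs) \<cdot> (emb 1 \<otimes> H)) = zigzag a (S_right S b H) (cls (word xs))"
      by (simp add: x(1) zigzag_right[OF gr_one H x(2-4)] zigzag_word antipode_one)
  qed
  moreover have "zigzag a b' ((G \<otimes> emb 1) \<cdot> X) = zigzag (S_left S a G) b' X" for b'
    using X
  proof (rule alin_ext; (intro alin_intros)?)
    fix xs ds assume "length xs = 3" "degrees xs ds"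
    then obtain x y z d e f where x: "xs = [x, y, z]" "x \<in> gr d" "y \<in> gr e" "z \<in> gr f"
      by (elim length_3_degreesE)
    show "zigzag a b' ((G \<otimes> emb 1) \<cdot> cls (word xs)) = zigzag (S_left S a G) b' (cls (word xs))"
      by (simp add: x(1) zigzag_left[OF gr_one G x(2-4)] zigzag_word antipode_one)
  qed
  moreover have "(G \<otimes> emb 1) \<cdot> X \<in> tpower 3"
    by (intro tmult_tpower X otimes_tpower_eq[OF tpower_gr_subset[OF G] emb_tpower]) simp
  ultimately show ?thesis by simp
qed

lemma tlin_tmaps: "tlin (tmap [emb, \<Delta>])" "tlin (tmap [\<Delta>, emb])" "tlin (tmap [emb, emb_K \<circ> \<epsilon>])" "tlin (tmap [emb_K \<circ> \<epsilon>, emb])"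
  by (rule tlin_tmap[of "[1, 2]"] tlin_tmap[of "[2, 1]"] tlin_tmap[of "[1, 0]"] tlin_tmap[of "[0, 1]"]; simp)+

lemma tmap_words2:
  assumes "letter_hom k f" "letter_hom l g"
  shows "tmap [f, g] (cls (word [x, y])) = f x \<otimes> g y"
  using tmap_words[of "[k, l]" "[f, g]" "[x, y]"] assms tpower_range[OF letter_hom_tpower[OF assms(2), of y]]
  by simp

lemma S_left_tone: "S_left S a (tone 2) = a" and S_right_tone: "S_right S a (tone 2) = a"
  using S_left_word[of a 1 1] S_right_word[of a 1 1] by (simp_all add: tone_def numeral_2_eq_2 antipode_one)

text \<open>Inside the contraction, a comultiplied leg of \<open>G\<close> meets \<open>\<alpha>\<close> (or \<open>\<beta>\<close>) and collapses by the
  antipode axiom, so that \<open>\<Delta>\<close> can be replaced by \<open>\<epsilon>\<close> there. With the counit normalisation of the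
  twist, this factor becomes trivial.\<close>

lemma zigzag_inv_coprod_left:
  assumes "G \<in> tpower 2" "X \<in> tpower 3"
  shows "zigzag_inv \<beta> \<alpha> (tmap [emb, \<Delta>] G \<cdot> X) = zigzag_inv \<beta> \<alpha> ((tmap [emb, emb_K \<circ> \<epsilon>] G \<otimes> tone 2) \<cdot> X)"
  using assms(2)
proof (rule alin_ext; (intro alin_intros)?)
  fix xs ds assume xs: "length xs = 3" "degrees xs ds"
  show "zigzag_inv \<beta> \<alpha> (tmap [emb, \<Delta>] G \<cdot> cls (word xs)) =
      zigzag_inv \<beta> \<alpha> ((tmap [emb, emb_K \<circ> \<epsilon>] G \<otimes> tone 2) \<cdot> cls (word xs))"
    using assms(1)
  proof (rule alin_ext; (intro alin_intros tlin_tmaps)?)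
    fix us es assume us: "length us = 2" "degrees us es"
    show "zigzag_inv \<beta> \<alpha> (tmap [emb, \<Delta>] (cls (word us)) \<cdot> cls (word xs)) =
      zigzag_inv \<beta> \<alpha> ((tmap [emb, emb_K \<circ> \<epsilon>] (cls (word us)) \<otimes> tone 2) \<cdot> cls (word xs))"
    proof (rule length_2_degreesE[OF us], rule length_3_degreesE[OF xs])
      fix u v du dv x y z dx dy dz
      assume *: "us = [u, v]" "u \<in> gr du" "v \<in> gr dv" "xs = [x, y, z]" "x \<in> gr dx" "y \<in> gr dy" "z \<in> gr dz"
      have 1: "tmap [emb, \<Delta>] (cls (word us)) = emb u \<otimes> \<Delta> v"
        "tmap [emb, emb_K \<circ> \<epsilon>] (cls (word us)) = tscale (\<epsilon> v) (emb u)"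
        by (simp_all add: * tmap_words2[OF letter_hom_emb letter_hom_coprod] tmap_words2[OF letter_hom_emb letter_hom_counit] otimes_emb_K)
      show ?thesis
        unfolding 1 using * ksign_counit[OF *(3), of "dx + dy"]
        by (auto simp: zigzag_inv_left[OF *(2) coprod_gr[OF *(3)] *(5-7)] zigzag_inv_left[OF *(2) tone_gr *(5-7)]
          alin_tscale[OF alin_zigzag_inv] antipode_alpha S_left_tone scale_mult_left scale_mult_right)
    qed
  qed
qed

lemma zigzag_inv_coprod_right:
  assumes "G \<in> tpower 2" "X \<in> tpower 3"
  shows "zigzag_inv \<beta> \<alpha> (X \<cdot> tmap [\<Delta>, emb] G) = zigzag_inv \<beta> \<alpha> (X \<cdot> (tone 2 \<otimes> tmap [emb_K \<circ> \<epsilon>, emb] G))"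
  using assms(2)
proof (rule alin_ext; (intro alin_intros)?)
  fix xs ds assume xs: "length xs = 3" "degrees xs ds"
  show "zigzag_inv \<beta> \<alpha> (cls (word xs) \<cdot> tmap [\<Delta>, emb] G) =
      zigzag_inv \<beta> \<alpha> (cls (word xs) \<cdot> (tone 2 \<otimes> tmap [emb_K \<circ> \<epsilon>, emb] G))"
    using assms(1)
  proof (rule alin_ext; (intro alin_intros tlin_tmaps)?)
    fix us es assume us: "length us = 2" "degrees us es"
    show "zigzag_inv \<beta> \<alpha> (cls (word xs) \<cdot> tmap [\<Delta>, emb] (cls (word us))) =
      zigzag_inv \<beta> \<alpha> (cls (word xs) \<cdot> (tone 2 \<otimes> tmap [emb_K \<circ> \<epsilon>, emb] (cls (word us))))"
    proof (rule length_2_degreesE[OF us], rule length_3_degreesE[OF xs])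
      fix u v du dv x y z dx dy dz
      assume *: "us = [u, v]" "u \<in> gr du" "v \<in> gr dv" "xs = [x, y, z]" "x \<in> gr dx" "y \<in> gr dy" "z \<in> gr dz"
      have 1: "tmap [\<Delta>, emb] (cls (word us)) = \<Delta> u \<otimes> emb v"
        "tmap [emb_K \<circ> \<epsilon>, emb] (cls (word us)) = tscale (\<epsilon> u) (emb v)"
        by (simp_all add: * tmap_words2[OF letter_hom_coprod letter_hom_emb] tmap_words2[OF letter_hom_counit letter_hom_emb] otimes_emb_K)
      show ?thesis
        unfolding 1 using * ksign_counit[OF *(2), of "dy + dz"]
        by (auto simp: zigzag_inv_right[OF *(3) coprod_gr[OF *(2)] *(5-7)] zigzag_inv_right[OF *(3) tone_gr *(5-7)]
          alin_tscale[OF alin_zigzag_inv] antipode_beta S_right_tone scale_mult_left scale_mult_right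
          ksign_commute[of _ du])
    qed
  qed
qed

lemma zigzag_coprod_left:
  assumes "G \<in> tpower 2" "X \<in> tpower 3"
  shows "zigzag \<alpha> \<beta> (tmap [\<Delta>, emb] G \<cdot> X) = zigzag \<alpha> \<beta> ((tone 2 \<otimes> tmap [emb_K \<circ> \<epsilon>, emb] G) \<cdot> X)"
  using assms(2)
proof (rule alin_ext; (intro alin_intros)?)
  fix xs ds assume xs: "length xs = 3" "degrees xs ds"
  show "zigzag \<alpha> \<beta> (tmap [\<Delta>, emb] G \<cdot> cls (word xs)) =
      zigzag \<alpha> \<beta> ((tone 2 \<otimes> tmap [emb_K \<circ> \<epsilon>, emb] G) \<cdot> cls (word xs))"
    using assms(1)
  proof (rule alin_ext; (intro alin_intros tlin_tmaps)?)
    fix us es assume us: "length us = 2" "degrees us es"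
    show "zigzag \<alpha> \<beta> (tmap [\<Delta>, emb] (cls (word us)) \<cdot> cls (word xs)) =
      zigzag \<alpha> \<beta> ((tone 2 \<otimes> tmap [emb_K \<circ> \<epsilon>, emb] (cls (word us))) \<cdot> cls (word xs))"
    proof (rule length_2_degreesE[OF us], rule length_3_degreesE[OF xs])
      fix u v du dv x y z dx dy dz
      assume *: "us = [u, v]" "u \<in> gr du" "v \<in> gr dv" "xs = [x, y, z]" "x \<in> gr dx" "y \<in> gr dy" "z \<in> gr dz"
      have 1: "tmap [\<Delta>, emb] (cls (word us)) = \<Delta> u \<otimes> emb v"
        "tmap [emb_K \<circ> \<epsilon>, emb] (cls (word us)) = tscale (\<epsilon> u) (emb v)"
        by (simp_all add: * tmap_words2[OF letter_hom_coprod letter_hom_emb] tmap_words2[OF letter_hom_counit letter_hom_emb] otimes_emb_K)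
      show ?thesis
        unfolding 1 using * ksign_counit[OF *(2), of dx]
        by (auto simp: zigzag_left[OF *(3) coprod_gr[OF *(2)] *(5-7)] zigzag_left[OF *(3) tone_gr *(5-7)]
          alin_tscale[OF alin_zigzag] antipode_alpha S_left_tone scale_mult_left scale_mult_right)
    qed
  qed
qed

lemma zigzag_coprod_right:
  assumes "G \<in> tpower 2" "X \<in> tpower 3"
  shows "zigzag \<alpha> \<beta> (X \<cdot> tmap [emb, \<Delta>] G) = zigzag \<alpha> \<beta> (X \<cdot> (tmap [emb, emb_K \<circ> \<epsilon>] G \<otimes> tone 2))"
  using assms(2)
proof (rule alin_ext; (intro alin_intros)?)
  fix xs ds assume xs: "length xs = 3" "degrees xs ds"
  show "zigzag \<alpha> \<beta> (cls (word xs) \<cdot> tmap [emb, \<Delta>] G) =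
      zigzag \<alpha> \<beta> (cls (word xs) \<cdot> (tmap [emb, emb_K \<circ> \<epsilon>] G \<otimes> tone 2))"
    using assms(1)
  proof (rule alin_ext; (intro alin_intros tlin_tmaps)?)
    fix us es assume us: "length us = 2" "degrees us es"
    show "zigzag \<alpha> \<beta> (cls (word xs) \<cdot> tmap [emb, \<Delta>] (cls (word us))) =
      zigzag \<alpha> \<beta> (cls (word xs) \<cdot> (tmap [emb, emb_K \<circ> \<epsilon>] (cls (word us)) \<otimes> tone 2))"
    proof (rule length_2_degreesE[OF us], rule length_3_degreesE[OF xs])
      fix u v du dv x y z dx dy dz
      assume *: "us = [u, v]" "u \<in> gr du" "v \<in> gr dv" "xs = [x, y, z]" "x \<in> gr dx" "y \<in> gr dy" "z \<in> gr dz"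
      have 1: "tmap [emb, \<Delta>] (cls (word us)) = emb u \<otimes> \<Delta> v"
        "tmap [emb, emb_K \<circ> \<epsilon>] (cls (word us)) = tscale (\<epsilon> v) (emb u)"
        by (simp_all add: * tmap_words2[OF letter_hom_emb letter_hom_coprod] tmap_words2[OF letter_hom_emb letter_hom_counit] otimes_emb_K)
      show ?thesis
        unfolding 1 using * ksign_counit[OF *(3), of dz]
        by (auto simp: zigzag_right[OF *(2) coprod_gr[OF *(3)] *(5-7)] zigzag_right[OF *(2) tone_gr *(5-7)]
          alin_tscale[OF alin_zigzag] antipode_beta S_right_tone scale_mult_left scale_mult_right  mult.commute)
    qed
  qed
qed

end

section \<open>Twisting the quasi-bialgebra\<close>

locale twisted_quasi_bialgebra = graded_quasi_bialgebra scale gr \<Delta> \<epsilon> \<Phi>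
  for scale :: "'k::field \<Rightarrow> 'a::ring_1 \<Rightarrow> 'a" (infixr "*s" 75) and gr \<Delta> \<epsilon> \<Phi> +
  fixes F :: "('k, 'a) formal set"
  assumes F_invertible: "tensor_invertible 2 F"
    and F_homogeneous: "tensor_homogeneous 2 F"
    and F_counit_left: "tmap [emb_K \<circ> \<epsilon>, emb] F = tone 1"
    and F_counit_right: "tmap [emb, emb_K \<circ> \<epsilon>] F = tone 1"
begin

abbreviation "F_inv \<equiv> tinv 2 F"
abbreviation "\<Delta>\<^sub>F \<equiv> twist_coprod \<Delta> F"
abbreviation "\<Phi>\<^sub>F \<equiv> twist_associator \<Delta> F \<Phi>"

lemma F_tinv: "is_tinv 2 F F_inv"
  by (rule is_tinv_tinv[OF F_invertible])

text \<open>Conjugation and multiplication by \<open>F\<close> cause no signs; all later computations rest on this.\<close>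

lemma F_even: "F \<in> tpower_gr 2 0" "F_inv \<in> tpower_gr 2 0"
proof -
  obtain d where "F \<in> tpower_gr 2 d"
    using F_homogeneous by (auto simp: tensor_homogeneous_def)
  from homogeneous_even[OF tensor_homs(6) this F_counit_left] show "F \<in> tpower_gr 2 0" by simp
  then show "F_inv \<in> tpower_gr 2 0" by (rule is_tinv_even[OF F_tinv])
qed

lemma F_tpower: "F \<in> tpower 2" "F_inv \<in> tpower 2"
  using F_even by (simp_all add: tpower_gr_subset)

lemma F_inv_counit: "tmap [emb_K \<circ> \<epsilon>, emb] F_inv = tone 1" "tmap [emb, emb_K \<circ> \<epsilon>] F_inv = tone 1"
proof -
  have one: "is_tinv 1 (tone 1) (tone 1)"
    using tone_gr[THEN tpower_gr_subset] by (simp add: is_tinv_def)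
  show "tmap [emb_K \<circ> \<epsilon>, emb] F_inv = tone 1"
    using tensor_hom_is_tinv[OF tensor_homs(6) F_tinv] one
    unfolding F_counit_left by (rule is_tinv_unique)
  show "tmap [emb, emb_K \<circ> \<epsilon>] F_inv = tone 1"
    using tensor_hom_is_tinv[OF tensor_homs(7) F_tinv] one
    unfolding F_counit_right by (rule is_tinv_unique)
qed

lemma F_legs:
  "is_tinv 3 (F \<otimes> emb 1) (F_inv \<otimes> emb 1)" "is_tinv 3 (emb 1 \<otimes> F) (emb 1 \<otimes> F_inv)"
  "is_tinv 3 (tmap [\<Delta>, emb] F) (tmap [\<Delta>, emb] F_inv)"
  "is_tinv 3 (tmap [emb, \<Delta>] F) (tmap [emb, \<Delta>] F_inv)"
  by (rule tensor_hom_is_tinv[OF tensor_hom_otimes_1(1) F_tinv]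
      tensor_hom_is_tinv[OF tensor_hom_otimes_1(2) F_tinv]
      tensor_hom_is_tinv[OF tensor_homs(1) F_tinv] tensor_hom_is_tinv[OF tensor_homs(2) F_tinv]; simp)+

lemmas F_legs_tpower = F_legs[THEN is_tinv_tpower(1)] F_legs[THEN is_tinv_tpower(2)]
  associator_tinv[THEN is_tinv_tpower(1)] associator_tinv[THEN is_tinv_tpower(2)]

lemma twisted_associator_tinv:
  "is_tinv 3 \<Phi>\<^sub>F ((emb 1 \<otimes> F) \<cdot> (tmap [emb, \<Delta>] F \<cdot> (tinv 3 \<Phi> \<cdot>
     (tmap [\<Delta>, emb] F_inv \<cdot> (F_inv \<otimes> emb 1)))))"
  unfolding twist_associator_def
  by (intro is_tinv_tmult F_legs F_legs[THEN is_tinv_sym] associator_tinv)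

lemma tinv_twisted_associator:
  "tinv 3 \<Phi>\<^sub>F = (emb 1 \<otimes> F) \<cdot> (tmap [emb, \<Delta>] F \<cdot> (tinv 3 \<Phi> \<cdot>
     (tmap [\<Delta>, emb] F_inv \<cdot> (F_inv \<otimes> emb 1))))"
  by (rule tinv_eqI[OF twisted_associator_tinv])

lemma twisted_associator_even: "\<Phi>\<^sub>F \<in> tpower_gr 3 0"
  unfolding twist_associator_def
  by (intro tmult_even associator_even
      tensor_homD(2)[OF tensor_homs(1) F_even(1)] tensor_homD(2)[OF tensor_homs(2) F_even(2)]
      tensor_homD(2)[OF tensor_hom_otimes_1(1) F_even(1)]
      tensor_homD(2)[OF tensor_hom_otimes_1(2) F_even(2)]) simp_all

lemma letter_hom_twist: "letter_hom 2 \<Delta>\<^sub>F"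
  unfolding letter_hom_def
proof (intro conjI allI ballI)
  have r: "\<Delta> x \<in> range cls" for x using coprod_tpower tpower_range by blast
  show "\<Delta>\<^sub>F (x + y) = tadd (\<Delta>\<^sub>F x) (\<Delta>\<^sub>F y)" for x y
    by (simp add: twist_coprod_def coprod_add tlin_tadd[OF tlin_tmult_right r r] tlin_tadd[OF tlin_tmult_left])
  show "\<Delta>\<^sub>F (c *s x) = tscale c (\<Delta>\<^sub>F x)" for c x
    by (simp add: twist_coprod_def coprod_scale r)
  show "\<Delta>\<^sub>F x \<in> tpower_gr 2 d" if "x \<in> gr d" for x d
    using tmult_gr[OF tmult_gr[OF F_even(1) coprod_gr[OF that]] F_even(2)] by (simp add: twist_coprod_def)
  show "\<Delta>\<^sub>F (x * y) = \<Delta>\<^sub>F x \<cdot> \<Delta>\<^sub>F y" for x y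
    using F_tpower coprod_tpower
    by (simp add: twist_coprod_def coprod_mult tmult_assoc is_tinv_cancel[OF F_tinv] tmult_tpower)
  show "\<Delta>\<^sub>F 1 = tone 2"
    using F_tinv F_tpower by (simp add: twist_coprod_def coprod_one is_tinv_def)
qed

text \<open>Applying \<open>\<Delta>\<^sub>F\<close> to one leg is conjugation of the result for \<open>\<Delta>\<close> by \<open>F\<close>, placed in the two new
  legs. Evenness of \<open>F\<close> lets it pass the legs on either side.\<close>

lemma tmap_twist:
  assumes fs: "list_all2 letter_hom ks fs" and gs: "list_all2 letter_hom ls gs"
    and X: "X \<in> tpower (length fs + (1 + length gs))"
  shows "tmap (fs @ \<Delta>\<^sub>F # gs) X =
    (tone (sum_list ks) \<otimes> (F \<otimes> tone (sum_list ls))) \<cdot> tmap (fs @ \<Delta> # gs) X \<cdot>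
    (tone (sum_list ks) \<otimes> (F_inv \<otimes> tone (sum_list ls)))"
proof -
  let ?k = "sum_list ks" and ?l = "sum_list ls"
  have homs: "list_all2 letter_hom (ks @ 2 # ls) (fs @ \<Delta>\<^sub>F # gs)"
    "list_all2 letter_hom (ks @ 2 # ls) (fs @ \<Delta> # gs)"
    "list_all2 letter_hom (2 # ls) (\<Delta>\<^sub>F # gs)"
    "list_all2 letter_hom (2 # ls) (\<Delta> # gs)"
    using fs gs letter_hom_twist by (simp_all add: list_all2_appendI)
  note lins = tlin_intros homs(1,2)[THEN tlin_tmap, THEN tlin_comp]
  show ?thesis
    using X
  proof (rule tpower_otimes3_ext; (intro lins)?)
    fix U V W d e f assume "U \<in> tpower_gr (length fs) d" "V \<in> tpower_gr 1 e" "W \<in> tpower_gr (length gs) f"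
    note UVW = this[THEN tpower_gr_subset]
    have U: "tmap fs U \<in> tpower ?k" and W: "tmap gs W \<in> tpower ?l"
      using tensor_homD(5)[OF tensor_hom_tmap[OF fs refl refl] UVW(1)]
        tensor_homD(5)[OF tensor_hom_tmap[OF gs refl refl] UVW(3)] by simp_all
    have split: "tmap (fs @ h # gs) (U \<otimes> (V \<otimes> W)) = tmap fs U \<otimes> (tmap [h] V \<otimes> tmap gs W)"
      if h: "letter_hom 2 h" for h
    proof -
      have "list_all2 letter_hom (2 # ls) (h # gs)" "V \<otimes> W \<in> tpower (length (h # gs))"
        using gs h otimes_tpower[OF UVW(2,3)] by simp_all
      from tmap_append[OF fs this(1) UVW(1) this(2)] tmap_append[of "[2]" "[h]" ls gs V W] gs h UVW
      show ?thesis by simp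
    qed
    have sandwich: "(tone ?k \<otimes> (P \<otimes> tone ?l)) \<cdot> (tmap fs U \<otimes> (Z \<otimes> tmap gs W)) = tmap fs U \<otimes> ((P \<cdot> Z) \<otimes> tmap gs W)"
      "(tmap fs U \<otimes> (Z \<otimes> tmap gs W)) \<cdot> (tone ?k \<otimes> (P \<otimes> tone ?l)) = tmap fs U \<otimes> ((Z \<cdot> P) \<otimes> tmap gs W)"
      if P: "P \<in> tpower_gr 2 0" and Z: "Z \<in> tpower 2" for P Z
    proof -
      note t = tone_gr[of ?k] tone_gr[of ?l] tpower_gr_subset[OF tone_gr[of ?k]] tpower_gr_subset[OF tone_gr[of ?l]]
      have P1: "P \<otimes> tone ?l \<in> tpower_gr (2 + ?l) 0" "P \<otimes> tone ?l \<in> tpower (2 + ?l)" "Z \<otimes> tmap gs W \<in> tpower (2 + ?l)"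
        using otimes_gr[OF P t(2)] otimes_tpower[OF tpower_gr_subset[OF P] t(4)] otimes_tpower[OF Z W] by simp_all
      show "(tone ?k \<otimes> (P \<otimes> tone ?l)) \<cdot> (tmap fs U \<otimes> (Z \<otimes> tmap gs W)) = tmap fs U \<otimes> ((P \<cdot> Z) \<otimes> tmap gs W)"
        using otimes_tmult_even1[OF t(3) P1(1) U P1(3)] otimes_tmult_even1[OF tpower_gr_subset[OF P] t(2) Z W] U W
        by simp
      show "(tmap fs U \<otimes> (Z \<otimes> tmap gs W)) \<cdot> (tone ?k \<otimes> (P \<otimes> tone ?l)) = tmap fs U \<otimes> ((Z \<cdot> P) \<otimes> tmap gs W)"
        using otimes_tmult_even2[OF U P1(3) t(1) P1(2)] otimes_tmult_even2[OF Z W P t(4)] U W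
        by simp
    qed
    have "tmap [\<Delta>\<^sub>F] V = F \<cdot> tmap [\<Delta>] V \<cdot> F_inv"
      using UVW(2) tlin_tmap[of "[2]" "[\<Delta>\<^sub>F]"] tlin_comp[OF tlin_comp[OF tlin_tmult_left tlin_tmult_right] tlin_tmap[of "[2]" "[\<Delta>]"]]
    proof (rule tpower_ext)
      fix xs ds assume "length xs = 1" "degrees xs ds"
      then obtain x where "cls (word xs) = emb x" by (auto simp: length_Suc_conv emb_def)
      then show "tmap [\<Delta>\<^sub>F] (cls (word xs)) = F \<cdot> tmap [\<Delta>] (cls (word xs)) \<cdot> F_inv"
        by (simp add: tmap_single[OF letter_hom_twist] tmap_single[OF letter_hom_coprod]) (simp add: twist_coprod_def)
    qed (use letter_hom_twist in simp_all)
    moreover have "tmap [\<Delta>] V \<in> tpower 2"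
      using tensor_homD(5)[OF tensor_hom_tmap[of "[2]" "[\<Delta>]"] UVW(2)] by simp
    moreover have "F \<cdot> tmap [\<Delta>] V \<in> tpower 2"
      using calculation(2) by (intro tmult_tpower F_tpower)
    ultimately show "tmap (fs @ \<Delta>\<^sub>F # gs) (U \<otimes> (V \<otimes> W)) =
      (tone ?k \<otimes> (F \<otimes> tone ?l)) \<cdot> tmap (fs @ \<Delta> # gs) (U \<otimes> (V \<otimes> W)) \<cdot> (tone ?k \<otimes> (F_inv \<otimes> tone ?l))"
      by (simp add: split[OF letter_hom_twist] split[OF letter_hom_coprod] sandwich F_even)
  qed
qed

lemma F_otimes_tone_0: "F \<otimes> tone 0 = F" "F_inv \<otimes> tone 0 = F_inv"
  "tone 0 \<otimes> (F \<otimes> X) = F \<otimes> X" "tone 0 \<otimes> (F_inv \<otimes> X) = F_inv \<otimes> X"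
  using F_tpower[THEN tpower_range] by (simp_all add: tone_0)

lemma tmap2_twist:
  assumes "X \<in> tpower 2"
  shows "tmap [\<Delta>\<^sub>F, emb] X = (F \<otimes> emb 1) \<cdot> (tmap [\<Delta>, emb] X \<cdot> (F_inv \<otimes> emb 1))"
    "tmap [emb, \<Delta>\<^sub>F] X = (emb 1 \<otimes> F) \<cdot> (tmap [emb, \<Delta>] X \<cdot> (emb 1 \<otimes> F_inv))"
  using tmap_twist[of "[]" "[]" "[1]" "[emb]" X] tmap_twist[of "[1]" "[emb]" "[]" "[]" X]
    assms assms[unfolded numeral_2_eq_2]
  by (simp_all add: F_otimes_tone_0 tone_1 tmult_assoc)

lemma tmap3_twist:
  assumes "X \<in> tpower 3"
  shows "tmap [\<Delta>\<^sub>F, emb, emb] X = (F \<otimes> tone 2) \<cdot> (tmap [\<Delta>, emb, emb] X \<cdot> (F_inv \<otimes> tone 2))"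
    "tmap [emb, \<Delta>\<^sub>F, emb] X = (emb 1 \<otimes> (F \<otimes> emb 1)) \<cdot> (tmap [emb, \<Delta>, emb] X \<cdot> (emb 1 \<otimes> (F_inv \<otimes> emb 1)))"
    "tmap [emb, emb, \<Delta>\<^sub>F] X = (tone 2 \<otimes> F) \<cdot> (tmap [emb, emb, \<Delta>] X \<cdot> (tone 2 \<otimes> F_inv))"
  using tmap_twist[of "[]" "[]" "[1, 1]" "[emb, emb]" X] tmap_twist[of "[1]" "[emb]" "[1]" "[emb]" X]
    tmap_twist[of "[1, 1]" "[emb, emb]" "[]" "[]" X]
    assms assms[unfolded numeral_3_eq_3]
  by (simp_all add: F_otimes_tone_0 tone_1 tmult_assoc flip: numeral_2_eq_2)

lemma twist_quasi_coassoc: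
  "tmap [emb, \<Delta>\<^sub>F] (\<Delta>\<^sub>F x) = tinv 3 \<Phi>\<^sub>F \<cdot> tmap [\<Delta>\<^sub>F, emb] (\<Delta>\<^sub>F x) \<cdot> \<Phi>\<^sub>F"
proof -
  have \<Delta>x: "F \<cdot> \<Delta> x \<cdot> F_inv \<in> tpower 2" "F \<cdot> \<Delta> x \<in> tpower 2"
    by (intro tmult_tpower F_tpower coprod_tpower)+
  note hom = tensor_homD(3)[OF tensor_homs(1)] tensor_homD(3)[OF tensor_homs(2)]
    tensor_homD(5)[OF tensor_homs(1)] tensor_homD(5)[OF tensor_homs(2)]
  show ?thesis
    unfolding tinv_twisted_associator tmap2_twist[OF letter_hom_tpower[OF letter_hom_twist]]
    unfolding twist_coprod_def twist_associator_def
    by (simp add: hom \<Delta>x F_tpower coprod_tpower tmult_assoc quasi_coassoc tmult_tpower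
        F_legs_tpower is_tinv_cancel[OF F_legs(1)] is_tinv_cancel[OF F_legs(2)] is_tinv_cancel[OF F_legs(3)]
        is_tinv_cancel[OF F_legs(4)])
qed

lemma twist_counit:
  "tmap [emb_K \<circ> \<epsilon>, emb] (\<Delta>\<^sub>F x) = emb x" "tmap [emb, emb_K \<circ> \<epsilon>] (\<Delta>\<^sub>F x) = emb x"
  using F_tpower coprod_tpower emb_tpower
  by (simp_all add: twist_coprod_def tensor_homD(3)[OF tensor_homs(6)] tensor_homD(3)[OF tensor_homs(7)]
      tmult_tpower F_counit_left F_counit_right F_inv_counit counit_left counit_right del: One_nat_def)

lemma twist_counit_associator: "tmap [emb, emb_K \<circ> \<epsilon>, emb] \<Phi>\<^sub>F = tone 2"
proof -
  have "tone 1 \<otimes> emb 1 = tone 2" "emb 1 \<otimes> tone 1 = tone 2"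
    using otimes_emb_1[of 1] by (simp_all add: numeral_2_eq_2)
  then show ?thesis
    using F_tinv F_tpower tone_gr[of 2, THEN tpower_gr_subset]
    by (simp add: twist_associator_def tensor_homD(3)[OF tensor_homs(8)] tmult_tpower F_legs_tpower
        tmap3_otimes_emb tmap3_emb_otimes F_counit_right F_inv_counit counit_coprod_13 counit_associator
        is_tinv_def del: One_nat_def)
qed

text \<open>Both sides reduce to the word \<open>?common\<close>. On the left, \<open>(\<Delta> \<otimes> \<Delta>)F\<^sup>-\<^sup>1\<close> from the first factor meets
  \<open>(\<Delta> \<otimes> \<Delta>)F\<close> from the second once \<open>F\<^sub>1\<^sub>2\<close> and \<open>F\<^sub>3\<^sub>4\<close> have been cancelled. On the right, \<open>F\<^sub>2\<^sub>3\<close> and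
  the comultiplied \<open>F\<close> next to it cancel with their inverses, and \<open>\<Phi> \<otimes> 1\<close> and \<open>1 \<otimes> \<Phi>\<close> are moved towards \<open>(1 \<otimes> \<Delta> \<otimes> 1)\<Phi>\<close>
  by quasi-coassociativity, where the pentagon of \<open>\<Phi>\<close> applies.\<close>

lemma twist_pentagon:
  "tmap [\<Delta>\<^sub>F, emb, emb] \<Phi>\<^sub>F \<cdot> tmap [emb, emb, \<Delta>\<^sub>F] \<Phi>\<^sub>F =
     (\<Phi>\<^sub>F \<otimes> emb 1) \<cdot> tmap [emb, \<Delta>\<^sub>F, emb] \<Phi>\<^sub>F \<cdot> (emb 1 \<otimes> \<Phi>\<^sub>F)"
proof -
  note r1 = tensor_hom_otimes_1(1)[of 3 4, simplified] and l1 = tensor_hom_otimes_1(2)[of 3 4, simplified]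
  have r2: "tensor_hom 2 4 (\<lambda>X. X \<otimes> tone 2)" and l2: "tensor_hom 2 4 (\<lambda>X. tone 2 \<otimes> X)"
    by (rule tensor_hom_otimes_tone_right tensor_hom_otimes_tone_left; simp)+
  have mid: "tensor_hom 2 4 (\<lambda>X. emb 1 \<otimes> (X \<otimes> emb 1))"
    by (rule tensor_hom_comp[OF tensor_hom_otimes_1(2) tensor_hom_otimes_1(1)]) simp_all
  note homs = r1 l1 tensor_homs(3-5)
  note D1 = tensor_homs(1) and D2 = tensor_homs(2)
  note invs =
    tensor_hom_is_tinv[OF r2 F_tinv] tensor_hom_is_tinv[OF l2 F_tinv] tensor_hom_is_tinv[OF mid F_tinv]
    tensor_hom_is_tinv[OF tensor_hom_comp[OF r1 D1] F_tinv] tensor_hom_is_tinv[OF tensor_hom_comp[OF r1 D2] F_tinv]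
    tensor_hom_is_tinv[OF tensor_hom_comp[OF l1 D1] F_tinv] tensor_hom_is_tinv[OF tensor_hom_comp[OF l1 D2] F_tinv]
    tensor_hom_is_tinv[OF tensor_hom_comp[OF tensor_homs(5) D1] F_tinv]
  note tp = invs[THEN is_tinv_tpower(1)] invs[THEN is_tinv_tpower(2)]
    tensor_homs(3-5)[THEN tensor_homD(5), OF F_legs_tpower(9)]
    r1[THEN tensor_homD(5), OF F_legs_tpower(9)] l1[THEN tensor_homD(5), OF F_legs_tpower(9)]
    tensor_homD(5)[OF tensor_hom_comp[OF tensor_homs(3) D1] F_tpower(1)]
    tensor_homD(5)[OF tensor_hom_comp[OF tensor_homs(4) D1] F_tpower(1)]
    tensor_homD(5)[OF tensor_hom_comp[OF tensor_homs(4) D2] F_tpower(2)]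
    tensor_homD(5)[OF tensor_hom_comp[OF tensor_homs(5) D2] F_tpower(2)]
  note cancel = is_tinv_cancel[OF invs(1)] is_tinv_cancel[OF invs(2)] is_tinv_cancel[OF invs(3)]
    is_tinv_cancel[OF invs(4)] is_tinv_cancel[OF invs(5)] is_tinv_cancel[OF invs(6)] is_tinv_cancel[OF invs(7)]
    is_tinv_cancel[OF invs(8)]
  note hom_mult = homs[THEN tensor_homD(3)]
  \<comment> \<open>\<open>F\<^sub>1\<^sub>2\<^sup>-\<^sup>1\<close> and \<open>F\<^sub>3\<^sub>4\<close> act on disjoint legs.\<close>
  have commute: "(F_inv \<otimes> tone 2) \<cdot> (tone 2 \<otimes> F) = (tone 2 \<otimes> F) \<cdot> (F_inv \<otimes> tone 2)"
    using F_tpower otimes_tmult_even1[OF F_tpower(2) tone_gr tone_gr[THEN tpower_gr_subset] F_tpower(1)]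
      otimes_tmult_even1[OF tone_gr[THEN tpower_gr_subset] F_even(1) F_tpower(2) tone_gr[THEN tpower_gr_subset]]
    by simp
  note P = twisted_associator_even[THEN tpower_gr_subset]
  have one: "emb 1 \<otimes> (emb 1 \<otimes> X) = tone 2 \<otimes> X" "X \<otimes> emb 1 \<otimes> emb 1 = X \<otimes> tone 2" for X
    using otimes_emb_1(1)[of 1] by (simp_all add: otimes_assoc tone_1 numeral_2_eq_2) (simp add: tone_1 flip: otimes_assoc)
  have L1: "tmap [\<Delta>, emb, emb] \<Phi>\<^sub>F = (tmap [\<Delta>, emb] F \<otimes> emb 1) \<cdot> (tmap [\<Delta>, emb, emb] (tmap [\<Delta>, emb] F) \<cdot>
      (tmap [\<Delta>, emb, emb] \<Phi> \<cdot> (tmap [emb, emb, \<Delta>] (tmap [\<Delta>, emb] F_inv) \<cdot> (tone 2 \<otimes> F_inv))))"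
    by (simp add: twist_associator_def hom_mult F_legs_tpower tmult_tpower tmult_assoc F_tpower
        tmap3_otimes_emb tmap3_emb_otimes coprod_one coprod_both_legs)
  have L2: "tmap [emb, emb, \<Delta>] \<Phi>\<^sub>F = (F \<otimes> tone 2) \<cdot> (tmap [emb, emb, \<Delta>] (tmap [\<Delta>, emb] F) \<cdot>
      (tmap [emb, emb, \<Delta>] \<Phi> \<cdot> (tmap [emb, emb, \<Delta>] (tmap [emb, \<Delta>] F_inv) \<cdot> (emb 1 \<otimes> tmap [emb, \<Delta>] F_inv))))"
    by (simp add: twist_associator_def hom_mult F_legs_tpower tmult_tpower tmult_assoc F_tpower
        tmap3_otimes_emb tmap3_emb_otimes coprod_one)
  have L3: "tmap [emb, \<Delta>, emb] \<Phi>\<^sub>F = (tmap [emb, \<Delta>] F \<otimes> emb 1) \<cdot> (tmap [emb, \<Delta>, emb] (tmap [\<Delta>, emb] F) \<cdot>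
      (tmap [emb, \<Delta>, emb] \<Phi> \<cdot> (tmap [emb, \<Delta>, emb] (tmap [emb, \<Delta>] F_inv) \<cdot> (emb 1 \<otimes> tmap [\<Delta>, emb] F_inv))))"
    by (simp add: twist_associator_def hom_mult F_legs_tpower tmult_tpower tmult_assoc F_tpower
        tmap3_otimes_emb tmap3_emb_otimes)
  have L4: "\<Phi>\<^sub>F \<otimes> emb 1 = (F \<otimes> tone 2) \<cdot> ((tmap [\<Delta>, emb] F \<otimes> emb 1) \<cdot> ((\<Phi> \<otimes> emb 1) \<cdot>
      ((tmap [emb, \<Delta>] F_inv \<otimes> emb 1) \<cdot> (emb 1 \<otimes> (F_inv \<otimes> emb 1)))))"
    by (simp add: twist_associator_def hom_mult F_legs_tpower tmult_tpower tmult_assoc one)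
      (simp add: otimes_assoc)
  have L5: "emb 1 \<otimes> \<Phi>\<^sub>F = (emb 1 \<otimes> (F \<otimes> emb 1)) \<cdot> ((emb 1 \<otimes> tmap [\<Delta>, emb] F) \<cdot> ((emb 1 \<otimes> \<Phi>) \<cdot>
      ((emb 1 \<otimes> tmap [emb, \<Delta>] F_inv) \<cdot> (tone 2 \<otimes> F_inv))))"
    by (simp add: twist_associator_def hom_mult F_legs_tpower tmult_tpower tmult_assoc one)
  have nested: "A \<cdot> B = C \<cdot> D \<Longrightarrow> A \<cdot> (B \<cdot> Z) = C \<cdot> (D \<cdot> Z)" for A B C D Z
    by (simp flip: tmult_assoc)
  have pentagon': "(\<Phi> \<otimes> emb 1) \<cdot> (tmap [emb, \<Delta>, emb] \<Phi> \<cdot> ((emb 1 \<otimes> \<Phi>) \<cdot> Z)) =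
      tmap [\<Delta>, emb, emb] \<Phi> \<cdot> (tmap [emb, emb, \<Delta>] \<Phi> \<cdot> Z)" for Z
    using pentagon by (simp flip: tmult_assoc)
  let ?common = "(F \<otimes> tone 2) \<cdot> ((tmap [\<Delta>, emb] F \<otimes> emb 1) \<cdot> (tmap [\<Delta>, emb, emb] (tmap [\<Delta>, emb] F) \<cdot>
      (tmap [\<Delta>, emb, emb] \<Phi> \<cdot> (tmap [emb, emb, \<Delta>] \<Phi> \<cdot> (tmap [emb, emb, \<Delta>] (tmap [emb, \<Delta>] F_inv) \<cdot>
      ((emb 1 \<otimes> tmap [emb, \<Delta>] F_inv) \<cdot> (tone 2 \<otimes> F_inv)))))))"
  have "tmap [\<Delta>\<^sub>F, emb, emb] \<Phi>\<^sub>F \<cdot> tmap [emb, emb, \<Delta>\<^sub>F] \<Phi>\<^sub>F = ?common"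
    by (simp add: tmap3_twist[OF P] L1 L2 tmult_assoc tmult_tpower tp cancel nested[OF commute])
  moreover have "(\<Phi>\<^sub>F \<otimes> emb 1) \<cdot> tmap [emb, \<Delta>\<^sub>F, emb] \<Phi>\<^sub>F \<cdot> (emb 1 \<otimes> \<Phi>\<^sub>F) = ?common"
    by (simp add: tmap3_twist[OF P] L3 L4 L5 tmult_assoc tmult_tpower tp cancel pentagon'
        nested[OF coassoc_left_leg[OF F_tpower(1)]] nested[OF coassoc_right_leg[OF F_tpower(2), symmetric]])
  ultimately show ?thesis by simp
qed

lemma twist_quasi_bialgebra: "graded_quasi_bialgebra scale gr \<Delta>\<^sub>F \<epsilon> \<Phi>\<^sub>F"
proof
  show "tensor_invertible 3 \<Phi>\<^sub>F" "tensor_homogeneous 3 \<Phi>\<^sub>F"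
    using twisted_associator_tinv twisted_associator_even
    by (auto simp: tensor_invertible_def tensor_homogeneous_def)
qed (use letter_hom_twist letter_hom_tpower[OF letter_hom_twist] in \<open>auto simp: letter_hom_def counit_add
  counit_scale counit_mult counit_one counit_odd twist_quasi_coassoc twist_pentagon twist_counit twist_counit_associator\<close>)

end

section \<open>Twisting the antipode\<close>

locale twisted_quasi_hopf_superalgebra =
  quasi_hopf_superalgebra scale gr \<Delta> \<epsilon> \<Phi> S \<alpha> \<beta> + twisted_quasi_bialgebra scale gr \<Delta> \<epsilon> \<Phi> F
  for scale :: "'k::field \<Rightarrow> 'a::ring_1 \<Rightarrow> 'a" (infixr "*s" 75) and gr \<Delta> \<epsilon> \<Phi> S \<alpha> \<beta> F
begin

abbreviation "\<alpha>\<^sub>F \<equiv> twist_alpha S \<alpha> F"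
abbreviation "\<beta>\<^sub>F \<equiv> twist_beta S \<beta> F"

lemma twist_antipode_alpha: "S_left S \<alpha>\<^sub>F (\<Delta>\<^sub>F x) = \<epsilon> x *s \<alpha>\<^sub>F"
proof -
  have \<Delta>F: "\<Delta>\<^sub>F x \<in> tpower 2" by (rule letter_hom_tpower[OF letter_hom_twist])
  have "S_left S \<alpha>\<^sub>F (\<Delta>\<^sub>F x) = S_left S \<alpha> (F_inv \<cdot> \<Delta>\<^sub>F x)"
    unfolding twist_alpha_def by (rule S_left_tmult_even[OF F_even(2) \<Delta>F, symmetric])
  also have "F_inv \<cdot> \<Delta>\<^sub>F x = \<Delta> x \<cdot> F_inv"
    by (simp add: twist_coprod_def tmult_assoc is_tinv_cancel[OF F_tinv] tmult_tpower coprod_tpower F_tpower)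
  finally show ?thesis by (simp add: S_left_coprod_tmult F_tpower twist_alpha_def)
qed

lemma twist_antipode_beta: "S_right S \<beta>\<^sub>F (\<Delta>\<^sub>F x) = \<epsilon> x *s \<beta>\<^sub>F"
proof -
  have \<Delta>F: "\<Delta>\<^sub>F x \<in> tpower 2" by (rule letter_hom_tpower[OF letter_hom_twist])
  have "F_inv \<cdot> F = tone 2" using F_tinv by (simp add: is_tinv_def)
  then have *: "\<Delta>\<^sub>F x \<cdot> F = F \<cdot> \<Delta> x"
    by (simp add: twist_coprod_def tmult_assoc coprod_tpower)
  have "S_right S \<beta>\<^sub>F (\<Delta>\<^sub>F x) = S_right S \<beta> (\<Delta>\<^sub>F x \<cdot> F)"
    unfolding twist_beta_def by (rule S_right_tmult_even[OF \<Delta>F F_even(1), symmetric])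
  then show ?thesis by (simp add: * S_right_tmult_coprod F_tpower twist_beta_def)
qed

text \<open>Passing to \<open>\<beta>\<close> and \<open>\<alpha>\<close> strips the outermost factors of \<open>\<Phi>\<^sub>F\<^sup>-\<^sup>1\<close>, and the remaining two
  factors that contain \<open>F\<close> are turned into units by the collapse of \<open>\<Delta>\<close> to \<open>\<epsilon>\<close>.\<close>

lemma twist_antipode_associator_inv: "zigzag_inv \<beta>\<^sub>F \<alpha>\<^sub>F (tinv 3 \<Phi>\<^sub>F) = 1"
proof -
  have "zigzag_inv \<beta>\<^sub>F \<alpha>\<^sub>F (tinv 3 \<Phi>\<^sub>F) =
      zigzag_inv \<beta> \<alpha> ((emb 1 \<otimes> F_inv) \<cdot> tinv 3 \<Phi>\<^sub>F \<cdot> (F \<otimes> emb 1))"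
    unfolding twist_alpha_def twist_beta_def
    by (rule zigzag_inv_twist[symmetric, OF F_even(2,1)])
      (simp add: tinv_twisted_associator tmult_tpower F_legs_tpower)
  also have "(emb 1 \<otimes> F_inv) \<cdot> tinv 3 \<Phi>\<^sub>F \<cdot> (F \<otimes> emb 1) = tmap [emb, \<Delta>] F \<cdot> (tinv 3 \<Phi> \<cdot> tmap [\<Delta>, emb] F_inv)"
    using F_legs(1)
    by (simp add: tinv_twisted_associator tmult_assoc tmult_tpower F_legs_tpower is_tinv_cancel[OF F_legs(2)] is_tinv_def)
  also have "zigzag_inv \<beta> \<alpha> \<dots> = zigzag_inv \<beta> \<alpha> (tinv 3 \<Phi> \<cdot> tmap [\<Delta>, emb] F_inv)"
    by (subst zigzag_inv_coprod_left) (simp_all add: F_tpower F_counit_right tmult_tpower F_legs_tpower del: One_nat_def)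
  also have "\<dots> = zigzag_inv \<beta> \<alpha> (tinv 3 \<Phi>)"
    by (subst zigzag_inv_coprod_right) (simp_all add: F_tpower F_inv_counit F_legs_tpower del: One_nat_def)
  finally show ?thesis using antipode_associator_inv by (simp add: zigzag_inv_def)
qed

lemma twist_antipode_associator: "zigzag \<alpha>\<^sub>F \<beta>\<^sub>F \<Phi>\<^sub>F = 1"
proof -
  have "zigzag \<alpha>\<^sub>F \<beta>\<^sub>F \<Phi>\<^sub>F = zigzag \<alpha> \<beta> ((F_inv \<otimes> emb 1) \<cdot> \<Phi>\<^sub>F \<cdot> (emb 1 \<otimes> F))"
    unfolding twist_alpha_def twist_beta_def
    by (rule zigzag_twist[symmetric, OF F_even(2,1)])
      (simp add: twist_associator_def tmult_tpower F_legs_tpower)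
  also have "(F_inv \<otimes> emb 1) \<cdot> \<Phi>\<^sub>F \<cdot> (emb 1 \<otimes> F) = tmap [\<Delta>, emb] F \<cdot> (\<Phi> \<cdot> tmap [emb, \<Delta>] F_inv)"
    using F_legs(2)
    by (simp add: twist_associator_def tmult_assoc tmult_tpower F_legs_tpower is_tinv_cancel[OF F_legs(1)] is_tinv_def)
  also have "zigzag \<alpha> \<beta> \<dots> = zigzag \<alpha> \<beta> (\<Phi> \<cdot> tmap [emb, \<Delta>] F_inv)"
    by (subst zigzag_coprod_left) (simp_all add: F_tpower F_counit_left tmult_tpower F_legs_tpower del: One_nat_def)
  also have "\<dots> = zigzag \<alpha> \<beta> \<Phi>"
    by (subst zigzag_coprod_right) (simp_all add: F_tpower F_inv_counit F_legs_tpower del: One_nat_def)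
  finally show ?thesis using antipode_associator by (simp add: zigzag_def)
qed

lemma twist_quasi_hopf: "quasi_hopf_superalgebra scale gr \<Delta>\<^sub>F \<epsilon> \<Phi>\<^sub>F S \<alpha>\<^sub>F \<beta>\<^sub>F"
proof (intro quasi_hopf_superalgebra.intro twist_quasi_bialgebra quasi_hopf_superalgebra_axioms.intro)
  show "\<alpha>\<^sub>F \<in> gr 0" "\<beta>\<^sub>F \<in> gr 0"
    unfolding twist_alpha_def twist_beta_def
    using S_left_gr[OF F_even(2) alpha_even] S_right_gr[OF F_even(1) beta_even] by simp_all
qed (use antipode_add antipode_scale antipode_one antipode_gr antipode_mult twist_antipode_alpha twist_antipode_beta
    twist_antipode_associator_inv twist_antipode_associator in \<open>auto simp: zigzag_def zigzag_inv_def\<close>)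

end

section \<open>Twisting the R-matrix\<close>

context quasitriangular_quasi_hopf_superalgebra
begin

lemma R_tinv: "is_tinv 2 R (tinv 2 R)"
  by (rule is_tinv_tinv[OF R_invertible])

text \<open>By the first hexagon the degree of \<open>(\<Delta> \<otimes> 1)\<R>\<close> is twice that of \<open>\<R>\<close>, hence even; applying
  \<open>\<epsilon> \<otimes> 1 \<otimes> 1\<close> recovers \<open>\<R>\<close> and preserves the degree.\<close>

lemma R_even: "R \<in> tpower_gr 2 0"
proof -
  obtain d where R: "R \<in> tpower_gr 2 d"
    using R_homogeneous by (auto simp: tensor_homogeneous_def)
  note g0 = tensor_hom_gtwist_3(1) and g1 = tensor_hom_gtwist_3(2)
  have inv: "tinv 3 (gtwist 1 (gtwist 0 \<Phi>)) = gtwist 1 (gtwist 0 (tinv 3 \<Phi>))"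
    by (rule tinv_eqI[OF tensor_hom_is_tinv[OF tensor_hom_comp[OF g1 g0] associator_tinv]]) 
  have "tmap [\<Delta>, emb] R \<in> tpower_gr 3 (0 + d + 0 + d + 0)"
    unfolding hexagon_left inv
    using tensor_homD(2)[OF g1 tensor_homD(2)[OF tensor_hom_otimes_1(1) R]] 
      tensor_homD(2)[OF tensor_hom_otimes_1(2) R] tensor_homD(2)[OF g1 associator_even(1)]
      tensor_homD(2)[OF g1 tensor_homD(2)[OF g0 associator_even(2)]]
    by (intro tmult_gr associator_even) simp_all
  then have "tmap [\<Delta>, emb] R \<in> tpower_gr 3 0"
    by (simp add: add.commute)
  from tensor_homD(2)[OF tensor_homs(9) this] show ?thesis
    using R[THEN tpower_gr_subset] by (simp add: counit_coprod_13)
qed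

text \<open>The intertwining property of \<open>\<R>\<close> in two of three legs; \<open>\<R>\<close> passes the third leg without a
  sign because it is even.\<close>

lemma R_legs:
  assumes "X \<in> tpower 2"
  shows "(R \<otimes> emb 1) \<cdot> tmap [\<Delta>, emb] X = gtwist 0 (tmap [\<Delta>, emb] X) \<cdot> (R \<otimes> emb 1)"
    and "(emb 1 \<otimes> R) \<cdot> tmap [emb, \<Delta>] X = gtwist 1 (tmap [emb, \<Delta>] X) \<cdot> (emb 1 \<otimes> R)"
proof -
  note R = R_even tpower_gr_subset[OF R_even]
  have T: "gtwist 0 (\<Delta> x) \<in> tpower 2" for x
    by (rule tensor_homD(5)[OF tensor_hom_gtwist_2 coprod_tpower])
  have g0: "gtwist 0 (\<Delta> x \<otimes> emb y) = gtwist 0 (\<Delta> x) \<otimes> emb y" for x y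
    by (rule gtwist_otimes_right[OF coprod_tpower emb_tpower]) simp
  have g1: "gtwist 1 (emb x \<otimes> \<Delta> y) = emb x \<otimes> gtwist 0 (\<Delta> y)" for x y
    using gtwist_otimes_left[OF emb_tpower coprod_tpower, of 0] by simp
  show "(R \<otimes> emb 1) \<cdot> tmap [\<Delta>, emb] X = gtwist 0 (tmap [\<Delta>, emb] X) \<cdot> (R \<otimes> emb 1)"
    using assms
  proof (rule tpower_2_ext; (intro tlin_homs)?)
    fix x y
    show "(R \<otimes> emb 1) \<cdot> tmap [\<Delta>, emb] (emb x \<otimes> emb y) =
        gtwist 0 (tmap [\<Delta>, emb] (emb x \<otimes> emb y)) \<cdot> (R \<otimes> emb 1)"
      using otimes_tmult_even1[OF R(2) emb_gr[OF gr_one] coprod_tpower emb_tpower[of y]]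
        otimes_tmult_even2[OF T emb_tpower[of y] R(1) emb_tpower[of 1]]
      by (simp add: tmap2_emb g0 R_intertwines flip: emb_mult)
  qed
  show "(emb 1 \<otimes> R) \<cdot> tmap [emb, \<Delta>] X = gtwist 1 (tmap [emb, \<Delta>] X) \<cdot> (emb 1 \<otimes> R)"
    using assms
  proof (rule tpower_2_ext; (intro tlin_homs)?)
    fix x y
    show "(emb 1 \<otimes> R) \<cdot> tmap [emb, \<Delta>] (emb x \<otimes> emb y) =
        gtwist 1 (tmap [emb, \<Delta>] (emb x \<otimes> emb y)) \<cdot> (emb 1 \<otimes> R)"
      using otimes_tmult_even1[OF emb_tpower[of 1] R(1) emb_tpower[of x] coprod_tpower]
        otimes_tmult_even2[OF emb_tpower[of x] T emb_gr[OF gr_one] R(2)]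
      by (simp add: tmap2_emb g1 R_intertwines del: One_nat_def flip: emb_mult)
  qed
qed

end

locale twisted_quasitriangular_quasi_hopf_superalgebra =
  quasitriangular_quasi_hopf_superalgebra scale gr \<Delta> \<epsilon> \<Phi> S \<alpha> \<beta> R +
  twisted_quasi_hopf_superalgebra scale gr \<Delta> \<epsilon> \<Phi> S \<alpha> \<beta> F
  for scale :: "'k::field \<Rightarrow> 'a::ring_1 \<Rightarrow> 'a" (infixr "*s" 75) and gr \<Delta> \<epsilon> \<Phi> S \<alpha> \<beta> R F
begin

abbreviation "R\<^sub>F \<equiv> twist_R F R"

lemmas gtwist_0_hom = tensor_hom_gtwist_3(1) and gtwist_1_hom = tensor_hom_gtwist_3(2)

lemma F_flip_tinv: "is_tinv 2 (gtwist 0 F) (gtwist 0 F_inv)"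
  by (rule tensor_hom_is_tinv[OF tensor_hom_gtwist_2 F_tinv])

lemma F_flip_tpower: "gtwist 0 F \<in> tpower 2" "gtwist 0 F_inv \<in> tpower 2"
  using F_flip_tinv by (simp_all add: is_tinv_def)

lemma gtwist_legs:
  assumes "X \<in> tpower_gr 2 0"
  shows "gtwist 0 (X \<otimes> emb 1) = gtwist 0 X \<otimes> emb 1" "gtwist 1 (emb 1 \<otimes> X) = emb 1 \<otimes> gtwist 0 X"
    "gtwist 1 (gtwist 0 (emb 1 \<otimes> X)) = X \<otimes> emb 1" "gtwist 0 (gtwist 1 (X \<otimes> emb 1)) = emb 1 \<otimes> X"
proof -
  note X = tpower_gr_subset[OF assms]
  show "gtwist 0 (X \<otimes> emb 1) = gtwist 0 X \<otimes> emb 1"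
    by (rule gtwist_otimes_right[OF X emb_tpower]) simp
  show "gtwist 1 (emb 1 \<otimes> X) = emb 1 \<otimes> gtwist 0 X"
    using gtwist_otimes_left[OF emb_tpower X, of 0] by simp
  show "gtwist 1 (gtwist 0 (emb 1 \<otimes> X)) = X \<otimes> emb 1" "gtwist 0 (gtwist 1 (X \<otimes> emb 1)) = emb 1 \<otimes> X"
    using gtwist_cycle_left[OF gr_one assms] gtwist_cycle_right[OF gr_one assms] by (simp_all add: tscale_1)
qed

lemma twist_R_intertwines: "gtwist 0 (\<Delta>\<^sub>F x) \<cdot> R\<^sub>F = R\<^sub>F \<cdot> \<Delta>\<^sub>F x"
proof -
  note t = tensor_homD(3)[OF tensor_hom_gtwist_2] tensor_homD(5)[OF tensor_hom_gtwist_2]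
  have "gtwist 0 (\<Delta> x) \<cdot> (R \<cdot> Z) = R \<cdot> (\<Delta> x \<cdot> Z)" for Z
    using R_intertwines[of x] by (simp flip: tmult_assoc)
  then show ?thesis
    by (simp add: twist_R_def twist_coprod_def t F_tpower coprod_tpower tmult_tpower tmult_assoc
        tpower_gr_subset[OF R_even] is_tinv_cancel[OF F_tinv] is_tinv_cancel[OF F_flip_tinv])
qed

lemma leg_homs:
  "tensor_hom 2 3 (\<lambda>X. X \<otimes> emb 1)" "tensor_hom 2 3 (\<lambda>X. emb 1 \<otimes> X)"
  "tensor_hom 2 3 (\<lambda>X. gtwist 1 (X \<otimes> emb 1))"
  using tensor_hom_comp[OF gtwist_1_hom tensor_hom_otimes_1(1)[of 2 3]]
  by (simp_all add: tensor_hom_otimes_1 del: One_nat_def)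

lemma flipped_legs:
  "is_tinv 3 (gtwist 0 F \<otimes> emb 1) (gtwist 0 F_inv \<otimes> emb 1)"
  "is_tinv 3 (emb 1 \<otimes> gtwist 0 F) (emb 1 \<otimes> gtwist 0 F_inv)"
  "is_tinv 3 (gtwist 1 (gtwist 0 F \<otimes> emb 1)) (gtwist 1 (gtwist 0 F_inv \<otimes> emb 1))"
  "is_tinv 3 (gtwist 1 (F \<otimes> emb 1)) (gtwist 1 (F_inv \<otimes> emb 1))"
  "is_tinv 3 (gtwist 0 (tmap [\<Delta>, emb] F)) (gtwist 0 (tmap [\<Delta>, emb] F_inv))"
  "is_tinv 3 (gtwist 1 (tmap [emb, \<Delta>] F)) (gtwist 1 (tmap [emb, \<Delta>] F_inv))"
  "is_tinv 3 (gtwist 1 (gtwist 0 (tmap [\<Delta>, emb] F))) (gtwist 1 (gtwist 0 (tmap [\<Delta>, emb] F_inv)))"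
  "is_tinv 3 (gtwist 0 (gtwist 1 (tmap [emb, \<Delta>] F))) (gtwist 0 (gtwist 1 (tmap [emb, \<Delta>] F_inv)))"
  using leg_homs(1-3)[THEN tensor_hom_is_tinv, OF F_flip_tinv] tensor_hom_is_tinv[OF leg_homs(3) F_tinv]
    tensor_hom_is_tinv[OF gtwist_0_hom F_legs(3)] tensor_hom_is_tinv[OF gtwist_1_hom F_legs(4)]
    tensor_hom_is_tinv[OF tensor_hom_comp[OF gtwist_1_hom gtwist_0_hom] F_legs(3)]
    tensor_hom_is_tinv[OF tensor_hom_comp[OF gtwist_0_hom gtwist_1_hom] F_legs(4)]
  by simp_all

lemmas flipped_legs_tpower = flipped_legs[THEN is_tinv_tpower(1)] flipped_legs[THEN is_tinv_tpower(2)]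

lemmas legs_cancel =
  is_tinv_cancel[OF F_legs(1)] is_tinv_cancel[OF F_legs(2)] is_tinv_cancel[OF F_legs(3)] is_tinv_cancel[OF F_legs(4)]
  is_tinv_cancel[OF flipped_legs(1)] is_tinv_cancel[OF flipped_legs(2)] is_tinv_cancel[OF flipped_legs(3)]
  is_tinv_cancel[OF flipped_legs(4)] is_tinv_cancel[OF flipped_legs(5)] is_tinv_cancel[OF flipped_legs(6)]
  is_tinv_cancel[OF flipped_legs(7)] is_tinv_cancel[OF flipped_legs(8)]

lemma R_tpower: "R \<in> tpower 2"
  by (rule tpower_gr_subset[OF R_even])

lemma legtwist_tpower:
  "R \<otimes> emb 1 \<in> tpower 3" "emb 1 \<otimes> R \<in> tpower 3" "gtwist 1 (R \<otimes> emb 1) \<in> tpower 3"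
  "tmap [\<Delta>, emb] (gtwist 0 F) \<in> tpower 3" "tmap [emb, \<Delta>] (gtwist 0 F) \<in> tpower 3"
  using leg_homs[THEN tensor_homD(5), OF R_tpower] tensor_homs(1,2)[THEN tensor_homD(5), OF F_flip_tpower(1)]
  by auto

lemma gtwist_tpower: "X \<in> tpower 3 \<Longrightarrow> gtwist 0 X \<in> tpower 3" "X \<in> tpower 3 \<Longrightarrow> gtwist 1 X \<in> tpower 3"
  by (rule tensor_homD(5)[OF gtwist_0_hom] tensor_homD(5)[OF gtwist_1_hom]; assumption)+

lemma twisted_R_legs:
  "R\<^sub>F \<otimes> emb 1 = (gtwist 0 F \<otimes> emb 1) \<cdot> ((R \<otimes> emb 1) \<cdot> (F_inv \<otimes> emb 1))"
  "emb 1 \<otimes> R\<^sub>F = (emb 1 \<otimes> gtwist 0 F) \<cdot> ((emb 1 \<otimes> R) \<cdot> (emb 1 \<otimes> F_inv))"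
  "gtwist 1 (R\<^sub>F \<otimes> emb 1) =
     gtwist 1 (gtwist 0 F \<otimes> emb 1) \<cdot> (gtwist 1 (R \<otimes> emb 1) \<cdot> gtwist 1 (F_inv \<otimes> emb 1))"
  using F_tpower F_flip_tpower R_tpower
  by (simp_all add: twist_R_def leg_homs[THEN tensor_homD(3)] tmult_tpower tmult_assoc tensor_homD(3)[OF gtwist_1_hom]
      leg_homs(1)[THEN tensor_homD(5)] del: One_nat_def)

text \<open>Both identities are images of \<open>R_legs\<close> under a twist that moves \<open>\<R>\<^sub>1\<^sub>2\<close>, respectively
  \<open>\<R>\<^sub>2\<^sub>3\<close>, to \<open>\<R>\<^sub>1\<^sub>3\<close>.\<close>

lemma R13_leg:
  "gtwist 1 (R \<otimes> emb 1) \<cdot> gtwist 1 (tmap [\<Delta>, emb] F) =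
     gtwist 1 (gtwist 0 (tmap [\<Delta>, emb] F)) \<cdot> gtwist 1 (R \<otimes> emb 1)"
  "gtwist 1 (R \<otimes> emb 1) \<cdot> gtwist 0 (tmap [emb, \<Delta>] F) =
     gtwist 0 (gtwist 1 (tmap [emb, \<Delta>] F)) \<cdot> gtwist 1 (R \<otimes> emb 1)"
proof -
  note t = legtwist_tpower F_legs_tpower gtwist_tpower
  show "gtwist 1 (R \<otimes> emb 1) \<cdot> gtwist 1 (tmap [\<Delta>, emb] F) =
     gtwist 1 (gtwist 0 (tmap [\<Delta>, emb] F)) \<cdot> gtwist 1 (R \<otimes> emb 1)"
    using R_legs(1)[OF F_tpower(1)] t by (simp flip: tensor_homD(3)[OF gtwist_1_hom] del: One_nat_def)
  show "gtwist 1 (R \<otimes> emb 1) \<cdot> gtwist 0 (tmap [emb, \<Delta>] F) =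
     gtwist 0 (gtwist 1 (tmap [emb, \<Delta>] F)) \<cdot> gtwist 1 (R \<otimes> emb 1)"
    unfolding gtwist_13[OF R_tpower, symmetric]
    using R_legs(2)[OF F_tpower(1)] t by (simp flip: tensor_homD(3)[OF gtwist_0_hom] del: One_nat_def)
qed

lemma tmult_nested: "A \<cdot> B = C \<cdot> D \<Longrightarrow> A \<cdot> (B \<cdot> Z) = C \<cdot> (D \<cdot> Z)"
  by (simp flip: tmult_assoc)

lemmas leg_simps = tmult_assoc tmult_tpower legtwist_tpower F_legs_tpower flipped_legs_tpower gtwist_tpower
  tensor_homD(3)[OF gtwist_0_hom] tensor_homD(3)[OF gtwist_1_hom] gtwist_legs[OF F_even(1)] gtwist_legs[OF F_even(2)]

text \<open>Between consecutive factors on the right the outermost twists cancel. What remains between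
  \<open>\<Phi>\<^sub>2\<^sub>3\<^sub>1\<^sup>-\<^sup>1\<close>, \<open>\<Phi>\<^sub>1\<^sub>3\<^sub>2\<close> and \<open>\<Phi>\<^sup>-\<^sup>1\<close> are \<open>\<R>\<^sub>1\<^sub>3\<close> and \<open>\<R>\<^sub>2\<^sub>3\<close>, each conjugated by a comultiplied \<open>F\<close> and its
  twisted form, and these conjugations are trivial by \<open>R13_leg\<close> and \<open>R_legs\<close>.\<close>

lemma twist_hexagon_left:
  "tmap [\<Delta>\<^sub>F, emb] R\<^sub>F =
     tinv 3 (gtwist 1 (gtwist 0 \<Phi>\<^sub>F)) \<cdot> gtwist 1 (R\<^sub>F \<otimes> emb 1) \<cdot> gtwist 1 \<Phi>\<^sub>F \<cdot> (emb 1 \<otimes> R\<^sub>F) \<cdot> tinv 3 \<Phi>\<^sub>F"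
proof -
  have inv: "tinv 3 (gtwist 1 (gtwist 0 X)) = gtwist 1 (gtwist 0 Y)" if "is_tinv 3 X Y" for X Y
    by (rule tinv_eqI[OF tensor_hom_is_tinv[OF tensor_hom_comp[OF gtwist_1_hom gtwist_0_hom] that]])
  have L: "tmap [\<Delta>\<^sub>F, emb] R\<^sub>F = (F \<otimes> emb 1) \<cdot> (tmap [\<Delta>, emb] (gtwist 0 F) \<cdot> (tmap [\<Delta>, emb] R \<cdot>
      (tmap [\<Delta>, emb] F_inv \<cdot> (F_inv \<otimes> emb 1))))"
    using F_tpower F_flip_tpower R_tpower
    by (simp add: tmap2_twist twist_R_def tmult_tpower tmult_assoc tensor_homD(3)[OF tensor_homs(1)])
  have \<Phi>231: "tinv 3 (gtwist 1 (gtwist 0 \<Phi>\<^sub>F)) = (F \<otimes> emb 1) \<cdot> (tmap [\<Delta>, emb] (gtwist 0 F) \<cdot>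
      (gtwist 1 (gtwist 0 (tinv 3 \<Phi>)) \<cdot> (gtwist 1 (gtwist 0 (tmap [\<Delta>, emb] F_inv)) \<cdot>
       gtwist 1 (gtwist 0 F_inv \<otimes> emb 1))))"
    unfolding inv[OF twisted_associator_tinv]
    by (simp add: leg_simps gtwist_coprod(1)[OF F_tpower(1)] del: One_nat_def)
  have \<Phi>132: "gtwist 1 \<Phi>\<^sub>F = gtwist 1 (F \<otimes> emb 1) \<cdot> (gtwist 1 (tmap [\<Delta>, emb] F) \<cdot> (gtwist 1 \<Phi> \<cdot>
      (gtwist 1 (tmap [emb, \<Delta>] F_inv) \<cdot> (emb 1 \<otimes> gtwist 0 F_inv))))"
    by (simp add: twist_associator_def leg_simps del: One_nat_def)
  show ?thesis
    unfolding L \<Phi>231 \<Phi>132 twisted_R_legs tinv_twisted_associator hexagon_left inv[OF associator_tinv]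
    by (simp add: leg_simps legs_cancel tmult_nested[OF R13_leg(1)] tmult_nested[OF R_legs(2)[OF F_tpower(1)]]
        del: One_nat_def)
qed

lemma twist_hexagon_right:
  "tmap [emb, \<Delta>\<^sub>F] R\<^sub>F =
     gtwist 0 (gtwist 1 \<Phi>\<^sub>F) \<cdot> gtwist 1 (R\<^sub>F \<otimes> emb 1) \<cdot> tinv 3 (gtwist 0 \<Phi>\<^sub>F) \<cdot> (R\<^sub>F \<otimes> emb 1) \<cdot> \<Phi>\<^sub>F"
proof -
  have inv: "tinv 3 (gtwist 0 X) = gtwist 0 Y" if "is_tinv 3 X Y" for X Y
    by (rule tinv_eqI[OF tensor_hom_is_tinv[OF gtwist_0_hom that]])
  have L: "tmap [emb, \<Delta>\<^sub>F] R\<^sub>F = (emb 1 \<otimes> F) \<cdot> (tmap [emb, \<Delta>] (gtwist 0 F) \<cdot> (tmap [emb, \<Delta>] R \<cdot>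
      (tmap [emb, \<Delta>] F_inv \<cdot> (emb 1 \<otimes> F_inv))))"
    using F_tpower F_flip_tpower R_tpower
    by (simp add: tmap2_twist twist_R_def tmult_tpower tmult_assoc tensor_homD(3)[OF tensor_homs(2)])
  have \<Phi>312: "gtwist 0 (gtwist 1 \<Phi>\<^sub>F) = (emb 1 \<otimes> F) \<cdot> (tmap [emb, \<Delta>] (gtwist 0 F) \<cdot>
      (gtwist 0 (gtwist 1 \<Phi>) \<cdot> (gtwist 0 (gtwist 1 (tmap [emb, \<Delta>] F_inv)) \<cdot>
       gtwist 1 (gtwist 0 F_inv \<otimes> emb 1))))"
    by (simp add: twist_associator_def leg_simps gtwist_coprod(2)[OF F_tpower(1)] gtwist_13[OF F_flip_tpower(2)]
        del: One_nat_def)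
  have \<Phi>213: "tinv 3 (gtwist 0 \<Phi>\<^sub>F) = gtwist 1 (F \<otimes> emb 1) \<cdot> (gtwist 0 (tmap [emb, \<Delta>] F) \<cdot> (gtwist 0 (tinv 3 \<Phi>) \<cdot>
      (gtwist 0 (tmap [\<Delta>, emb] F_inv) \<cdot> (gtwist 0 F_inv \<otimes> emb 1))))"
    unfolding inv[OF twisted_associator_tinv]
    by (simp add: leg_simps gtwist_13[OF F_tpower(1)] del: One_nat_def)
  show ?thesis
    unfolding L \<Phi>312 \<Phi>213 twisted_R_legs hexagon_right inv[OF associator_tinv]
    unfolding twist_associator_def
    by (simp add: leg_simps legs_cancel tmult_nested[OF R13_leg(2)] tmult_nested[OF R_legs(1)[OF F_tpower(1)]]
        del: One_nat_def)
qed

lemma twist_quasitriangular: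
  "quasitriangular_quasi_hopf_superalgebra scale gr \<Delta>\<^sub>F \<epsilon> \<Phi>\<^sub>F S \<alpha>\<^sub>F \<beta>\<^sub>F R\<^sub>F"
proof (intro quasitriangular_quasi_hopf_superalgebra.intro twist_quasi_hopf
    quasitriangular_quasi_hopf_superalgebra_axioms.intro)
  have "is_tinv 2 R\<^sub>F (F \<cdot> (tinv 2 R \<cdot> gtwist 0 F_inv))"
    unfolding twist_R_def by (intro is_tinv_tmult F_flip_tinv R_tinv F_tinv[THEN is_tinv_sym])
  then show "tensor_invertible 2 R\<^sub>F" by (auto simp: tensor_invertible_def)
  have "R\<^sub>F \<in> tpower_gr 2 0"
    unfolding twist_R_def by (intro tmult_even R_even F_even tensor_homD(2)[OF tensor_hom_gtwist_2])
  then show "tensor_homogeneous 2 R\<^sub>F" by (auto simp: tensor_homogeneous_def)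
qed (fact twist_R_intertwines twist_hexagon_left twist_hexagon_right)+

end

theorem theorem2:
  fixes scale :: "'k::field \<Rightarrow> 'a::ring_1 \<Rightarrow> 'a"
    and gr :: "bit \<Rightarrow> 'a set"
    and \<Delta> :: "'a \<Rightarrow> ('k, 'a) formal set"
    and \<epsilon> :: "'a \<Rightarrow> 'k"
    and \<Phi> R F :: "('k, 'a) formal set"
    and S :: "'a \<Rightarrow> 'a"
    and \<alpha> \<beta> :: 'a
  assumes "quasitriangular_quasi_hopf_superalgebra scale gr \<Delta> \<epsilon> \<Phi> S \<alpha> \<beta> R"
    and "superalgebra.tensor_invertible scale gr 2 F"
    and "superalgebra.tensor_homogeneous scale gr 2 F"
    and "superalgebra.tmap scale
           [superalgebra.emb_K scale \<circ> \<epsilon>, superalgebra.emb scale] F = superalgebra.tone scale 1"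
    and "superalgebra.tmap scale
           [superalgebra.emb scale, superalgebra.emb_K scale \<circ> \<epsilon>] F = superalgebra.tone scale 1"
  shows "quasitriangular_quasi_hopf_superalgebra scale gr
           (superalgebra.twist_coprod scale gr \<Delta> F) \<epsilon>
           (superalgebra.twist_associator scale gr \<Delta> F \<Phi>) S
           (superalgebra.twist_alpha scale gr S \<alpha> F)
           (superalgebra.twist_beta scale S \<beta> F)
           (superalgebra.twist_R scale gr F R)"
proof -
  interpret quasitriangular_quasi_hopf_superalgebra scale gr \<Delta> \<epsilon> \<Phi> S \<alpha> \<beta> R
    by (rule assms(1))
  interpret twisted_quasitriangular_quasi_hopf_superalgebra scale gr \<Delta> \<epsilon> \<Phi> S \<alpha> \<beta> R F
    by unfold_locales (rule assms(2-5))+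
  show ?thesis by (rule twist_quasitriangular)
qed

end
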